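(* In the market model of the context, assume that $\rho_{12}=\rho_{13}=0$, that the subordinators $\vartheta^j_t$ are the gamma subordinators of the context, $\vartheta^j_t=\gamma^j_t(a_j)$, $j=1,2,3$, with $\gamma^2,\gamma^3$ decomposed as in the context, and that $\gamma^3_t=\gamma^2_t=\kappa_2\gamma_t+\kappa_{21}\gamma^1_t$. Let $b=\kappa_{21}\left[\sum_{j=2}^{3}\left(\beta_j+\frac{\sigma_j^2}{2}\right)+\rho_{23}\sigma_2\sigma_3\right]$. Then the double inequality $$\sum_{n_1=0}^{N_1}\sum_{n_2=0}^{N_2}\sum_{n_3=0}^{N_3}\frac{\lambda_1^{n_1}\lambda_2^{n_2}\lambda_3^{n_3}T^{n_1+n_2+n_3}e^{-(\lambda_1+\lambda_2+\lambda_3)T}\,\mathrm{DC}(n_1,n_2,n_3)}{n_1!\,n_2!\,n_3!}\le\mathbb{DC}$$ $$\le\sum_{n_1=0}^{N_1}\sum_{n_2=0}^{N_2}\sum_{n_3=0}^{N_3}\frac{\lambda_1^{n_1}\lambda_2^{n_2}\lambda_3^{n_3}T^{n_1+n_2+n_3}e^{-(\lambda_1+\lambda_2+\lambda_3)T}\,\mathrm{DC}(n_1,n_2,n_3)}{n_1!\,n_2!\,n_3!}$$ $$+\,\mathrm{DC}(N_1,N_2,N_3)\left(1-\sum_{n_1=0}^{N_1}\frac{\lambda_1^{n_1}e^{-\lambda_1T}}{n_1!}\right)\left(1-\sum_{n_2=0}^{N_2}\frac{\lambda_2^{n_2}e^{-\lambda_2T}}{n_2!}\right)\left(1-\sum_{n_3=0}^{N_3}\frac{\lambda_3^{n_3}e^{-\lambda_3T}}{n_3!}\right)$$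 for the price $\mathbb{DC}$ holds for any $N_1,N_2,N_3$ with a decreasing function $\mathrm{DC}(n_1,n_2,n_3)$ and $$\mathrm{DC}(n_1,n_2,n_3)=\frac{e^{(\mu_2+\mu_3-r)T}a_1^{a_1T}}{(a_1-b)^{a_1T}\Gamma(a_1T)\sqrt{2\pi}}\,\mathrm{E}\big(e^{-\sum_{l=0}^{n_2}\xi_{2l}}\big)\mathrm{E}\big(e^{-\sum_{l=0}^{n_3}\xi_{3l}}\big)\left(\frac{a}{a-\kappa_2\left[\sum_{j=2}^{3}(\beta_j+\frac{\sigma_j^2}{2})+\rho_{23}\sigma_2\sigma_3\right]}\right)^{aT}$$ $$\times\left(\Lambda\,\mathrm{P}\Big(\sum_{l=0}^{n_1}\xi_{1l}=\mu_1T-K\Big)+\mathrm{E}\Big(\Xi\Big(\sum_{l=0}^{n_1}\xi_{1l}\Big)I_{\{\sum_{l=0}^{n_1}\xi_{1l}\neq\mu_1T-K\}}\Big)\right),$$ where $$\Lambda=\Gamma\left(a_1T+\tfrac12\right)\left(\frac{\mathrm{B}(\frac12,a_1T)}{\sqrt2}+\frac{\beta_1}{\sigma_1\sqrt{a_1-b}}\,\mathrm{G}\left(a_1T+\tfrac12,\tfrac12,\tfrac32;-\frac{\beta_1^2}{2(a_1-b)\sigma_1^2}\right)\right)$$ and $$\Xi(x)=|s|^{a_1T-\frac12}e^{s}(1+q)^{a_1T}\Big(\mathrm{B}(a_1T,1)\big(|s|\mathrm{M}_{a_1T+\frac12}(|s|)+s\,\mathrm{M}_{a_1T-\frac12}(|s|)\big)\mathrm{A}_0-(1+q)\,s\,\mathrm{B}(a_1T+1,1)\,\mathrm{M}_{a_1T-\frac12}(|s|)\,\mathrm{A}_1\Big)$$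 with $$q=\frac{\beta_1}{\sqrt{\beta_1^2+2(a_1-b)\sigma_1^2}},\qquad s=s(x)=\frac{(\mu_1T-K-x)\sqrt{\beta_1^2+2(a_1-b)\sigma_1^2}}{\sigma_1}$$ and $\mathrm{A}_j=\mathrm{A}\left(a_1T+j,\,1-a_1T,\,a_1T+1+j;\,\frac{1+q}{2},\,-s(1+q)\right)$, $j=0,1$.
   Context: Market model. Fix $T>0$, $K>0$. For $j=1,2,3$ and $t\le T$ the risky assets $S^j_t$ have log-returns $H^j_t=\log S^j_t=\mu_jt+\beta_j\vartheta^j_t+\sigma_jB^j_{\vartheta^j_t}-Z^j_t$, $H^j_0=0$, where $\mu_j,\beta_j\in\mathbb{R}$, $\sigma_j\ge0$; $B^1,B^2,B^3$ are Wiener processes correlated with coefficients $\rho_{jl}$; the subordinators $\vartheta^j$ are independent of the Wiener processes; $Z^j_t=\sum_{l=0}^{N^j_t}\xi_{jl}$ with $\xi_{j0}\equiv0$, $N^j$ a Poisson process with intensity $\lambda_j$, $N^j_0=0$, and $\xi_{jl}\ge0$, $l=1,2,\ldots$, independent random variables, identically distributed for every $j$ with arbitrary law. The compound Poisson processes $Z^1,Z^2,Z^3$ are mutually independent and independent of the time-changed Brownian motions. It is assumed that $\mathrm{E}(S^3_TS^2_T)<\infty$. $S^3$ is the exchange rate between the domestic and foreign currencies; $S^1,S^2$ are stock prices in the domestic currency; the domestic and foreign bank accounts are $R^d_t=e^{r_dt}$, $R^f_t=e^{rt}$ with $r_d,r\ge0$, and $S^3R^d/R^f$, $S^3S^1/R^f$,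 $S^3S^2/R^f$ are assumed to be martingales under the initial probability measure. The price of the digital asset-or-nothing call option in foreign currency is $\mathbb{DC}=e^{-rT}\mathrm{E}\big(S^3_TS^2_TI_{\{S^1_T\ge K\}}\big)$. Gamma subordinators. For $u,v>0$, $\gamma_t(u,v)$ is the Lévy process with $\gamma_0=0$ and probability density $v^{ut}x^{ut-1}e^{-vx}/\Gamma(ut)$, $x>0$, at time $t$; $\gamma_t(u)=\gamma_t(u,u)$ (unit mean rate). The subordinators are $\vartheta^j_t=\gamma^j_t=\gamma^j_t(a_j)$, $j=1,2,3$, and for $j=2,3$, $\gamma^j_t=\kappa_j\gamma_t(a)+\kappa_{j1}\gamma^1_t+\tilde\kappa_j\tilde\gamma^j_t(\tilde a_j)$, where the unit-mean-rate gamma processes $\gamma,\gamma^1,\tilde\gamma^2,\tilde\gamma^3$ are mutually independent, $\kappa_j,\kappa_{j1},\tilde\kappa_j\ge0$ and $\kappa_j+\kappa_{j1}+\tilde\kappa_j=1$. Consequently, for $j=2,3$, $a_j=a/\kappa_j$ if $\kappa_j>0$, $a_j=a_1/\kappa_{j1}$ if $\kappa_{j1}>0$, $a_j=\tilde a_j/\tilde\kappa_j$ if $\tilde\kappa_j>0$, and $a_j=aI_{\{\kappa_j>0\}}+a_1I_{\{\kappa_{j1}>0\}}+\tilde a_jI_{\{\tilde\kappa_j>0\}}$. Special functions. $\Gamma$ and $\mathrm{B}$ are the gamma and beta functions; $\mathrm{M}_{u_1}(u_2)$ is the MacDonald function (modified Bessel function of the second kind) of order $u_1\in\mathbb{R}$,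 $u_2>0$; $\mathrm{G}(u_1,u_2,u_3;u_4)$, $u_4<1$, is the Gauss hypergeometric function; $\mathrm{A}(u_1,u_2,u_3;u_4,u_5)=\sum_{m=0}^\infty\sum_{n=0}^\infty\frac{(u_1)_{m+n}(u_2)_m}{m!\,n!\,(u_3)_{m+n}}u_4^mu_5^n$, $|u_4|<1$, is the degenerate Appell function (Humbert series), with $(u)_l$ the Pochhammer symbol. $I_{\{\cdot\}}$ is the indicator.
   Formalization: Corrected: μ_1T−K becomes μ_1T−ln K; s is divided by σ_1² instead of σ_1; the factors 1−Σ get (λ_jT)^n for λ_j^n; the upper bound gains six terms for counts where only one or two n_j exceed N_j (false without: ξ≡0, λ_j=T=1, N_j=0); σ_1>0; decreasing means non-increasing. *)

theory Defs
  imports "HOL-Probability.Probability"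
begin

text \<open>
  Processes are curried functions of time and outcome; only times \<open>t \<ge> 0\<close> matter.  Path
  properties are required for every outcome, which is the usual choice of a good version and
  makes time-changed processes measurable.
\<close>

definition generated_sets ::
  "'a measure \<Rightarrow> 'i set \<Rightarrow> ('i \<Rightarrow> 'a \<Rightarrow> 'b::topological_space) \<Rightarrow> 'a set set" where
  "generated_sets M I X =
     sigma_sets (space M) {X i -` A \<inter> space M | i A. i \<in> I \<and> A \<in> sets borel}"

definition cadlag :: "(real \<Rightarrow> 'b::topological_space) \<Rightarrow> bool" where
  "cadlag f \<longleftrightarrow>
     (\<forall>t\<ge>0. (f \<longlongrightarrow> f t) (at_right t)) \<and> (\<forall>t>0. \<exists>l. (f \<longlongrightarrow> l) (at_left t))"

definition levy_process :: "'a measure \<Rightarrow> (real \<Rightarrow> 'a \<Rightarrow> 'b::euclidean_space) \<Rightarrow> bool" where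
  "levy_process M X \<longleftrightarrow>
     (\<forall>t\<ge>0. X t \<in> borel_measurable M) \<and>
     (\<forall>\<omega>\<in>space M. X 0 \<omega> = 0) \<and>
     (\<forall>\<tau>::nat \<Rightarrow> real. 0 \<le> \<tau> 0 \<and> mono \<tau> \<longrightarrow>
        prob_space.indep_vars M (\<lambda>_. borel) (\<lambda>i \<omega>. X (\<tau> (Suc i)) \<omega> - X (\<tau> i) \<omega>) UNIV) \<and>
     (\<forall>s\<ge>0. \<forall>t\<ge>0. distr M borel (\<lambda>\<omega>. X (s + t) \<omega> - X s \<omega>) = distr M borel (X t)) \<and>
     (\<forall>\<omega>\<in>space M. cadlag (\<lambda>t. X t \<omega>))"

text \<open>Centred normal law, including the degenerate case of variance \<open>0\<close>.\<close>

definition centred_gaussian :: "'a measure \<Rightarrow> ('a \<Rightarrow> real) \<Rightarrow> real \<Rightarrow> bool" where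
  "centred_gaussian M X v \<longleftrightarrow>
     0 \<le> v \<and> X \<in> borel_measurable M \<and>
     distr M borel X =
       (if v = 0 then return borel 0
        else density lborel (\<lambda>x. ennreal (normal_density 0 (sqrt v) x)))"

text \<open>
  Three Wiener processes \<open>B 1, B 2, B 3\<close> with correlation coefficients \<open>\<rho> j l\<close>, i.e. jointly a
  three-dimensional continuous Levy process whose value at time \<open>t\<close> is a Gaussian vector with
  covariance matrix \<open>t * \<rho> j l\<close> (Gaussian vectors being characterised by the laws of all linear
  combinations of their components).
\<close>

definition correlated_wiener ::
  "'a measure \<Rightarrow> (nat \<Rightarrow> nat \<Rightarrow> real) \<Rightarrow> (nat \<Rightarrow> real \<Rightarrow> 'a \<Rightarrow> real) \<Rightarrow> bool" where
  "correlated_wiener M \<rho> B \<longleftrightarrow>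
     (\<forall>j\<in>{1,2,3}. \<rho> j j = 1) \<and>
     (\<forall>j\<in>{1,2,3}. \<forall>l\<in>{1,2,3}. \<rho> j l = \<rho> l j) \<and>
     levy_process M (\<lambda>t \<omega>. (B 1 t \<omega>, B 2 t \<omega>, B 3 t \<omega>)) \<and>
     (\<forall>\<omega>\<in>space M. \<forall>j\<in>{1,2,3}. continuous_on {0..} (\<lambda>t. B j t \<omega>)) \<and>
     (\<forall>t\<ge>0. \<forall>u::nat \<Rightarrow> real.
        centred_gaussian M (\<lambda>\<omega>. \<Sum>j\<in>{1,2,3}. u j * B j t \<omega>)
          (t * (\<Sum>j\<in>{1,2,3}. \<Sum>l\<in>{1,2,3}. u j * u l * \<rho> j l)))"

definition gamma_process ::
  "'a measure \<Rightarrow> real \<Rightarrow> real \<Rightarrow> (real \<Rightarrow> 'a \<Rightarrow> real) \<Rightarrow> bool" where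
  "gamma_process M u v g \<longleftrightarrow>
     0 < u \<and> 0 < v \<and> levy_process M g \<and>
     (\<forall>\<omega>\<in>space M. mono_on {0..} (\<lambda>t. g t \<omega>)) \<and>
     (\<forall>t>0. distributed M lborel (g t)
        (\<lambda>x. ennreal (if 0 < x
           then v powr (u * t) * x powr (u * t - 1) * exp (- v * x) / Gamma (u * t) else 0)))"

definition poisson_process :: "'a measure \<Rightarrow> real \<Rightarrow> (real \<Rightarrow> 'a \<Rightarrow> nat) \<Rightarrow> bool" where
  "poisson_process M c N \<longleftrightarrow>
     0 \<le> c \<and> levy_process M (\<lambda>t \<omega>. real (N t \<omega>)) \<and>
     (\<forall>t\<ge>0. \<forall>n. measure M {\<omega>\<in>space M. N t \<omega> = n} = (c * t) ^ n / fact n * exp (- c * t))"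

definition martingale_upto ::
  "'a measure \<Rightarrow> (real \<Rightarrow> 'a measure) \<Rightarrow> real \<Rightarrow> (real \<Rightarrow> 'a \<Rightarrow> real) \<Rightarrow> bool" where
  "martingale_upto M F T X \<longleftrightarrow>
     (\<forall>t\<in>{0..T}. X t \<in> borel_measurable (F t) \<and> integrable M (X t)) \<and>
     (\<forall>s\<in>{0..T}. \<forall>t\<in>{s..T}. AE \<omega> in M. real_cond_exp M (F s) (X t) \<omega> = X s \<omega>)"

text \<open>
  The MacDonald function for \<open>x > 0\<close>, through the integral representation that covers integer
  and non-integer orders \<open>\<nu>\<close> alike.
\<close>

definition macdonald :: "real \<Rightarrow> real \<Rightarrow> real" where
  "macdonald \<nu> x = (LINT u:{0..}|lborel. exp (- x * cosh u) * cosh (\<nu> * u))"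

definition gauss_series :: "real \<Rightarrow> real \<Rightarrow> real \<Rightarrow> real \<Rightarrow> real" where
  "gauss_series a b c z =
     (\<Sum>n. pochhammer a n * pochhammer b n / (pochhammer c n * fact n) * z ^ n)"

text \<open>
  The Gauss hypergeometric function for real \<open>z < 1\<close>: the power series inside the unit disc, and
  for \<open>z \<le> -1\<close> its analytic continuation, given by Pfaff's transformation (note that
  \<open>1 / 2 \<le> z / (z - 1) < 1\<close> in that case).
\<close>

definition gauss_hypergeom :: "real \<Rightarrow> real \<Rightarrow> real \<Rightarrow> real \<Rightarrow> real" where
  "gauss_hypergeom a b c z =
     (if \<bar>z\<bar> < 1 then gauss_series a b c z
      else (1 - z) powr (- a) * gauss_series a (c - b) c (z / (z - 1)))"

definition appell_degenerate :: "real \<Rightarrow> real \<Rightarrow> real \<Rightarrow> real \<Rightarrow> real \<Rightarrow> real" where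
  "appell_degenerate a b c x y =
     (\<Sum>m. \<Sum>n. pochhammer a (m + n) * pochhammer b m
                / (fact m * fact n * pochhammer c (m + n)) * x ^ m * y ^ n)"

end

theory Submission
  imports Defs "HOL-Probability.Probability"
begin

text \<open>
Given the subordinators, the Wiener components that drive the second and third asset are independent
of the one that drives the first, although the two groups are read at different times. Averaging the
former out replaces the diffusive part of the payment \<open>S 3 T * S 2 T\<close> by \<open>exp (c * \<theta> 2 T)\<close>, where \<open>c\<close>
collects drifts and covariances. Since \<open>\<theta> 2\<close> is a combination of \<open>\<theta> 1\<close> and of an independent gamma process, this factor
splits into a gamma exponential moment and an exponential tilt \<open>exp (b * \<theta> 1 T)\<close> of the subordinator
that the exercise event sees (\<open>variance_gamma_tilt\<close>). For a fixed total jump \<open>z\<close> of the first asset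
the price is then a constant times the gamma mixture
\<open>\<integral> x powr (\<nu> - 1) * exp (- l * x) * \<Phi> ((\<beta> 1 * x + y) / (\<sigma> 1 * sqrt x)) dx\<close>
of the normal distribution function \<open>\<Phi>\<close>, with \<open>\<nu> = \<alpha> 1 * T\<close>, \<open>l = \<alpha> 1 - b\<close> and
\<open>y = \<mu> 1 * T - ln K - z\<close> (\<open>gamma_process_vg_mixture\<close>).

A change of scale turns the mixture into a function of the two parameters \<open>q\<close> and \<open>s\<close> alone. With \<open>s\<close>
fixed, its derivative in \<open>q\<close> is elementary up to two integrals
\<open>\<integral> t powr (m - 1) * exp (- t / 2 - s^2 / (2 * t)) dt\<close>, which are Macdonald functions of order
\<open>\<nu> + 1/2\<close> and \<open>\<nu> - 1/2\<close>. The mixture vanishes as \<open>q\<close> tends to \<open>-1\<close>, so it is the integral of that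
derivative over \<open>(-1, q)\<close>; Fubini's theorem makes this rigorous (\<open>std_normal_cdf_mixture\<close>). The
substitution \<open>u = (1 + q) * t - 1\<close> converts the integral over \<open>u\<close> into the Euler integrals of two
Humbert series (\<open>appell_degenerate_integral\<close>), which gives \<open>\<Xi>\<close>. For \<open>s = 0\<close> only the integral of
\<open>(1 - u^2) powr (\<nu> - 1)\<close> is left, a Gauss function up to its value at \<open>q = 0\<close>, which \<open>\<Phi> 0 = 1/2\<close>
determines; this gives \<open>\<Lambda>\<close>.

The bounds follow from the structure of the price. The three jump parts are independent of each
other and of the diffusive part, so the price is a constant times a product of three averages with
Poisson weights (\<open>independent_jumps_nn_integral\<close>, \<open>compound_poisson_expectation\<close>). Jumps are
nonnegative and \<open>\<Phi>\<close> is increasing, hence the averaged sequences decrease. Each average therefore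
exceeds its partial sum by something between zero and the last term times the Poisson tail
(\<open>weighted_average_truncation\<close>); the product of the three upper bounds expands into the eight
summands of the upper estimate. Integrability of \<open>S 3 T * S 2 T\<close> enters through the gamma exponential
moments: it forces \<open>\<kappa> 2 * c < a\<close> and \<open>b < \<alpha> 1\<close>, so the formulas make sense.
\<close>

section \<open>Bessel moments and the Macdonald function\<close>

lemma set_integrable_lebesgue:
  fixes f :: "real \<Rightarrow> real"
  assumes "set_integrable lborel S f"
  shows "f absolutely_integrable_on S"
  using assms unfolding set_integrable_def
  by (subst integrable_completion) auto

text \<open>
An unnormalised moment of the generalised inverse Gaussian law. In contrast to the Macdonald function
it also makes sense at \<open>s = 0\<close> when \<open>\<mu>\<close> is positive, which lets both closed forms come from one
integral formula.
\<close>

definition bessel_moment :: "real \<Rightarrow> real \<Rightarrow> real" where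
  "bessel_moment \<mu> s = (LINT t:{0<..}|lborel. t powr (\<mu> - 1) * exp (- t / 2 - s\<^sup>2 / (2 * t)))"

text \<open>
A Gaussian majorant for \<open>exp (- x * cosh v)\<close> is all that integrability needs, so the constant is not sharp.
\<close>

lemma cosh_ge_quadratic: "(v::real)\<^sup>2 / 4 \<le> cosh v"
proof -
  have "1 + \<bar>v\<bar> + \<bar>v\<bar>\<^sup>2 / 2 \<le> exp \<bar>v\<bar>"
    by (rule exp_lower_Taylor_quadratic) simp
  moreover have "exp \<bar>v\<bar> / 2 \<le> cosh \<bar>v\<bar>"
    by (simp add: cosh_def)
  ultimately show ?thesis by simp
qed

lemma integrable_exp_cosh:
  assumes x: "(x::real) > 0"
  shows "integrable lborel (\<lambda>v. exp (- x * cosh v) * exp (\<mu> * v))"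
proof (rule Bochner_Integration.integrable_bound)
  define c where "c = exp (\<mu>\<^sup>2 / x) * sqrt (2 * pi * (sqrt (2/x))\<^sup>2)"
  show "integrable lborel (\<lambda>v. c * normal_density (2 * \<mu> / x) (sqrt (2 / x)) v)"
    by (intro integrable_mult_right integrable_normal_density) (use x in auto)
  have "exp (- x * cosh v) * exp (\<mu> * v) \<le> c * normal_density (2 * \<mu> / x) (sqrt (2 / x)) v" for v
  proof -
    have "exp (- x * cosh v) * exp (\<mu> * v) \<le> exp (\<mu>\<^sup>2 / x + - (v - 2 * \<mu> / x)\<^sup>2 / (2 * (sqrt (2/x))\<^sup>2))"
    proof -
      have "- x * cosh v + \<mu> * v \<le> - x * (v\<^sup>2 / 4) + \<mu> * v"
        using cosh_ge_quadratic[of v] x by (simp add: mult_left_mono)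
      \<comment> \<open>completing the square exhibits a normal density with mean \<open>2 * \<mu> / x\<close> and variance \<open>2 / x\<close>\<close>
      also have "\<dots> = \<mu>\<^sup>2 / x + - (v - 2 * \<mu> / x)\<^sup>2 / (2 * (sqrt (2/x))\<^sup>2)"
        using x by (simp add: field_simps power2_eq_square)
      finally show ?thesis by (simp add: exp_add[symmetric])
    qed
    also have "\<dots> = c * normal_density (2 * \<mu> / x) (sqrt (2 / x)) v"
      using x by (simp add: c_def normal_density_def exp_add[symmetric])
    finally show ?thesis .
  qed
  then show "AE v in lborel. norm (exp (- x * cosh v) * exp (\<mu> * v))
      \<le> norm (c * normal_density (2 * \<mu> / x) (sqrt (2 / x)) v)"
    by (intro AE_I2) (smt (verit) real_norm_def mult_pos_pos exp_gt_zero)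
qed (auto simp: cosh_def)

text \<open>
The substitution \<open>t = \<bar>s\<bar> * exp v\<close> turns the exponent into \<open>- \<bar>s\<bar> * cosh v\<close> and \<open>t powr \<mu>\<close> into
\<open>\<bar>s\<bar> powr \<mu> * exp (\<mu> * v)\<close>; folding the real line at \<open>0\<close> replaces \<open>exp (\<mu> * v)\<close> by
\<open>2 * cosh (\<mu> * v)\<close>.
\<close>

lemma bessel_moment_macdonald:
  assumes s: "s \<noteq> 0"
  shows "set_integrable lborel {0<..} (\<lambda>t. t powr (\<mu> - 1) * exp (- t / 2 - s\<^sup>2 / (2 * t)))" (is ?I)
    and "bessel_moment \<mu> s = 2 * \<bar>s\<bar> powr \<mu> * macdonald \<mu> \<bar>s\<bar>" (is ?E)
proof -
  define x where "x = \<bar>s\<bar>"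
  have x: "x > 0" and sx: "s\<^sup>2 = x\<^sup>2" using s by (auto simp: x_def)
  define f where "f = (\<lambda>t. t powr (\<mu> - 1) * exp (- t / 2 - s\<^sup>2 / (2 * t)))"
  define h where "h = (\<lambda>v. exp (- x * cosh v) * exp (\<mu> * v))"
  have fg: "\<bar>x * exp v\<bar> * f (x * exp v) = x powr \<mu> * h v" for v
  proof -
    have "x * exp v * (x * exp v) powr (\<mu> - 1) = (x * exp v) powr \<mu>"
      using x by (simp add: powr_diff)
    also have "\<dots> = x powr \<mu> * exp (\<mu> * v)" using x
      by (simp add: powr_mult) (simp add: powr_def)
    finally have 1: "x * exp v * (x * exp v) powr (\<mu> - 1) = x powr \<mu> * exp (\<mu> * v)" .
    have 2: "- (x * exp v) / 2 - s\<^sup>2 / (2 * (x * exp v)) = - x * cosh v"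
      using x unfolding sx by (simp add: cosh_def exp_minus field_simps power2_eq_square)
    have "\<bar>x * exp v\<bar> * f (x * exp v) = (x * exp v * (x * exp v) powr (\<mu> - 1)) * exp (- (x * exp v) / 2 - s\<^sup>2 / (2 * (x * exp v)))"
      unfolding f_def using x by (simp add: mult.assoc)
    then show ?thesis unfolding 1 2 h_def by (simp add: mult.commute)
  qed
  have inth: "integrable lborel h" unfolding h_def by (rule integrable_exp_cosh[OF x])
  then have inth': "set_integrable lborel UNIV (\<lambda>v. x powr \<mu> * h v)"
    by (simp add: set_integrable_def)
  have rng: "range (\<lambda>v::real. x * exp v) = {0<..}"
  proof (intro equalityI subsetI)
    fix t :: real assume "t \<in> {0<..}"
    then have "t = x * exp (ln (t / x))" using x by simp
    then show "t \<in> range (\<lambda>v. x * exp v)" by blast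
  qed (use x in auto)
  have "f absolutely_integrable_on range (\<lambda>v. x * exp v) \<and>
      integral (range (\<lambda>v. x * exp v)) f = integral UNIV (\<lambda>v. x powr \<mu> * h v)"
  proof (subst has_absolute_integral_change_of_variables_1'[where g' = "\<lambda>v. x * exp v", symmetric])
    show "inj (\<lambda>v. x * exp v)" using x by (auto intro: injI)
    show "(\<lambda>v. \<bar>x * exp v\<bar> * f (x * exp v)) absolutely_integrable_on UNIV \<and>
      integral UNIV (\<lambda>v. \<bar>x * exp v\<bar> * f (x * exp v)) = integral UNIV (\<lambda>v. x powr \<mu> * h v)"
      unfolding fg using set_integrable_lebesgue[OF inth'] by simp
  qed (auto intro!: derivative_eq_intros)
  then have F: "f absolutely_integrable_on {0<..}"
    and F': "integral {0<..} f = integral UNIV (\<lambda>v. x powr \<mu> * h v)"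
    unfolding rng by auto
  have [measurable]: "f \<in> borel_measurable borel" unfolding f_def by measurable
  show I: ?I
    using F unfolding f_def[symmetric] set_integrable_def
    by (subst (asm) integrable_completion) auto
  have "bessel_moment \<mu> s = integral {0<..} f"
    unfolding bessel_moment_def f_def
    by (rule set_borel_integral_eq_integral(2)) (use I in simp)
  also have "\<dots> = (LINT v:UNIV|lborel. x powr \<mu> * h v)"
    unfolding F' by (rule set_borel_integral_eq_integral(2)[symmetric]) (fact inth')
  also have "\<dots> = x powr \<mu> * (LINT v|lborel. h v)"
    by (simp add: set_lebesgue_integral_def)
  also have "(LINT v|lborel. h v) = 2 * macdonald \<mu> x"
  proof -
    have inthm: "integrable lborel (\<lambda>v. h (- v))"
      using lborel_integrable_real_affine[OF inth, of "-1" 0] by simp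
    have eq: "h v + h (- v) = 2 * (exp (- x * cosh v) * cosh (\<mu> * v))" for v
      by (simp add: h_def cosh_def field_simps)
    have "(LINT v|lborel. h v) = (LINT v:{0..}|lborel. h v) + (LINT v:{..<0}|lborel. h v)"
    proof -
      have "(LINT v:{0..}\<union>{..<0}|lborel. h v) = (LINT v:{0..}|lborel. h v) + (LINT v:{..<0}|lborel. h v)"
        by (intro set_integral_Un) (use inth in \<open>auto simp: set_integrable_def simp del: real_scaleR_def intro!: integrable_mult_indicator\<close>)
      moreover have "{0..}\<union>{..<0} = (UNIV::real set)" by auto
      ultimately show ?thesis by (simp add: set_lebesgue_integral_def)
    qed
    also have "(LINT v:{..<0}|lborel. h v) = (LINT v|lborel. indicator {0<..} v * h (- v))"
      unfolding set_lebesgue_integral_def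
      by (subst lborel_integral_real_affine[where c = "-1" and t = 0])
         (auto intro!: Bochner_Integration.integral_cong simp: indicator_def)
    also have "\<dots> = (LINT v:{0..}|lborel. h (- v))"
      unfolding set_lebesgue_integral_def
    proof (rule integral_cong_AE)
      show "AE v in lborel. indicator {0<..} v * h (- v) = indicator {0..} v *\<^sub>R h (- v)"
        using AE_lborel_singleton[of "0::real"] by eventually_elim (auto split: split_indicator)
    qed (auto simp: h_def cosh_def)
    also have "(LINT v:{0..}|lborel. h v) + (LINT v:{0..}|lborel. h (- v)) = (LINT v:{0..}|lborel. h v + h (- v))"
      by (rule set_integral_add(2)[symmetric])
        (use inth inthm in \<open>auto simp: set_integrable_def simp del: real_scaleR_def intro!: integrable_mult_indicator\<close>)
    also have "\<dots> = 2 * macdonald \<mu> x"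
      unfolding eq macdonald_def by (rule set_integral_mult_right)
    finally show ?thesis .
  qed
  finally show ?E by (simp add: x_def)
qed

lemma bessel_moment_0:
  assumes \<mu>: "\<mu> > 0"
  shows "set_integrable lborel {0<..} (\<lambda>t. t powr (\<mu> - 1) * exp (- t / 2 - 0\<^sup>2 / (2 * t)))" (is ?I)
    and "bessel_moment \<mu> 0 = 2 powr \<mu> * Gamma \<mu>" (is ?E)
proof -
  have "has_bochner_integral lborel (\<lambda>t. indicator {0..} t * t powr (\<mu> - 1) / exp t) (Gamma \<mu>)"
    by (rule has_bochner_integral_nn_integral) (auto simp: Gamma_conv_nn_integral_real[OF \<mu>] Gamma_real_nonneg \<mu>)
  note lborel_has_bochner_integral_real_affine_iff[THEN iffD1, OF _ this, of "1/2" 0]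
  then have "has_bochner_integral lborel (\<lambda>t. 2 powr (\<mu> - 1) * (indicator {0..} (t/2) * (t/2) powr (\<mu> - 1) / exp (t/2))) (2 powr (\<mu> - 1) * (2 * Gamma \<mu>))"
    by (intro has_bochner_integral_mult_right) (auto simp: field_simps)
  moreover have "2 powr (\<mu> - 1) * (2 * Gamma \<mu>) = 2 powr \<mu> * Gamma \<mu>"
    by (simp add: powr_diff)
  moreover have "(\<lambda>t. 2 powr (\<mu> - 1) * (indicator {0..} (t/2) * (t/2) powr (\<mu> - 1) / exp (t/2)))
     = (\<lambda>t. indicator {0<..} t *\<^sub>R (t powr (\<mu> - 1) * exp (- t / 2 - 0\<^sup>2 / (2 * t))))"
    by (auto simp: fun_eq_iff indicator_def powr_divide exp_minus field_simps)
  ultimately have *: "has_bochner_integral lborel (\<lambda>t. indicator {0<..} t *\<^sub>R (t powr (\<mu> - 1) * exp (- t / 2 - 0\<^sup>2 / (2 * t)))) (2 powr \<mu> * Gamma \<mu>)"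
    by simp
  show ?I using * unfolding set_integrable_def by (rule integrable.intros)
  show ?E using * unfolding bessel_moment_def set_lebesgue_integral_def by (rule has_bochner_integral_integral_eq)
qed

section \<open>The Humbert series as an Euler integral\<close>

lemma powr_integral_unit_interval:
  assumes c: "(c::real) > 0"
  shows "has_bochner_integral lborel (\<lambda>t. indicator {0<..<1} t * t powr (c - 1)) (1 / c)"
proof -
  have "((\<lambda>t. t powr (c - 1)) has_integral (1 / c)) {0..1}"
    using has_integral_powr_from_0[of "c - 1" 1] c by simp
  then have "((\<lambda>t. t powr (c - 1)) has_integral (1 / c)) {0<..<1}"
    by (simp add: has_integral_Icc_iff_Ioo)
  then have "(\<integral>\<^sup>+t. ennreal (indicator {0<..<1} t * t powr (c - 1)) \<partial>lborel) = ennreal (1 / c)"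
    by (intro nn_integral_has_integral_lebesgue) auto
  then show ?thesis
    using c by (intro has_bochner_integral_nn_integral) auto
qed

text \<open>
The incomplete gamma integral that arises when the inner sum of the Humbert series is carried out.
\<close>

lemma exp_powr_integral_sums:
  assumes c: "(c::real) > 0"
  shows "integrable lborel (\<lambda>t. indicator {0<..<1} t * (t powr (c - 1) * exp (y * t)))"
    and "(\<lambda>n. y ^ n / (fact n * (c + n))) sums
      (LINT t|lborel. indicator {0<..<1} t * (t powr (c - 1) * exp (y * t)))"
proof -
  define g where "g = (\<lambda>n t::real. y ^ n / fact n * (indicator {0<..<1} t * t powr (c + n - 1)))"
  have g: "has_bochner_integral lborel (g n) (y ^ n / fact n * (1 / (c + n)))" for n
    unfolding g_def using c by (intro has_bochner_integral_mult_right powr_integral_unit_interval) auto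
  have ng: "norm (g n t) = \<bar>y\<bar> ^ n / fact n * (indicator {0<..<1} t * t powr (c + n - 1))" for n t
    by (simp add: g_def abs_mult power_abs)
  have "has_bochner_integral lborel (\<lambda>t. norm (g n t)) (\<bar>y\<bar> ^ n / fact n * (1 / (c + n)))" for n
    unfolding ng using c by (intro has_bochner_integral_mult_right powr_integral_unit_interval) auto
  then have Ig: "(LINT t|lborel. norm (g n t)) = \<bar>y\<bar> ^ n / fact n * (1 / (c + n))" for n
    by (rule has_bochner_integral_integral_eq)
  have gt: "(\<lambda>n. g n t) sums (indicator {0<..<1} t * (t powr (c - 1) * exp (y * t)))" for t
  proof -
    have "(\<lambda>n. (indicator {0<..<1} t * t powr (c - 1)) * ((y * t) ^ n /\<^sub>R fact n)) sums
      ((indicator {0<..<1} t * t powr (c - 1)) * exp (y * t))"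
      by (intro sums_mult exp_converges)
    moreover have "(indicator {0<..<1} t * t powr (c - 1)) * ((y * t) ^ n /\<^sub>R fact n) = g n t" for n
      by (auto simp: g_def indicator_def powr_add powr_diff powr_realpow power_mult_distrib field_simps)
    ultimately show ?thesis by (simp add: mult.assoc)
  qed
  have sum_n: "summable (\<lambda>n. norm (g n t))" for t
  proof (rule summable_comparison_test)
    have "norm (g n t) \<le> (indicator {0<..<1} t * t powr (c - 1)) * (\<bar>y * t\<bar> ^ n /\<^sub>R fact n)" for n
      unfolding ng
      by (auto simp: indicator_def powr_add powr_diff powr_realpow power_mult_distrib abs_mult field_simps)
    then show "\<exists>N. \<forall>n\<ge>N. norm (norm (g n t)) \<le> (indicator {0<..<1} t * t powr (c - 1)) * (\<bar>y * t\<bar> ^ n /\<^sub>R fact n)"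
      by auto
    show "summable (\<lambda>n. (indicator {0<..<1} t * t powr (c - 1)) * (\<bar>y * t\<bar> ^ n /\<^sub>R fact n))"
      by (intro summable_mult summable_exp_generic)
  qed
  have sum_I: "summable (\<lambda>n. LINT t|lborel. norm (g n t))"
  proof (rule summable_comparison_test)
    show "\<exists>N. \<forall>n\<ge>N. norm (LINT t|lborel. norm (g n t)) \<le> \<bar>y\<bar> ^ n /\<^sub>R fact n * (1 / c)"
    proof (intro exI[of _ 0] allI impI)
      fix n
      have "\<bar>y\<bar> ^ n / fact n * (1 / (c + n)) \<le> \<bar>y\<bar> ^ n / fact n * (1 / c)"
        using c by (intro mult_left_mono frac_le) auto
      then show "norm (LINT t|lborel. norm (g n t)) \<le> \<bar>y\<bar> ^ n /\<^sub>R fact n * (1 / c)"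
        unfolding Ig using c by (simp add: divide_inverse mult_ac)
    qed
    show "summable (\<lambda>n. \<bar>y\<bar> ^ n /\<^sub>R fact n * (1 / c))"
      by (intro summable_mult2 summable_exp_generic)
  qed
  have int: "integrable lborel (g n)" for n using g by (rule integrable.intros)
  have eq: "(\<lambda>t. \<Sum>n. g n t) = (\<lambda>t. indicator {0<..<1} t * (t powr (c - 1) * exp (y * t)))"
    using gt by (auto simp: sums_iff)
  show "integrable lborel (\<lambda>t. indicator {0<..<1} t * (t powr (c - 1) * exp (y * t)))"
    unfolding eq[symmetric] by (rule integrable_suminf[OF int _ sum_I]) (intro AE_I2 sum_n)
  have "(\<lambda>n. LINT t|lborel. g n t) sums (LINT t|lborel. (\<Sum>n. g n t))"
    by (rule sums_integral[OF int _ sum_I]) (intro AE_I2 sum_n)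
  then show "(\<lambda>n. y ^ n / (fact n * (c + n))) sums
      (LINT t|lborel. indicator {0<..<1} t * (t powr (c - 1) * exp (y * t)))"
    unfolding eq has_bochner_integral_integral_eq[OF g] by simp
qed

text \<open>
This is Newton's binomial series in Pochhammer notation. Absolute convergence follows from convergence
at a point of larger modulus.
\<close>

lemma pochhammer_binomial_sums:
  fixes b z :: real
  assumes z: "\<bar>z\<bar> < 1"
  shows "(\<lambda>m. pochhammer b m / fact m * z ^ m) sums (1 - z) powr (- b)"
    and "summable (\<lambda>m. \<bar>pochhammer b m / fact m * z ^ m\<bar>)"
proof -
  have eq: "((- b) gchoose m) * (- w) ^ m = pochhammer b m / fact m * w ^ m" for m and w :: real
  proof -
    have "((- 1) ^ m * (- w) ^ m) = w ^ m" by (simp flip: power_mult_distrib)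
    then show ?thesis by (simp add: gbinomial_pochhammer field_simps)
  qed
  have *: "(\<lambda>m. pochhammer b m / fact m * w ^ m) sums (1 - w) powr (- b)" if "\<bar>w\<bar> < 1" for w :: real
    using gen_binomial_real[of "- w" "- b"] that unfolding eq by simp
  show "(\<lambda>m. pochhammer b m / fact m * z ^ m) sums (1 - z) powr (- b)" by (rule *[OF z])
  define k where "k = (1 + \<bar>z\<bar>) / 2"
  have k: "\<bar>k\<bar> < 1" "norm z < norm k" using z by (auto simp: k_def)
  have "summable (\<lambda>m. norm (pochhammer b m / fact m * z ^ m))"
    by (rule powser_insidea[OF sums_summable[OF *[OF k(1)]] k(2)])
  then show "summable (\<lambda>m. \<bar>pochhammer b m / fact m * z ^ m\<bar>)" by simp
qed

text \<open>
In the Humbert series and in the Gauss series with parameters \<open>1/2\<close> and \<open>3/2\<close> a numerator and a denominator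
parameter differ by one, and this quotient is the integral of a power.
\<close>

lemma pochhammer_quotient_Suc:
  assumes "(a::real) > 0"
  shows "pochhammer a n / pochhammer (a + 1) n = a / (a + n)"
proof -
  have "pochhammer (a + 1) n > 0" using assms by (intro pochhammer_pos) auto
  moreover have "a * pochhammer (a + 1) n = pochhammer a n * (a + n)"
    by (metis pochhammer_Suc pochhammer_rec)
  ultimately show ?thesis using assms by (simp add: field_simps)
qed

text \<open>
Because \<open>c = a + 1\<close>, the quotient of Pochhammer symbols is \<open>a / (a + m + n)\<close>, that is, \<open>a\<close> times the
integral of \<open>t powr (a + m + n - 1)\<close> over the unit interval. Summation over \<open>n\<close> yields the exponential
and summation over \<open>m\<close> the binomial factor; dominated convergence allows both interchanges.
\<close>

lemma appell_degenerate_integral: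
  fixes a b x y :: real
  assumes a: "a > 0" and x: "\<bar>x\<bar> < 1"
  shows "set_integrable lborel {0<..<1} (\<lambda>t. t powr (a - 1) * (1 - x * t) powr (- b) * exp (y * t))"
    and "appell_degenerate a b (a + 1) x y =
      a * (LINT t:{0<..<1}|lborel. t powr (a - 1) * (1 - x * t) powr (- b) * exp (y * t))"
proof -
  define E where "E c = (LINT t|lborel. indicator {0<..<1} t * (t powr (c - 1) * exp (y * t)))" for c
  define w where "w m = pochhammer b m / fact m" for m
  define f where "f = (\<lambda>m t::real. (w m * x ^ m) * (indicator {0<..<1} t * (t powr (a + m - 1) * exp (y * t))))"
  have E: "(\<lambda>n. y ^ n / (fact n * (c + n))) sums E c" if "c > 0" for c :: real
    unfolding E_def by (rule exp_powr_integral_sums(2)[OF that])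
  have f: "integrable lborel (f m)" for m
    unfolding f_def using a by (intro integrable_mult_right exp_powr_integral_sums(1)) auto
  have If: "(LINT t|lborel. f m t) = w m * x ^ m * E (a + m)" for m
    unfolding f_def E_def by simp
  have fle: "norm (f m t) \<le> \<bar>w m * x ^ m\<bar> * (indicator {0<..<1} t * (t powr (a - 1) * exp (y * t)))" for m t
  proof -
    have "t powr (a + m - 1) \<le> t powr (a - 1)" if "0 < t" "t < 1"
      using that by (intro powr_mono') auto
    then show ?thesis unfolding f_def by (auto simp: abs_mult indicator_def intro!: mult_left_mono)
  qed
  have sw: "summable (\<lambda>m. \<bar>w m * x ^ m\<bar>)"
    unfolding w_def by (rule pochhammer_binomial_sums(2)[OF x])
  have sum_n: "summable (\<lambda>m. norm (f m t))" for t
    by (rule summable_comparison_test[OF _ summable_mult2[OF sw]]) (use fle in auto)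
  have sum_I: "summable (\<lambda>m. LINT t|lborel. norm (f m t))"
  proof (rule summable_comparison_test[OF _ summable_mult2[OF sw]], intro exI[of _ 0] allI impI)
    fix m
    have "(LINT t|lborel. norm (f m t)) \<le> (LINT t|lborel. \<bar>w m * x ^ m\<bar> * (indicator {0<..<1} t * (t powr (a - 1) * exp (y * t))))"
      by (intro integral_mono integrable_mult_right exp_powr_integral_sums(1)[OF a] integrable_norm f fle)
    then show "norm (LINT t|lborel. norm (f m t)) \<le> \<bar>w m * x ^ m\<bar> * E a"
      by (simp add: E_def)
  qed
  have eq: "(\<lambda>t. \<Sum>m. f m t) = (\<lambda>t. indicator {0<..<1} t *\<^sub>R (t powr (a - 1) * (1 - x * t) powr (- b) * exp (y * t)))"
  proof
    fix t :: real
    have "(\<lambda>m. f m t) sums (indicator {0<..<1} t *\<^sub>R (t powr (a - 1) * (1 - x * t) powr (- b) * exp (y * t)))"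
    proof (cases "t \<in> {0<..<1}")
      case True
      then have "\<bar>x * t\<bar> < 1" using x mult_strict_mono[of "\<bar>x\<bar>" 1 "\<bar>t\<bar>" 1] by (auto simp: abs_mult)
      from sums_mult[OF pochhammer_binomial_sums(1)[OF this, of b], of "t powr (a - 1) * exp (y * t)"]
      have "(\<lambda>m. t powr (a - 1) * exp (y * t) * (w m * (x * t) ^ m)) sums (t powr (a - 1) * exp (y * t) * (1 - x * t) powr (- b))"
        by (simp add: w_def)
      moreover have "t powr (a - 1) * exp (y * t) * (w m * (x * t) ^ m) = f m t" for m
        using True by (simp add: f_def powr_add powr_diff powr_realpow power_mult_distrib)
      ultimately show ?thesis using True by (simp add: mult.commute mult.left_commute)
    qed (simp add: f_def)
    then show "(\<Sum>m. f m t) = indicator {0<..<1} t *\<^sub>R (t powr (a - 1) * (1 - x * t) powr (- b) * exp (y * t))"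
      by (simp add: sums_iff)
  qed
  show "set_integrable lborel {0<..<1} (\<lambda>t. t powr (a - 1) * (1 - x * t) powr (- b) * exp (y * t))"
    unfolding set_integrable_def eq[symmetric] by (rule integrable_suminf[OF f _ sum_I]) (intro AE_I2 sum_n)
  have "(\<lambda>m. LINT t|lborel. f m t) sums (LINT t|lborel. (\<Sum>m. f m t))"
    by (rule sums_integral[OF f _ sum_I]) (intro AE_I2 sum_n)
  then have S: "(\<lambda>m. w m * x ^ m * E (a + m)) sums
      (LINT t:{0<..<1}|lborel. t powr (a - 1) * (1 - x * t) powr (- b) * exp (y * t))"
    unfolding If eq set_lebesgue_integral_def .
  have inner: "(\<Sum>n. pochhammer a (m + n) * pochhammer b m / (fact m * fact n * pochhammer (a + 1) (m + n)) * x ^ m * y ^ n)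
     = a * (w m * x ^ m * E (a + m))" for m
  proof -
    have "pochhammer a (m + n) * pochhammer b m / (fact m * fact n * pochhammer (a + 1) (m + n)) * x ^ m * y ^ n
      = (a * (w m * x ^ m)) * (y ^ n / (fact n * ((a + m) + n)))" for n
    proof -
      have "pochhammer a (m + n) * pochhammer b m / (fact m * fact n * pochhammer (a + 1) (m + n)) * x ^ m * y ^ n
        = (pochhammer a (m + n) / pochhammer (a + 1) (m + n)) * (w m * x ^ m) * (y ^ n / fact n)"
        by (simp add: w_def field_simps)
      also have "\<dots> = (a * (w m * x ^ m)) * (y ^ n / (fact n * ((a + m) + n)))"
        unfolding pochhammer_quotient_Suc[OF a] by (simp add: add.assoc)
      finally show ?thesis .
    qed
    then show ?thesis
      using sums_mult[OF E[of "a + m"], of "a * (w m * x ^ m)"] a by (simp add: sums_iff mult.assoc)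
  qed
  show "appell_degenerate a b (a + 1) x y =
      a * (LINT t:{0<..<1}|lborel. t powr (a - 1) * (1 - x * t) powr (- b) * exp (y * t))"
    unfolding appell_degenerate_def inner using sums_mult[OF S, of a] by (simp add: sums_iff)
qed

section \<open>The Gauss hypergeometric function as an integral\<close>

text \<open>
Writing the series as \<open>x * P (x^2)\<close> keeps the index of the coefficients in step with that of the
hypergeometric series.
\<close>

lemma odd_power_series_has_real_derivative:
  fixes c :: "nat \<Rightarrow> real"
  assumes c: "\<And>w. \<bar>w\<bar> < 1 \<Longrightarrow> summable (\<lambda>n. c n * w ^ n)" and x: "\<bar>x\<bar> < 1"
  shows "((\<lambda>x. x * (\<Sum>n. c n * (x\<^sup>2) ^ n)) has_real_derivative
      (\<Sum>n. (2 * real n + 1) * c n * (x\<^sup>2) ^ n)) (at x)"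
    and "summable (\<lambda>n. (2 * real n + 1) * c n * (x\<^sup>2) ^ n)"
proof -
  define w where "w = x\<^sup>2"
  have w: "0 \<le> w" "w < 1" using x by (auto simp: w_def abs_square_less_1)
  define k where "k = (1 + w) / 2"
  have k: "\<bar>k\<bar> < 1" "norm w < norm k" using w by (auto simp: k_def)
  define P where "P w = (\<Sum>n. c n * w ^ n)" for w
  define P' where "P' = (\<Sum>n. diffs c n * w ^ n)"
  have dP: "(P has_real_derivative P') (at w)"
    unfolding P_def[abs_def] P'_def by (rule termdiffs_strong[OF c[OF k(1)] k(2)])
  have "summable (\<lambda>n. diffs c n * w ^ n)"
    by (rule termdiff_converges[where K = 1]) (use w c in auto)
  from diffs_equiv[OF this] have "(\<lambda>n. of_nat n * c n * w ^ (n - Suc 0)) sums P'"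
    unfolding P'_def .
  from sums_mult[OF this, of "2 * w"]
  have "(\<lambda>n. 2 * w * (n * c n * w ^ (n - Suc 0))) sums (2 * w * P')" by simp
  moreover have "2 * w * (n * c n * w ^ (n - Suc 0)) = 2 * real n * c n * w ^ n" for n
    by (cases n) auto
  ultimately have "(\<lambda>n. 2 * real n * c n * w ^ n) sums (2 * w * P')" by simp
  moreover have "(\<lambda>n. c n * w ^ n) sums P w"
    unfolding P_def using c[of w] w by (intro summable_sums) auto
  ultimately have "(\<lambda>n. c n * w ^ n + 2 * real n * c n * w ^ n) sums (P w + 2 * w * P')"
    by (intro sums_add)
  moreover have "c n * w ^ n + 2 * real n * c n * w ^ n = (2 * real n + 1) * c n * w ^ n" for n
    by (simp add: algebra_simps)
  ultimately have S: "(\<lambda>n. (2 * real n + 1) * c n * w ^ n) sums (P w + 2 * w * P')" by (simp only:)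
  have "((\<lambda>x. P (x\<^sup>2)) has_real_derivative P' * (2 * x)) (at x)"
    by (rule DERIV_chain2[where f = P]) (use dP in \<open>auto simp: w_def intro!: derivative_eq_intros\<close>)
  from DERIV_mult[OF DERIV_ident this]
  have "((\<lambda>x. x * P (x\<^sup>2)) has_real_derivative P w + 2 * w * P') (at x)"
    by (simp add: w_def power2_eq_square algebra_simps)
  moreover have "(\<Sum>n. (2 * real n + 1) * c n * w ^ n) = P w + 2 * w * P'"
    using S by (simp add: sums_iff)
  ultimately show "((\<lambda>x. x * (\<Sum>n. c n * (x\<^sup>2) ^ n)) has_real_derivative
      (\<Sum>n. (2 * real n + 1) * c n * (x\<^sup>2) ^ n)) (at x)"
    unfolding w_def[symmetric] by (simp only: P_def)
  show "summable (\<lambda>n. (2 * real n + 1) * c n * (x\<^sup>2) ^ n)"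
    using S by (simp add: sums_iff w_def)
qed

text \<open>
Here the factor \<open>2 * n + 1\<close> from differentiation cancels the quotient of the Pochhammer symbols of
\<open>1/2\<close> and \<open>3/2\<close>, and what remains is the binomial series.
\<close>

lemma gauss_series_has_real_derivative:
  assumes z: "\<bar>z\<bar> < 1"
  shows "((\<lambda>z. z * gauss_series a (1/2) (3/2) (- z\<^sup>2)) has_real_derivative (1 + z\<^sup>2) powr (- a)) (at z)"
proof -
  define c where "c n = pochhammer a n * pochhammer (1/2) n / (pochhammer (3/2) n * fact n) * (- 1) ^ n" for n
  have c: "c n = pochhammer a n / fact n * (- 1) ^ n / (2 * real n + 1)" for n
  proof -
    have "c n = pochhammer a n / fact n * (pochhammer (1/2) n / pochhammer (1/2 + 1) n) * (- 1) ^ n"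
      by (simp add: c_def)
    then show ?thesis
      unfolding pochhammer_quotient_Suc[of "1/2", OF half_gt_zero[OF zero_less_one]]
      by (simp add: field_simps)
  qed
  have gs: "gauss_series a (1/2) (3/2) (- z\<^sup>2) = (\<Sum>n. c n * (z\<^sup>2) ^ n)" for z
    unfolding gauss_series_def c_def by (simp add: power_minus[of "z\<^sup>2"] mult.assoc)
  have sum: "summable (\<lambda>n. c n * w ^ n)" if w: "\<bar>w\<bar> < 1" for w
  proof (rule summable_comparison_test[OF _ pochhammer_binomial_sums(2)[OF w, of a]], intro exI[of _ 0] allI impI)
    fix n
    have "\<bar>c n * w ^ n\<bar> = \<bar>pochhammer a n / fact n * w ^ n\<bar> * (1 / (2 * real n + 1))"
      unfolding c by (simp add: abs_mult power_abs)
    also have "\<dots> \<le> \<bar>pochhammer a n / fact n * w ^ n\<bar> * 1"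
      by (intro mult_left_mono) auto
    finally show "norm (c n * w ^ n) \<le> \<bar>pochhammer a n / fact n * w ^ n\<bar>" by simp
  qed
  have w: "\<bar>- z\<^sup>2\<bar> < 1" using z by (simp add: abs_square_less_1)
  have "(\<Sum>n. (2 * real n + 1) * c n * (z\<^sup>2) ^ n) = (1 + z\<^sup>2) powr (- a)"
  proof -
    have "(2 * real n + 1) * c n * (z\<^sup>2) ^ n = pochhammer a n / fact n * (- z\<^sup>2) ^ n" for n
    proof -
      have "(2 * real n + 1) \<noteq> 0" by (simp add: add_nonneg_eq_0_iff)
      then have "(2 * real n + 1) * c n = pochhammer a n / fact n * (- 1) ^ n"
        by (simp only: c times_divide_eq_right) (rule nonzero_mult_div_cancel_left)
      then show ?thesis unfolding power_minus[of "z\<^sup>2"] by (simp add: mult.assoc)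
    qed
    then show ?thesis using pochhammer_binomial_sums(1)[OF w, of a] by (simp add: sums_iff)
  qed
  then show ?thesis
    using odd_power_series_has_real_derivative(1)[OF sum z] unfolding gs by simp
qed

text \<open>
Used to bound the coefficients of a hypergeometric series by binomial coefficients.
\<close>

lemma fact_le_pochhammer:
  assumes "1 \<le> (x::real)"
  shows "fact n \<le> pochhammer x n"
proof (induction n)
  case (Suc n)
  have "fact (Suc n) = fact n * (1 + real n)" by (simp add: mult.commute)
  also have "\<dots> \<le> pochhammer x n * (x + real n)"
    using Suc assms by (intro mult_mono) (auto intro: order_trans[OF fact_ge_zero])
  finally show ?case by (simp add: pochhammer_Suc)
qed simp

text \<open>
The recursion of the coefficients says that \<open>G x = \<Sum>n. c n * x ^ (2 * n + 1)\<close> solves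
\<open>(1 - x^2) * G' = 1 + 2 * \<nu> * x * G\<close>. Multiplication by \<open>(1 - x^2) powr \<nu>\<close> integrates this equation.
\<close>

lemma gauss_series_one_has_real_derivative:
  assumes q: "\<bar>q\<bar> < 1" and \<nu>: "\<nu> > 0"
  shows "((\<lambda>q. q * (1 - q\<^sup>2) powr \<nu> * gauss_series (\<nu> + 1/2) 1 (3/2) (q\<^sup>2))
     has_real_derivative (1 - q\<^sup>2) powr (\<nu> - 1)) (at q)"
proof -
  define c where "c n = pochhammer (\<nu> + 1/2) n / pochhammer (3/2) n" for n
  have gs: "gauss_series (\<nu> + 1/2) 1 (3/2) w = (\<Sum>n. c n * w ^ n)" for w
    unfolding gauss_series_def c_def by (simp add: pochhammer_fact[symmetric])
  have sum: "summable (\<lambda>n. c n * w ^ n)" if w: "\<bar>w\<bar> < 1" for w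
  proof (rule summable_comparison_test[OF _ pochhammer_binomial_sums(2)[OF w, of "\<nu> + 1/2"]], intro exI[of _ 0] allI impI)
    fix n
    have "0 \<le> pochhammer (\<nu> + 1/2) n" using \<nu> by (intro pochhammer_nonneg) auto
    moreover have "fact n \<le> pochhammer (3/2::real) n" by (rule fact_le_pochhammer) simp
    moreover have "(fact n::real) > 0" by simp
    ultimately have "\<bar>c n\<bar> \<le> \<bar>pochhammer (\<nu> + 1/2) n / fact n\<bar>"
      unfolding c_def abs_divide by (intro divide_left_mono mult_pos_pos) linarith+
    then show "norm (c n * w ^ n) \<le> \<bar>pochhammer (\<nu> + 1/2) n / fact n * w ^ n\<bar>"
      unfolding abs_mult real_norm_def by (rule mult_right_mono) simp
  qed
  define w where "w = q\<^sup>2"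
  have w: "\<bar>w\<bar> < 1" "w < 1" using q by (auto simp: w_def abs_square_less_1)
  define P where "P = (\<Sum>n. c n * w ^ n)"
  define S where "S = (\<Sum>n. (2 * real n + 1) * c n * w ^ n)"
  note dS = odd_power_series_has_real_derivative[OF sum q, folded w_def, folded S_def]
  have rec: "(2 * real n + 3) * c (Suc n) = (2 * real n + 1 + 2 * \<nu>) * c n" for n
  proof -
    have p: "pochhammer (3/2::real) n > 0" by (rule pochhammer_pos) simp
    have "c (Suc n) = c n * ((\<nu> + 1/2 + n) / (3/2 + n))"
      unfolding c_def pochhammer_Suc by simp
    also have "\<dots> * (2 * real n + 3) = (2 * real n + 1 + 2 * \<nu>) * c n"
      by (simp add: field_simps)
    finally show ?thesis by (simp add: mult.commute)
  qed
  have "(\<lambda>n. (2 * real n + 3) * c (Suc n) * w ^ Suc n) sums (S - 1)"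
    using sums_split_initial_segment[OF summable_sums[OF dS(2)], of 1, folded S_def]
    by (simp add: c_def add.commute)
  moreover have "(\<lambda>n. w * ((2 * real n + 1) * c n * w ^ n) + 2 * \<nu> * w * (c n * w ^ n)) sums (w * S + 2 * \<nu> * w * P)"
    unfolding S_def P_def by (intro sums_add sums_mult summable_sums dS(2) sum w)
  moreover have "w * ((2 * real n + 1) * c n * w ^ n) + 2 * \<nu> * w * (c n * w ^ n) = (2 * real n + 3) * c (Suc n) * w ^ Suc n" for n
    unfolding rec by (simp add: algebra_simps)
  ultimately have "S - 1 = w * S + 2 * \<nu> * w * P" by (simp add: sums_iff)
  then have ODE: "(1 - w) * S - 2 * \<nu> * w * P = 1" by (simp add: algebra_simps)
  have d1: "((\<lambda>q::real. (1 - q\<^sup>2) powr \<nu>) has_real_derivative (\<nu> * (1 - w) powr (\<nu> - 1)) * (- 2 * q)) (at q)"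
    unfolding w_def by (rule DERIV_chain2[OF has_real_derivative_powr])
       (use w in \<open>auto simp: w_def intro!: derivative_eq_intros\<close>)
  have "((\<lambda>q. (1 - q\<^sup>2) powr \<nu> * (q * (\<Sum>n. c n * (q\<^sup>2) ^ n))) has_real_derivative
     (\<nu> * (1 - w) powr (\<nu> - 1)) * (- 2 * q) * (q * P) + S * (1 - w) powr \<nu>) (at q)"
    using DERIV_mult[OF d1 dS(1)] by (simp add: w_def P_def)
  moreover have "(\<nu> * (1 - w) powr (\<nu> - 1)) * (- 2 * q) * (q * P) + S * (1 - w) powr \<nu> = (1 - w) powr (\<nu> - 1)"
  proof -
    have e: "(1 - w) powr \<nu> = (1 - w) powr (\<nu> - 1) * (1 - w)"
      using w by (simp add: powr_diff)
    have "(\<nu> * (1 - w) powr (\<nu> - 1)) * (- 2 * q) * (q * P) + S * (1 - w) powr \<nu>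
      = (1 - w) powr (\<nu> - 1) * ((1 - w) * S - 2 * \<nu> * w * P)"
      unfolding e by (simp add: w_def power2_eq_square algebra_simps)
    then show ?thesis unfolding ODE by simp
  qed
  ultimately show ?thesis unfolding gs by (simp add: w_def mult_ac)
qed

text \<open>
In the variable \<open>q\<close> with \<open>z = q / sqrt (1 - q^2)\<close> both branches of the definition become the same function
of \<open>q\<close>: Pfaff's form directly, the power series because the two sides agree at \<open>0\<close> and have equal
derivatives. The right-hand side has the advantage of being defined for all \<open>q\<close> of modulus below one.
\<close>

lemma gauss_hypergeom_eq_gauss_series_one:
  fixes q \<nu> :: real
  assumes q: "\<bar>q\<bar> < 1" and \<nu>: "\<nu> > 0"
  defines "z \<equiv> q / sqrt (1 - q\<^sup>2)"
  shows "z * gauss_hypergeom (\<nu> + 1/2) (1/2) (3/2) (- z\<^sup>2)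
    = q * (1 - q\<^sup>2) powr \<nu> * gauss_series (\<nu> + 1/2) 1 (3/2) (q\<^sup>2)"
proof -
  define g where "g q = q * (1 - q\<^sup>2) powr \<nu> * gauss_series (\<nu> + 1/2) 1 (3/2) (q\<^sup>2)" for q
  have d: "1 - q\<^sup>2 > 0" using q by (simp add: abs_square_less_1)
  have zz: "z\<^sup>2 = q\<^sup>2 / (1 - q\<^sup>2)" using d by (simp add: z_def power_divide)
  have z1: "1 + z\<^sup>2 = 1 / (1 - q\<^sup>2)" unfolding zz using d by (simp add: field_simps)
  have sz: "sqrt (1 + z\<^sup>2) = 1 / sqrt (1 - q\<^sup>2)" unfolding z1 by (simp add: real_sqrt_divide)
  have qz: "q = z / sqrt (1 + z\<^sup>2)" unfolding sz unfolding z_def using d by simp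
  show ?thesis
  proof (cases "\<bar>z\<bar> < 1")
    case True
    define f where "f x = x * gauss_series (\<nu> + 1/2) (1/2) (3/2) (- x\<^sup>2) - g (x / sqrt (1 + x\<^sup>2))" for x
    have "(f has_real_derivative 0) (at x)" if x: "\<bar>x\<bar> < 1" for x
    proof -
      define p where "p = 1 + x\<^sup>2"
      have p: "p > 0" "p \<noteq> 0" by (auto simp: p_def add_pos_nonneg add_nonneg_eq_0_iff)
      define y where "y = x / sqrt p"
      have y2: "1 - y\<^sup>2 = 1 / p" using p by (simp add: y_def power_divide p_def field_simps)
      have "y\<^sup>2 < 1" using y2 p by (metis diff_gt_0_iff_gt zero_less_divide_1_iff)
      then have y: "\<bar>y\<bar> < 1" by (simp add: abs_square_less_1)
      have sq: "((\<lambda>x. sqrt (1 + x\<^sup>2)) has_real_derivative x / sqrt p) (at x)"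
        using p by (auto intro!: derivative_eq_intros simp: p_def field_simps)
      have "((\<lambda>x. x / sqrt (1 + x\<^sup>2)) has_real_derivative (1 * sqrt (1 + x\<^sup>2) - x * (x / sqrt p)) / (sqrt (1 + x\<^sup>2) * sqrt (1 + x\<^sup>2))) (at x)"
        by (rule DERIV_divide, rule DERIV_ident, rule sq) (use p in \<open>simp add: p_def\<close>)
      also have "(1 * sqrt (1 + x\<^sup>2) - x * (x / sqrt p)) / (sqrt (1 + x\<^sup>2) * sqrt (1 + x\<^sup>2)) = 1 / (p * sqrt p)"
      proof -
        have "sqrt p - x * (x / sqrt p) = (sqrt p * sqrt p - x * x) / sqrt p" using p by (simp add: field_simps)
        also have "sqrt p * sqrt p - x * x = 1" using p by (simp add: p_def power2_eq_square)
        finally show ?thesis using p by (simp add: p_def[symmetric] mult.commute)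
      qed
      finally have dy: "((\<lambda>x. x / sqrt (1 + x\<^sup>2)) has_real_derivative 1 / (p * sqrt p)) (at x)" .
      have "(g has_real_derivative (1 / p) powr (\<nu> - 1)) (at (x / sqrt (1 + x\<^sup>2)))"
        using gauss_series_one_has_real_derivative[OF y \<nu>] unfolding g_def[abs_def] y2 by (simp add: y_def p_def)
      from DERIV_chain2[OF this dy]
      have dg: "((\<lambda>x. g (x / sqrt (1 + x\<^sup>2))) has_real_derivative (1 / p) powr (\<nu> - 1) * (1 / (p * sqrt p))) (at x)" .
      have "(1 / p) powr (\<nu> - 1) * (1 / (p * sqrt p)) = p powr (- (\<nu> + 1/2))"
      proof -
        have "(1 / p) powr (\<nu> - 1) = p powr (1 - \<nu>)" using p by (simp add: powr_divide powr_minus_divide[symmetric])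
        moreover have "1 / (p * sqrt p) = p powr (- (3/2))"
        proof -
          have "p * sqrt p = p powr 1 * p powr (1/2)" using p by (simp add: powr_half_sqrt)
          then show ?thesis unfolding powr_add[symmetric] by (simp add: powr_minus_divide)
        qed
        moreover have "(1 - \<nu>) + (- (3/2)) = - (\<nu> + 1/2)" by simp
        ultimately show ?thesis by (simp only: powr_add[symmetric])
      qed
      with dg have dg': "((\<lambda>x. g (x / sqrt (1 + x\<^sup>2))) has_real_derivative (1 + x\<^sup>2) powr (- (\<nu> + 1/2))) (at x)"
        by (simp add: p_def)
      show ?thesis
        unfolding f_def[abs_def]
        using DERIV_diff[OF gauss_series_has_real_derivative[OF x, of "\<nu> + 1/2"] dg'] by simp
    qed
    then have "(f has_real_derivative 0) (at x within {- 1<..<1})" if "x \<in> {- 1<..<1}" for x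
      by (rule has_field_derivative_at_within) (use that in \<open>auto simp: abs_less_iff\<close>)
    then have "\<exists>c. \<forall>x\<in>{- 1<..<1}. f x = c"
      by (intro has_field_derivative_zero_constant) auto
    then obtain c where c: "\<And>x. x \<in> {- 1<..<1} \<Longrightarrow> f x = c" by blast
    have "z \<in> {- 1<..<1}" using True by (auto simp: abs_less_iff)
    then have "f z = f 0" using c[of z] c[of 0] by simp
    also have "f 0 = 0" by (simp add: f_def g_def)
    finally have "z * gauss_series (\<nu> + 1/2) (1/2) (3/2) (- z\<^sup>2) = g q" unfolding f_def qz[symmetric] by simp
    then show ?thesis using True by (simp add: gauss_hypergeom_def g_def abs_square_less_1)
  next
    case False
    have "\<not> \<bar>- z\<^sup>2\<bar> < 1" using False by (simp add: abs_square_less_1)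
    moreover have "- z\<^sup>2 / (- z\<^sup>2 - 1) = q\<^sup>2"
    proof -
      have "- z\<^sup>2 - 1 = - (1 + z\<^sup>2)" by simp
      then have "- z\<^sup>2 / (- z\<^sup>2 - 1) = z\<^sup>2 / (1 + z\<^sup>2)" by (simp only: minus_divide_divide)
      then show ?thesis unfolding z1 unfolding zz using d by simp
    qed
    ultimately have G: "gauss_hypergeom (\<nu> + 1/2) (1/2) (3/2) (- z\<^sup>2)
      = (1 + z\<^sup>2) powr (- (\<nu> + 1/2)) * gauss_series (\<nu> + 1/2) 1 (3/2) (q\<^sup>2)"
      by (simp add: gauss_hypergeom_def)
    have "z * (1 + z\<^sup>2) powr (- (\<nu> + 1/2)) = q * (1 - q\<^sup>2) powr \<nu>"
    proof -
      have "(1 + z\<^sup>2) powr (- (\<nu> + 1/2)) = (1 - q\<^sup>2) powr \<nu> * sqrt (1 - q\<^sup>2)"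
        unfolding z1 powr_minus using d by (simp only: powr_divide powr_add powr_half_sqrt) simp
      then show ?thesis unfolding z_def using d by simp
    qed
    then show ?thesis unfolding G by simp
  qed
qed

section \<open>Gamma mixtures of the normal distribution function\<close>

abbreviation std_normal_cdf :: "real \<Rightarrow> real" where
  "std_normal_cdf \<equiv> cdf std_normal_distribution"

interpretation std_normal: real_distribution std_normal_distribution
  by (rule real_dist_normal_dist)

lemma std_normal_cdf_bounds: "0 \<le> std_normal_cdf x" "std_normal_cdf x \<le> 1"
  by (simp_all add: cdf_def)

lemma std_normal_cdf_mono: "x \<le> y \<Longrightarrow> std_normal_cdf x \<le> std_normal_cdf y"
  by (rule std_normal.cdf_nondecreasing)

lemma std_normal_cdf_measurable [measurable]: "std_normal_cdf \<in> borel_measurable borel"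
  by (intro borel_measurable_mono monoI std_normal_cdf_mono)

lemma std_normal_density_set_integrable:
  "A \<in> sets borel \<Longrightarrow> set_integrable lborel A std_normal_density"
  by (auto simp: set_integrable_def simp del: real_scaleR_def intro!: integrable_mult_indicator)

lemma std_normal_measure:
  assumes A[measurable]: "A \<in> sets borel"
  shows "measure std_normal_distribution A = (LINT z:A|lborel. std_normal_density z)"
proof -
  have "emeasure std_normal_distribution A = (\<integral>\<^sup>+z. ennreal (indicator A z *\<^sub>R std_normal_density z) \<partial>lborel)"
    by (subst emeasure_density) (auto intro!: nn_integral_cong simp: indicator_def)
  also have "\<dots> = ennreal (LINT z:A|lborel. std_normal_density z)"
    unfolding set_lebesgue_integral_def
    by (intro nn_integral_eq_integral)
      (use std_normal_density_set_integrable[OF A] in \<open>auto simp: set_integrable_def\<close>)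
  finally show ?thesis
    by (simp add: measure_def set_lebesgue_integral_def integral_nonneg_AE)
qed

text \<open>
The distribution function differs from its value at a point to the left by an integral of the continuous
density.
\<close>

lemma std_normal_cdf_has_real_derivative:
  "(std_normal_cdf has_real_derivative std_normal_density x) (at x)"
proof -
  define a where "a = x - 1"
  have cdf_eq: "std_normal_cdf y = (LINT z:{..y}|lborel. std_normal_density z)" for y
    unfolding cdf_def by (rule std_normal_measure) simp
  have cont: "continuous_on S std_normal_density" for S
    unfolding std_normal_density_def[abs_def] by (intro continuous_intros) auto
  have "((\<lambda>y. std_normal_cdf a + integral {a..y} std_normal_density) has_real_derivative 0 + std_normal_density x)
      (at x within {a..x + 1})"
    by (intro derivative_intros integral_has_real_derivative cont) (auto simp: a_def)
  then have "((\<lambda>y. std_normal_cdf a + integral {a..y} std_normal_density) has_real_derivative std_normal_density x)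
      (at x)"
    by (subst (asm) at_within_interior) (auto simp: a_def)
  moreover have "\<forall>\<^sub>F y in nhds x. std_normal_cdf y = std_normal_cdf a + integral {a..y} std_normal_density"
  proof (rule eventually_nhds_in_open[THEN eventually_mono])
    fix y assume y: "y \<in> {a<..}"
    have "{..y} = {..a} \<union> {a<..y}" using y by auto
    then have "std_normal_cdf y = std_normal_cdf a + (LINT z:{a<..y}|lborel. std_normal_density z)"
      unfolding cdf_eq by (simp only:) (intro set_integral_Un std_normal_density_set_integrable, auto)
    also have "(LINT z:{a<..y}|lborel. std_normal_density z) = integral {a<..y} std_normal_density"
      by (intro set_borel_integral_eq_integral std_normal_density_set_integrable) auto
    also have "\<dots> = integral {a..y} std_normal_density"
      by (rule integral_spike_set) (auto intro!: negligible_subset[OF negligible_sing[of a]])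
    finally show "std_normal_cdf y = std_normal_cdf a + integral {a..y} std_normal_density" .
  qed (auto simp: a_def)
  ultimately show ?thesis by (subst DERIV_cong_ev[OF refl _ refl])
qed

text \<open>
An affine change of variables of the Beta integral with equal parameters.
\<close>

lemma integrable_one_minus_square_powr:
  assumes \<nu>: "(\<nu>::real) > 0"
  shows "set_integrable lborel {-1<..<1} (\<lambda>u. (1 - u\<^sup>2) powr (\<nu> - 1))"
proof -
  have "integrable lborel (\<lambda>t. indicator {0..1} t *\<^sub>R (t powr (\<nu> - 1) * (1 - t) powr (\<nu> - 1)))"
    using integrable_Beta[OF \<nu> \<nu>] by (simp add: set_integrable_def)
  from lborel_integrable_real_affine[OF this, of "1/2" "1/2"]
  have 1: "integrable lborel (\<lambda>u. indicator {0..1} (1/2 + 1/2 * u) *\<^sub>R ((1/2 + 1/2 * u) powr (\<nu> - 1) * (1 - (1/2 + 1/2 * u)) powr (\<nu> - 1)))"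
    by simp
  have int4: "integrable lborel (\<lambda>u. 4 powr (\<nu> - 1) * (indicator {0..1} (1/2 + 1/2 * u) *\<^sub>R ((1/2 + 1/2 * u) powr (\<nu> - 1) * (1 - (1/2 + 1/2 * u)) powr (\<nu> - 1))))"
    by (rule integrable_mult_right[OF 1])
  have eq: "4 powr (\<nu> - 1) * (indicator {0..1} (1/2 + 1/2 * u) *\<^sub>R ((1/2 + 1/2 * u) powr (\<nu> - 1) * (1 - (1/2 + 1/2 * u)) powr (\<nu> - 1)))
    = indicator {-1<..<1} u *\<^sub>R (1 - u\<^sup>2) powr (\<nu> - 1)" for u :: real
  proof (cases "u \<in> {-1<..<1}")
    case True
    have "1 - u\<^sup>2 = 4 * ((1/2 + 1/2 * u) * (1 - (1/2 + 1/2 * u)))"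
      by (simp add: field_simps power2_eq_square)
    then have "(1 - u\<^sup>2) powr (\<nu> - 1) = 4 powr (\<nu> - 1) * ((1/2 + 1/2 * u) powr (\<nu> - 1) * (1 - (1/2 + 1/2 * u)) powr (\<nu> - 1))"
      using True by (simp only: powr_mult) 
    then show ?thesis using True by (simp add: indicator_def)
  next
    case False
    then have "u = 1 \<or> u = -1 \<or> 1/2 + 1/2 * u \<notin> {0..1}" by auto
    then show ?thesis using False by auto
  qed
  show ?thesis using int4 unfolding set_integrable_def eq .
qed

text \<open>
The argument of the normal distribution function in the gamma mixture after all scales have been
removed. It is chosen so that \<open>vg_arg s u ((1 - u^2) * t / 2) = u * sqrt t + s / sqrt t\<close> for \<open>\<bar>u\<bar> < 1\<close> and \<open>t > 0\<close>.
\<close>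

definition vg_arg :: "real \<Rightarrow> real \<Rightarrow> real \<Rightarrow> real" where
  "vg_arg s u \<tau> = sqrt (2 * \<tau>) * u / sqrt (1 - u\<^sup>2) + s * sqrt (1 - u\<^sup>2) / sqrt (2 * \<tau>)"

lemma vg_arg_tendsto_at_bot:
  assumes \<tau>: "\<tau> > 0"
  shows "filterlim (\<lambda>u. vg_arg s u \<tau>) at_bot (at_right (-1))"
proof -
  define c where "c = sqrt (2 * \<tau>)"
  have c: "c > 0" using \<tau> by (simp add: c_def)
  have d: "((\<lambda>u::real. sqrt (1 - u\<^sup>2)) \<longlongrightarrow> 0) (at_right (-1))"
    by (auto intro!: tendsto_eq_intros)
  have pos: "\<forall>\<^sub>F u::real in at_right (-1). 0 < sqrt (1 - u\<^sup>2)"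
    by (rule eventually_at_right_field[THEN iffD2]) (auto intro!: exI[of _ 0] simp: abs_square_less_1 abs_if)
  have "filterlim (\<lambda>u::real. inverse (sqrt (1 - u\<^sup>2))) at_top (at_right (-1))"
    by (rule filterlim_inverse_at_top[OF d pos])
  moreover have "((\<lambda>u::real. c * u) \<longlongrightarrow> - c) (at_right (-1))"
    by (auto intro!: tendsto_eq_intros)
  ultimately have 1: "filterlim (\<lambda>u. (c * u) * inverse (sqrt (1 - u\<^sup>2))) at_bot (at_right (-1))"
    using c by (intro filterlim_tendsto_neg_mult_at_bot[where c = "- c"]) auto
  have "((\<lambda>u. s * sqrt (1 - u\<^sup>2) / c) \<longlongrightarrow> 0) (at_right (-1))"
    using c by (auto intro!: tendsto_eq_intros)
  from filterlim_tendsto_add_at_bot_iff[OF this, THEN iffD2, OF 1] show ?thesis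
    unfolding vg_arg_def c_def by (simp add: divide_inverse add.commute)
qed

lemma vg_arg_has_real_derivative:
  assumes u: "-1 < u" "u < 1" and \<tau>: "\<tau> > 0"
  shows "((\<lambda>u. vg_arg s u \<tau>) has_real_derivative
    sqrt (2 * \<tau>) / ((1 - u\<^sup>2) * sqrt (1 - u\<^sup>2)) - s * u / (sqrt (1 - u\<^sup>2) * sqrt (2 * \<tau>))) (at u)"
proof -
  define c where "c = sqrt (2 * \<tau>)"
  have c: "c > 0" using \<tau> by (simp add: c_def)
  have d: "1 - u\<^sup>2 > 0" using u by (simp add: abs_square_less_1 abs_less_iff)
  define r where "r = sqrt (1 - u\<^sup>2)"
  have r: "r > 0" "r\<^sup>2 = 1 - u\<^sup>2" using d by (auto simp: r_def)
  have sq: "((\<lambda>u. sqrt (1 - u\<^sup>2)) has_real_derivative - u / r) (at u)"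
    using d unfolding r_def by (auto intro!: derivative_eq_intros simp: field_simps)
  have "((\<lambda>u. c * u / sqrt (1 - u\<^sup>2) + s * sqrt (1 - u\<^sup>2) / c) has_real_derivative
     ((c * 1) * sqrt (1 - u\<^sup>2) - (c * u) * (- u / r)) / (sqrt (1 - u\<^sup>2) * sqrt (1 - u\<^sup>2)) + s * (- u / r) / c) (at u)"
    by (rule DERIV_add, rule DERIV_divide, rule DERIV_cmult, rule DERIV_ident, rule sq,
        use d in simp, rule DERIV_cdivide, rule DERIV_cmult, rule sq)
  then have "((\<lambda>u. c * u / sqrt (1 - u\<^sup>2) + s * sqrt (1 - u\<^sup>2) / c) has_real_derivative
     (c * r - c * u * (- u / r)) / (r * r) + s * (- u / r) / c) (at u)"
    by (simp only: r_def mult_1_right)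
  moreover have "(c * r - c * u * (- u / r)) / (r * r) + s * (- u / r) / c = c / (r\<^sup>2 * r) - s * u / (r * c)"
  proof -
    have "c * r - c * u * (- u / r) = c * (r\<^sup>2 + u\<^sup>2) / r" using r(1) by (simp add: field_simps power2_eq_square)
    also have "\<dots> = c / r" unfolding r(2) by simp
    finally show ?thesis using r(1) by (simp add: power2_eq_square mult.commute)
  qed
  ultimately show ?thesis unfolding vg_arg_def c_def[symmetric] r_def[symmetric] r(2)[symmetric] using r(1) by simp
qed

text \<open>
Write \<open>\<Phi> (vg_arg s q \<tau>)\<close> as the integral of its derivative in \<open>u\<close> over \<open>(-1, q)\<close> and interchange the
integrals. For fixed \<open>u\<close>, the substitution \<open>\<tau> = (1 - u^2) * t / 2\<close> turns \<open>\<tau> + (vg_arg s u \<tau>)^2 / 2\<close> into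
\<open>t / 2 + u * s + s^2 / (2 * t)\<close>, so the inner integral is a combination of two Bessel moments. The
integrand changes sign, hence Fubini's theorem requires absolute integrability, which the Beta
weight provides. The product \<open>s * bessel_moment (\<nu> - 1/2) s\<close> is kept together because the second factor
may diverge at \<open>s = 0\<close>.
\<close>

lemma std_normal_cdf_mixture:
  fixes \<nu> q s :: real
  assumes \<nu>: "\<nu> > 0" and q: "-1 < q" "q < 1"
  defines "w \<equiv> (\<lambda>u. (1 - u\<^sup>2) powr (\<nu> - 1) * exp (- s * u)
      * (bessel_moment (\<nu> + 1/2) s - u * (s * bessel_moment (\<nu> - 1/2) s)))"
  shows "set_integrable lborel {-1<..<q} w"
    and "sqrt (2 * pi) * (LINT \<tau>:{0<..}|lborel. \<tau> powr (\<nu> - 1) * exp (- \<tau>) * std_normal_cdf (vg_arg s q \<tau>))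
      = 2 powr (- \<nu>) * (LINT u:{-1<..<q}|lborel. w u)"
proof -
  define A' where "A' u \<tau> = sqrt (2 * \<tau>) / ((1 - u\<^sup>2) * sqrt (1 - u\<^sup>2)) - s * u / (sqrt (1 - u\<^sup>2) * sqrt (2 * \<tau>))" for u \<tau>
  define f where "f u \<tau> = (indicator {-1<..<q} u * indicator {0<..} \<tau>) *
      (\<tau> powr (\<nu> - 1) * exp (- \<tau>) * exp (- (vg_arg s u \<tau>)\<^sup>2 / 2) * A' u \<tau>)" for u \<tau> :: real
  define k where "k \<mu> t = indicator {0<..} t * (t powr (\<mu> - 1) * exp (- t / 2 - s\<^sup>2 / (2 * t)))" for \<mu> t :: real
  have kint: "integrable lborel (k (\<nu> + 1/2))"
  proof (cases "s = 0")
    case True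
    then show ?thesis using bessel_moment_0(1)[of "\<nu> + 1/2"] \<nu> by (simp add: k_def[abs_def] set_integrable_def)
  next
    case False
    then show ?thesis using bessel_moment_macdonald(1)[of s "\<nu> + 1/2"] by (simp add: k_def[abs_def] set_integrable_def)
  qed
  have kint': "integrable lborel (\<lambda>t. s * k (\<nu> - 1/2) t)"
  proof (cases "s = 0")
    case False
    then show ?thesis using bessel_moment_macdonald(1)[of s "\<nu> - 1/2"] by (simp add: k_def[abs_def] set_integrable_def)
  qed simp
  have k_nonneg: "0 \<le> k \<mu> t" for \<mu> t by (simp add: k_def)
  have bk: "(LINT t|lborel. k \<mu> t) = bessel_moment \<mu> s" for \<mu>
    by (simp add: k_def bessel_moment_def set_lebesgue_integral_def)
  have [measurable]: "case_prod f \<in> borel_measurable (lborel \<Otimes>\<^sub>M lborel)"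
    unfolding f_def[abs_def] A'_def[abs_def] vg_arg_def[abs_def] by measurable
  define c where "c u = 2 powr (- \<nu>) * ((1 - u\<^sup>2) powr (\<nu> - 1) * exp (- s * u))" for u
  have d_pos: "0 < 1 - u\<^sup>2" if "-1 < u" "u < q" for u
    using that q by (simp add: abs_square_less_1 abs_less_iff)
  have fk: "\<bar>(1 - u\<^sup>2) / 2\<bar> * f u (0 + (1 - u\<^sup>2) / 2 * t) = c u * (k (\<nu> + 1/2) t - u * (s * k (\<nu> - 1/2) t))"
    if u: "-1 < u" "u < q" for u t
  proof (cases "t > 0")
    case False
    then show ?thesis using d_pos[OF u] by (simp add: f_def k_def zero_less_mult_iff)
  next
    case t: True
    define d where "d = 1 - u\<^sup>2"
    have d: "d > 0" using d_pos[OF u] by (simp add: d_def)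
    have sq: "sqrt (2 * (d / 2 * t)) = sqrt d * sqrt t" by (simp add: real_sqrt_mult)
    have rr: "sqrt d * sqrt d = d" "sqrt t * sqrt t = t" using d t by auto
    have arg: "vg_arg s u (d / 2 * t) = u * sqrt t + s / sqrt t"
      unfolding vg_arg_def d_def[symmetric] sq using d t by (simp add: field_simps)
    have arg2: "(vg_arg s u (d / 2 * t))\<^sup>2 = u\<^sup>2 * t + 2 * u * s + s\<^sup>2 / t"
      unfolding arg using t by (simp add: power2_sum power_mult_distrib power_divide)
    have A': "A' u (d / 2 * t) = (sqrt t - s * u / sqrt t) / d"
    proof -
      have "A' u (d / 2 * t) = sqrt d * sqrt t / (d * sqrt d) - s * u / ((sqrt d * sqrt d) * sqrt t)"
        unfolding A'_def d_def[symmetric] sq by (simp add: mult.assoc)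
      also have "\<dots> = (sqrt t - s * u / sqrt t) / d"
        unfolding rr using d t by (simp add: field_simps)
      finally show ?thesis .
    qed
    have E: "exp (- (d / 2 * t)) * exp (- (vg_arg s u (d / 2 * t))\<^sup>2 / 2) = exp (- s * u) * exp (- t / 2 - s\<^sup>2 / (2 * t))"
      unfolding arg2 exp_add[symmetric] unfolding d_def using t by (simp add: field_simps)
    have P1: "t powr (\<nu> - 1) * sqrt t = t powr (\<nu> + 1/2 - 1)"
      using t by (simp add: powr_half_sqrt[symmetric] powr_add[symmetric])
    have P2: "t powr (\<nu> - 1) / sqrt t = t powr (\<nu> - 1/2 - 1)"
      using t by (simp add: powr_half_sqrt[symmetric] powr_diff[symmetric])
    have P: "(d / 2 * t) powr (\<nu> - 1) = 2 powr (- \<nu>) * 2 * d powr (\<nu> - 1) * t powr (\<nu> - 1)"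
      using d t by (simp add: powr_mult powr_divide powr_diff powr_minus field_simps)
    have "\<bar>d / 2\<bar> * f u (0 + d / 2 * t) = d / 2 * ((d / 2 * t) powr (\<nu> - 1) * (exp (- (d / 2 * t)) * exp (- (vg_arg s u (d / 2 * t))\<^sup>2 / 2)) * A' u (d / 2 * t))"
      using d t u by (simp add: f_def mult.assoc)
    also have "\<dots> = d / 2 * ((2 powr (- \<nu>) * 2 * d powr (\<nu> - 1) * t powr (\<nu> - 1)) * (exp (- s * u) * exp (- t / 2 - s\<^sup>2 / (2 * t))) * ((sqrt t - s * u / sqrt t) / d))"
      unfolding E A' P ..
    also have "\<dots> = c u * (exp (- t / 2 - s\<^sup>2 / (2 * t)) * (t powr (\<nu> - 1) * sqrt t - u * (s * (t powr (\<nu> - 1) / sqrt t))))"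
      unfolding c_def d_def[symmetric] using d by (simp add: field_simps)
    also have "\<dots> = c u * (k (\<nu> + 1/2) t - u * (s * k (\<nu> - 1/2) t))"
      unfolding P1 P2 k_def using t by (simp add: algebra_simps)
    finally show ?thesis by (simp add: d_def)
  qed
  have f_out: "f u = (\<lambda>\<tau>. 0)" if "\<not> (-1 < u \<and> u < q)" for u using that by (auto simp: f_def)
  have intk: "integrable lborel (\<lambda>t. c u * (k (\<nu> + 1/2) t - u * (s * k (\<nu> - 1/2) t)))" for u
    by (intro integrable_mult_right Bochner_Integration.integrable_diff kint kint')
  have intf: "integrable lborel (f u)" for u
  proof (cases "-1 < u \<and> u < q")
    case True
    then have "integrable lborel (\<lambda>t. \<bar>(1 - u\<^sup>2) / 2\<bar> * f u (0 + (1 - u\<^sup>2) / 2 * t))"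
      using intk[of u] fk[of u] by simp
    then have "integrable lborel (\<lambda>t. f u (0 + (1 - u\<^sup>2) / 2 * t))"
      using d_pos[of u] True by (simp only: integrable_mult_left_iff) auto
    then show ?thesis
      using d_pos[of u] True lborel_integrable_real_affine_iff[of "(1 - u\<^sup>2) / 2" "f u" 0] by auto
  qed (simp add: f_out)
  have Intf: "(LINT \<tau>|lborel. f u \<tau>) = indicator {-1<..<q} u * (2 powr (- \<nu>) * w u)" for u
  proof (cases "-1 < u \<and> u < q")
    case True
    then have "(LINT \<tau>|lborel. f u \<tau>) = (LINT t|lborel. \<bar>(1 - u\<^sup>2) / 2\<bar> * f u (0 + (1 - u\<^sup>2) / 2 * t))"
      using d_pos[of u] by (subst lborel_integral_real_affine[of "(1 - u\<^sup>2) / 2" _ 0]) auto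
    also have "\<dots> = (LINT t|lborel. c u * (k (\<nu> + 1/2) t - u * (s * k (\<nu> - 1/2) t)))"
      using True fk[of u] by simp
    also have "\<dots> = c u * (bessel_moment (\<nu> + 1/2) s - u * (s * bessel_moment (\<nu> - 1/2) s))"
      using kint kint' by (simp add: bk)
    finally show ?thesis using True by (simp add: c_def w_def mult.assoc)
  qed (auto simp: f_out)
  \<comment> \<open>the bound needed for Fubini's theorem: on \<open>(-1, q)\<close> all factors but the Beta weight are bounded\<close>
  define C where "C = 2 powr (- \<nu>) * exp \<bar>s\<bar> * (bessel_moment (\<nu> + 1/2) s + \<bar>s\<bar> * bessel_moment (\<nu> - 1/2) s)"
  have normf: "(LINT \<tau>|lborel. norm (f u \<tau>)) \<le> indicator {-1<..<q} u * ((1 - u\<^sup>2) powr (\<nu> - 1) * C)" for u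
  proof (cases "-1 < u \<and> u < q")
    case True
    have u1: "\<bar>u\<bar> \<le> 1" using True q by auto
    have intabs: "integrable lborel (\<lambda>t. k (\<nu> + 1/2) t + \<bar>s\<bar> * k (\<nu> - 1/2) t)"
      using kint integrable_abs[OF kint'] k_nonneg by (auto simp: abs_mult)
    have "(LINT \<tau>|lborel. norm (f u \<tau>)) = (LINT t|lborel. norm (\<bar>(1 - u\<^sup>2) / 2\<bar> * f u (0 + (1 - u\<^sup>2) / 2 * t)))"
      using d_pos[of u] True by (subst lborel_integral_real_affine[of "(1 - u\<^sup>2) / 2" _ 0]) (auto simp: abs_mult)
    also have "\<dots> = (LINT t|lborel. norm (c u * (k (\<nu> + 1/2) t - u * (s * k (\<nu> - 1/2) t))))"
      using True fk[of u] by simp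
    also have "\<dots> \<le> (LINT t|lborel. c u * (k (\<nu> + 1/2) t + \<bar>s\<bar> * k (\<nu> - 1/2) t))"
    proof (rule integral_mono)
      fix t
      have "\<bar>u * (s * k (\<nu> - 1/2) t)\<bar> \<le> 1 * (\<bar>s\<bar> * k (\<nu> - 1/2) t)"
        unfolding abs_mult using u1 k_nonneg by (intro mult_mono) auto
      then have "\<bar>k (\<nu> + 1/2) t - u * (s * k (\<nu> - 1/2) t)\<bar> \<le> k (\<nu> + 1/2) t + \<bar>s\<bar> * k (\<nu> - 1/2) t"
        using k_nonneg[of "\<nu> + 1/2" t] by linarith
      then show "norm (c u * (k (\<nu> + 1/2) t - u * (s * k (\<nu> - 1/2) t))) \<le> c u * (k (\<nu> + 1/2) t + \<bar>s\<bar> * k (\<nu> - 1/2) t)"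
        by (simp add: abs_mult c_def mult_left_mono)
    qed (intro integrable_norm intk integrable_mult_right intabs)+
    also have "\<dots> = c u * (bessel_moment (\<nu> + 1/2) s + \<bar>s\<bar> * bessel_moment (\<nu> - 1/2) s)"
    proof (cases "s = 0")
      case False
      then have "integrable lborel (k (\<nu> - 1/2))" using kint' by simp
      then show ?thesis using kint by (simp add: bk)
    qed (simp add: bk)
    also have "\<dots> \<le> (1 - u\<^sup>2) powr (\<nu> - 1) * C"
    proof -
      have "- s * u \<le> \<bar>s\<bar>" using u1 mult_left_mono[of "\<bar>u\<bar>" 1 "\<bar>s\<bar>"] abs_mult[of s u] by (simp add: abs_le_iff)
      moreover have "0 \<le> bessel_moment (\<nu> + 1/2) s + \<bar>s\<bar> * bessel_moment (\<nu> - 1/2) s"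
        unfolding bk[symmetric] using k_nonneg by (intro add_nonneg_nonneg mult_nonneg_nonneg integral_nonneg_AE) auto
      ultimately show ?thesis unfolding c_def C_def
        by (auto intro!: mult_left_mono mult_right_mono simp: mult.assoc mult.left_commute[of "(1 - u\<^sup>2) powr (\<nu> - 1)"])
    qed
    finally show ?thesis using True by simp
  qed (auto simp: f_out)
  have beta_int: "integrable lborel (\<lambda>u. indicator {-1<..<q} u * ((1 - u\<^sup>2) powr (\<nu> - 1) * C))"
  proof -
    have "set_integrable lborel {-1<..<q} (\<lambda>u. (1 - u\<^sup>2) powr (\<nu> - 1))"
      by (rule set_integrable_subset[OF integrable_one_minus_square_powr[OF \<nu>]]) (use q in auto)
    then have "set_integrable lborel {-1<..<q} (\<lambda>u. (1 - u\<^sup>2) powr (\<nu> - 1) * C)" by simp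
    then show ?thesis by (simp add: set_integrable_def)
  qed
  have F: "integrable (lborel \<Otimes>\<^sub>M lborel) (case_prod f)"
  proof (rule lborel_pair.Fubini_integrable)
    show "integrable lborel (\<lambda>u. LINT \<tau>|lborel. norm (case (u, \<tau>) of (x, xa) \<Rightarrow> f x xa))"
    proof (rule Bochner_Integration.integrable_bound[OF beta_int])
      show "AE u in lborel. norm (LINT \<tau>|lborel. norm (case (u, \<tau>) of (x, xa) \<Rightarrow> f x xa))
        \<le> norm (indicator {-1<..<q} u * ((1 - u\<^sup>2) powr (\<nu> - 1) * C))"
      proof (rule AE_I2)
        fix u
        have "0 \<le> (LINT \<tau>|lborel. norm (f u \<tau>))" by (intro integral_nonneg_AE) auto
        then show "norm (LINT \<tau>|lborel. norm (case (u, \<tau>) of (x, xa) \<Rightarrow> f x xa))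
          \<le> norm (indicator {-1<..<q} u * ((1 - u\<^sup>2) powr (\<nu> - 1) * C))"
          using normf[of u] by simp
      qed
    qed measurable
  qed (use intf in auto)
  have ind: "integrable lborel (\<lambda>u. indicator {-1<..<q} u * (2 powr (- \<nu>) * w u))"
    using lborel_pair.integrable_fst[OF F] unfolding Intf by simp
  have "integrable lborel (\<lambda>u. 2 powr \<nu> * (indicator {-1<..<q} u * (2 powr (- \<nu>) * w u)))"
    by (rule integrable_mult_right[OF ind])
  also have "(\<lambda>u. 2 powr \<nu> * (indicator {-1<..<q} u * (2 powr (- \<nu>) * w u))) = (\<lambda>u. indicator {-1<..<q} u *\<^sub>R w u)"
    by (auto simp: powr_minus fun_eq_iff)
  finally show "set_integrable lborel {-1<..<q} w" unfolding set_integrable_def .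
  have "AE \<tau> in lborel. integrable lborel (\<lambda>u. f u \<tau>)"
    using lborel_pair.AE_integrable_snd[OF F] .
  then have AE1: "AE \<tau> in lborel. (LINT u|lborel. f u \<tau>) =
      sqrt (2 * pi) * (indicator {0<..} \<tau> * (\<tau> powr (\<nu> - 1) * exp (- \<tau>) * std_normal_cdf (vg_arg s q \<tau>)))"
  proof eventually_elim
    case (elim \<tau>)
    show ?case
    proof (cases "\<tau> > 0")
      case \<tau>: True
      define h where "h u = \<tau> powr (\<nu> - 1) * exp (- \<tau>) * exp (- (vg_arg s u \<tau>)\<^sup>2 / 2) * A' u \<tau>" for u
      define H where "H u = sqrt (2 * pi) * (\<tau> powr (\<nu> - 1) * exp (- \<tau>)) * std_normal_cdf (vg_arg s u \<tau>)" for u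
      have fh: "f u \<tau> = indicator {-1<..<q} u *\<^sub>R h u" for u using \<tau> by (simp add: f_def h_def)
      have "(LBINT u=ereal (-1)..ereal q. h u) = H q - 0"
      proof (rule interval_integral_FTC_integrable)
        show "ereal (-1) < ereal q" using q by simp
        show "set_integrable lborel (einterval (ereal (-1)) (ereal q)) h"
          using elim unfolding set_integrable_def fh by simp
        have dH: "(H has_real_derivative h u) (at u)" if u: "-1 < u" "u < 1" for u
        proof -
          have "((\<lambda>u. std_normal_cdf (vg_arg s u \<tau>)) has_real_derivative std_normal_density (vg_arg s u \<tau>) * A' u \<tau>) (at u)"
            unfolding A'_def
            by (rule DERIV_chain2[OF std_normal_cdf_has_real_derivative vg_arg_has_real_derivative[OF u \<tau>]])
          from DERIV_cmult[OF this, of "sqrt (2 * pi) * (\<tau> powr (\<nu> - 1) * exp (- \<tau>))"]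
          show ?thesis unfolding H_def[abs_def] h_def std_normal_density_def by (simp add: mult.assoc)
        qed
        show "(H has_vector_derivative h u) (at u)" if "ereal (-1) < ereal u" "ereal u < ereal q" for u
          using dH[of u] that q by (simp add: has_real_derivative_iff_has_vector_derivative)
        show "isCont h u" if "ereal (-1) < ereal u" "ereal u < ereal q" for u
        proof -
          have "1 - u\<^sup>2 > 0" using d_pos[of u] that by simp
          then have "sqrt (1 - u\<^sup>2) \<noteq> 0" "1 - u\<^sup>2 \<noteq> 0" by auto
          then show ?thesis using \<tau> unfolding h_def[abs_def] vg_arg_def[abs_def] A'_def[abs_def]
            by (intro continuous_intros) auto
        qed
        have "((\<lambda>u. std_normal_cdf (vg_arg s u \<tau>)) \<longlongrightarrow> 0) (at_right (-1))"
          by (rule filterlim_compose[OF std_normal.cdf_lim_at_bot vg_arg_tendsto_at_bot[OF \<tau>]])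
        then have "(H \<longlongrightarrow> 0) (at_right (-1))"
          unfolding H_def[abs_def] by (rule tendsto_mult_right_zero)
        then show "((H \<circ> real_of_ereal) \<longlongrightarrow> 0) (at_right (ereal (-1)))"
          unfolding ereal_tendsto_simps1 .
        have "isCont H q" using dH[OF q] by (rule DERIV_isCont)
        then have "(H \<longlongrightarrow> H q) (at_left q)" by (simp add: continuous_within filterlim_at_split)
        then show "((H \<circ> real_of_ereal) \<longlongrightarrow> H q) (at_left (ereal q))"
          unfolding ereal_tendsto_simps1 .
      qed
      then have "(LINT u|lborel. f u \<tau>) = H q"
        using q unfolding fh by (simp add: interval_integral_Ioo set_lebesgue_integral_def)
      then show ?thesis using \<tau> by (simp add: H_def mult.assoc)
    qed (simp add: f_def)
  qed
  have "2 powr (- \<nu>) * (LINT u:{-1<..<q}|lborel. w u) = (LINT u|lborel. (LINT \<tau>|lborel. f u \<tau>))"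
    unfolding Intf set_lebesgue_integral_def mult.left_commute[of _ "2 powr (- \<nu>)"] by simp
  also have "\<dots> = (LINT \<tau>|lborel. (LINT u|lborel. f u \<tau>))"
    by (rule lborel_pair.Fubini_integral[OF F, symmetric])
  also have "\<dots> = (LINT \<tau>|lborel. sqrt (2 * pi) * (indicator {0<..} \<tau> * (\<tau> powr (\<nu> - 1) * exp (- \<tau>) * std_normal_cdf (vg_arg s q \<tau>))))"
  proof (rule integral_cong_AE[OF _ _ AE1])
    show "(\<lambda>\<tau>. sqrt (2 * pi) * (indicator {0<..} \<tau> * (\<tau> powr (\<nu> - 1) * exp (- \<tau>) * std_normal_cdf (vg_arg s q \<tau>)))) \<in> borel_measurable lborel"
      unfolding vg_arg_def by measurable
  qed (use borel_measurable_integrable[OF lborel_pair.integrable_snd[OF F]] in simp)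
  also have "\<dots> = sqrt (2 * pi) * (LINT \<tau>:{0<..}|lborel. \<tau> powr (\<nu> - 1) * exp (- \<tau>) * std_normal_cdf (vg_arg s q \<tau>))"
    by (simp add: set_lebesgue_integral_def)
  finally show "sqrt (2 * pi) * (LINT \<tau>:{0<..}|lborel. \<tau> powr (\<nu> - 1) * exp (- \<tau>) * std_normal_cdf (vg_arg s q \<tau>))
      = 2 powr (- \<nu>) * (LINT u:{-1<..<q}|lborel. w u)" by simp
qed

text \<open>
Symmetry of the density.
\<close>

lemma std_normal_cdf_zero: "std_normal_cdf 0 = 1/2"
proof -
  have "(LINT z:{..0}|lborel. std_normal_density z) = (LINT z:{0..}|lborel. std_normal_density z)"
    unfolding set_lebesgue_integral_def
    by (subst lborel_integral_real_affine[where c = "-1" and t = 0])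
       (auto intro!: Bochner_Integration.integral_cong simp: indicator_def std_normal_density_def)
  also have "\<dots> = (LINT z:{0<..}|lborel. std_normal_density z)"
    unfolding set_lebesgue_integral_def
  proof (rule integral_cong_AE)
    show "AE z in lborel. indicator {0..} z *\<^sub>R std_normal_density z = indicator {0<..} z *\<^sub>R std_normal_density z"
      using AE_lborel_singleton[of "0::real"] by eventually_elim (auto split: split_indicator)
  qed auto
  finally have "measure std_normal_distribution {..0} = measure std_normal_distribution {0<..}" by (simp add: std_normal_measure)
  moreover have "measure std_normal_distribution ({..0} \<union> {0<..}) = measure std_normal_distribution {..0} + measure std_normal_distribution {0<..}"
    by (rule std_normal.finite_measure_Union) auto
  moreover have "{..0} \<union> {0<..} = (UNIV::real set)" by auto
  ultimately show ?thesis using std_normal.prob_space by (simp add: cdf_def)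
qed

text \<open>
Increments suffice here: the constant of integration is fixed separately at \<open>q = 0\<close>.
\<close>

lemma one_minus_square_powr_integral:
  fixes \<nu> a b :: real
  assumes \<nu>: "\<nu> > 0" and a: "-1 < a" and b: "b < 1" and ab: "a \<le> b"
  shows "(LINT u:{-1<..<b}|lborel. (1 - u\<^sup>2) powr (\<nu> - 1)) =
    (LINT u:{-1<..<a}|lborel. (1 - u\<^sup>2) powr (\<nu> - 1)) +
    (b * (1 - b\<^sup>2) powr \<nu> * gauss_series (\<nu> + 1/2) 1 (3/2) (b\<^sup>2) - a * (1 - a\<^sup>2) powr \<nu> * gauss_series (\<nu> + 1/2) 1 (3/2) (a\<^sup>2))"
proof -
  have int: "set_integrable lborel S (\<lambda>u. (1 - u\<^sup>2) powr (\<nu> - 1))" if "S \<in> sets borel" "S \<subseteq> {-1<..<1}" for S :: "real set"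
    by (rule set_integrable_subset[OF integrable_one_minus_square_powr[OF \<nu>]]) (use that in auto)
  have "{-1<..<b} = {-1<..<a} \<union> {a..<b}" using a ab by auto
  then have "(LINT u:{-1<..<b}|lborel. (1 - u\<^sup>2) powr (\<nu> - 1)) =
    (LINT u:{-1<..<a}|lborel. (1 - u\<^sup>2) powr (\<nu> - 1)) + (LINT u:{a..<b}|lborel. (1 - u\<^sup>2) powr (\<nu> - 1))"
    by (simp only:) (intro set_integral_Un int, use a b ab in auto)
  also have "(LINT u:{a..<b}|lborel. (1 - u\<^sup>2) powr (\<nu> - 1)) = integral {a..<b} (\<lambda>u. (1 - u\<^sup>2) powr (\<nu> - 1))"
    by (intro set_borel_integral_eq_integral int) (use a b ab in auto)
  also have "\<dots> = integral {a..b} (\<lambda>u. (1 - u\<^sup>2) powr (\<nu> - 1))"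
    by (rule integral_spike_set) (auto intro!: negligible_subset[OF negligible_sing[of b]])
  also have "\<dots> = b * (1 - b\<^sup>2) powr \<nu> * gauss_series (\<nu> + 1/2) 1 (3/2) (b\<^sup>2) - a * (1 - a\<^sup>2) powr \<nu> * gauss_series (\<nu> + 1/2) 1 (3/2) (a\<^sup>2)"
  proof (rule integral_unique, rule fundamental_theorem_of_calculus[OF ab])
    fix x assume "x \<in> {a..b}"
    then have "\<bar>x\<bar> < 1" using a b by auto
    then show "((\<lambda>q. q * (1 - q\<^sup>2) powr \<nu> * gauss_series (\<nu> + 1/2) 1 (3/2) (q\<^sup>2)) has_vector_derivative (1 - x\<^sup>2) powr (\<nu> - 1)) (at x within {a..b})"
      unfolding has_real_derivative_iff_has_vector_derivative[symmetric]
      by (rule has_field_derivative_at_within[OF gauss_series_one_has_real_derivative[OF _ \<nu>]])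
  qed
  finally show ?thesis .
qed

lemma Gamma_lborel_integral:
  assumes "(\<nu>::real) > 0"
  shows "has_bochner_integral lborel (\<lambda>\<tau>. indicator {0<..} \<tau> * (\<tau> powr (\<nu> - 1) * exp (- \<tau>))) (Gamma \<nu>)"
proof -
  have "has_bochner_integral lborel (\<lambda>t. indicator {0..} t * t powr (\<nu> - 1) / exp t) (Gamma \<nu>)"
    by (rule has_bochner_integral_nn_integral) (auto simp: Gamma_conv_nn_integral_real[OF assms] Gamma_real_nonneg assms)
  moreover have "(\<lambda>t. indicator {0..} t * t powr (\<nu> - 1) / exp t) = (\<lambda>\<tau>. indicator {0<..} \<tau> * (\<tau> powr (\<nu> - 1) * exp (- \<tau>)))"
    by (auto simp: fun_eq_iff indicator_def exp_minus field_simps)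
  ultimately show ?thesis by simp
qed

text \<open>
At \<open>s = 0\<close> only one Bessel moment, a gamma integral, survives. The mixture at \<open>q = 0\<close> equals half a gamma
integral, which identifies the integral from \<open>-1\<close> to \<open>0\<close> as half a Beta function without computing it.
\<close>

lemma std_normal_cdf_mixture_zero:
  fixes \<nu> q :: real
  assumes \<nu>: "\<nu> > 0" and q: "\<bar>q\<bar> < 1"
  defines "z \<equiv> q / sqrt (1 - q\<^sup>2)"
  shows "sqrt (2 * pi) * (LINT \<tau>:{0<..}|lborel. \<tau> powr (\<nu> - 1) * exp (- \<tau>) * std_normal_cdf (vg_arg 0 q \<tau>))
    = Gamma (\<nu> + 1/2) * (Beta (1/2) \<nu> / sqrt 2 + sqrt 2 * (z * gauss_hypergeom (\<nu> + 1/2) (1/2) (3/2) (- z\<^sup>2)))"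
proof -
  define F where "F q = sqrt (2 * pi) * (LINT \<tau>:{0<..}|lborel. \<tau> powr (\<nu> - 1) * exp (- \<tau>) * std_normal_cdf (vg_arg 0 q \<tau>))" for q
  define I where "I q = (LINT u:{-1<..<q}|lborel. (1 - u\<^sup>2) powr (\<nu> - 1))" for q :: real
  have FI: "F q = sqrt 2 * Gamma (\<nu> + 1/2) * I q" if q: "\<bar>q\<bar> < 1" for q
  proof -
    have "F q = 2 powr (- \<nu>) * (LINT u:{-1<..<q}|lborel. (1 - u\<^sup>2) powr (\<nu> - 1) * bessel_moment (\<nu> + 1/2) 0)"
      using std_normal_cdf_mixture(2)[of \<nu> q 0] \<nu> q by (simp add: F_def abs_less_iff)
    also have "\<dots> = 2 powr (- \<nu>) * (2 powr (\<nu> + 1/2)) * Gamma (\<nu> + 1/2) * I q"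
      using \<nu> by (simp add: bessel_moment_0(2) I_def)
    also have "2 powr (- \<nu>) * (2 powr (\<nu> + 1/2)) = sqrt 2"
      by (simp add: powr_add[symmetric] powr_half_sqrt)
    finally show ?thesis by simp
  qed
  have "F 0 = sqrt (2 * pi) * (LINT \<tau>:{0<..}|lborel. \<tau> powr (\<nu> - 1) * exp (- \<tau>) * (1 / 2))"
    by (simp only: F_def vg_arg_def) (simp add: std_normal_cdf_zero)
  also have "\<dots> = sqrt (2 * pi) / 2 * (LINT \<tau>:{0<..}|lborel. \<tau> powr (\<nu> - 1) * exp (- \<tau>))"
    by simp
  also have "(LINT \<tau>:{0<..}|lborel. \<tau> powr (\<nu> - 1) * exp (- \<tau>)) = Gamma \<nu>"
    using has_bochner_integral_integral_eq[OF Gamma_lborel_integral[OF \<nu>]]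
    by (simp add: set_lebesgue_integral_def)
  finally have F0: "F 0 = sqrt (2 * pi) / 2 * Gamma \<nu>" .
  have B: "Gamma (\<nu> + 1/2) * (Beta (1/2) \<nu> / sqrt 2) = sqrt (2 * pi) / 2 * Gamma \<nu>"
  proof -
    have "Gamma (\<nu> + 1/2) > 0" using \<nu> by (intro Gamma_real_pos) auto
    then have "Gamma (\<nu> + 1/2) * (Beta (1/2) \<nu> / sqrt 2) = sqrt pi * Gamma \<nu> / sqrt 2"
      by (simp add: Beta_def Gamma_one_half_real add.commute)
    also have "\<dots> = sqrt (2 * pi) / 2 * Gamma \<nu>"
      by (simp add: real_sqrt_mult field_simps)
    finally show ?thesis .
  qed
  have "I q = I 0 + z * gauss_hypergeom (\<nu> + 1/2) (1/2) (3/2) (- z\<^sup>2)"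
    unfolding z_def gauss_hypergeom_eq_gauss_series_one[OF q \<nu>] I_def
    using one_minus_square_powr_integral[OF \<nu>, of 0 q] one_minus_square_powr_integral[OF \<nu>, of q 0] q
    by (cases "q \<ge> 0") (auto simp: abs_less_iff)
  then have "F q = F 0 + sqrt 2 * Gamma (\<nu> + 1/2) * (z * gauss_hypergeom (\<nu> + 1/2) (1/2) (3/2) (- z\<^sup>2))"
    unfolding FI[OF q] FI[of 0, simplified] by (simp add: distrib_left)
  then show ?thesis unfolding F0 B[symmetric] F_def[of q] by (simp add: distrib_left)
qed

lemma Beta_one_right:
  assumes "(a::real) > 0" shows "Beta a 1 = 1 / a"
proof -
  have "a \<notin> \<int>\<^sub>\<le>\<^sub>0" using assms by (auto elim!: nonpos_Ints_cases)
  then show ?thesis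
    using assms Gamma_real_pos[of a] by (simp add: Beta_def Gamma_plus1 Gamma_eq_zero_iff)
qed

text \<open>
The substitution \<open>u = (1 + q) * t - 1\<close> gives \<open>1 - u^2 = 2 * (1 + q) * t * (1 - (1 + q) * t / 2)\<close>; the
constant and the linear part of \<open>u\<close> then lead to the Euler integrals with parameter shifts \<open>0\<close> and \<open>1\<close>.
\<close>

lemma std_normal_cdf_mixture_nonzero:
  fixes \<nu> q s :: real
  assumes \<nu>: "\<nu> > 0" and q: "\<bar>q\<bar> < 1" and s: "s \<noteq> 0"
  defines "A \<equiv> (\<lambda>j::nat. appell_degenerate (\<nu> + j) (1 - \<nu>) (\<nu> + 1 + j) ((1 + q) / 2) (- s * (1 + q)))"
  shows "sqrt (2 * pi) * (LINT \<tau>:{0<..}|lborel. \<tau> powr (\<nu> - 1) * exp (- \<tau>) * std_normal_cdf (vg_arg s q \<tau>))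
    = \<bar>s\<bar> powr (\<nu> - 1/2) * exp s * (1 + q) powr \<nu> *
       (Beta \<nu> 1 * (\<bar>s\<bar> * macdonald (\<nu> + 1/2) \<bar>s\<bar> + s * macdonald (\<nu> - 1/2) \<bar>s\<bar>) * A 0
        - (1 + q) * s * Beta (\<nu> + 1) 1 * macdonald (\<nu> - 1/2) \<bar>s\<bar> * A 1)"
proof -
  define x y where "x = (1 + q) / 2" and "y = - s * (1 + q)"
  have x: "0 < x" "x < 1" "\<bar>x\<bar> < 1" using q by (auto simp: x_def)
  define Mp Mm where "Mp = macdonald (\<nu> + 1/2) \<bar>s\<bar>" and "Mm = macdonald (\<nu> - 1/2) \<bar>s\<bar>"
  define g where "g j t = t powr (\<nu> + real j - 1) * (1 - x * t) powr (- (1 - \<nu>)) * exp (y * t)" for j :: nat and t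
  have g: "set_integrable lborel {0<..<1} (g j)" "A j = (\<nu> + j) * (LINT t:{0<..<1}|lborel. g j t)" for j
    using appell_degenerate_integral[of "\<nu> + j" x "1 - \<nu>" y] \<nu> x
    by (simp_all add: g_def[abs_def] A_def x_def y_def add_ac)
  define w where "w u = (1 - u\<^sup>2) powr (\<nu> - 1) * exp (- s * u)
      * (bessel_moment (\<nu> + 1/2) s - u * (s * bessel_moment (\<nu> - 1/2) s))" for u
  define c where "c = \<bar>s\<bar> powr (\<nu> - 1/2) * exp s * (1 + q) powr \<nu>"
  have sp: "\<bar>s\<bar> powr (\<nu> + 1/2) = \<bar>s\<bar> powr (\<nu> - 1/2) * \<bar>s\<bar>"
    using powr_add[of "\<bar>s\<bar>" "\<nu> - 1/2" 1] s by (simp add: add.commute)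
  have w_eq: "w u = 2 * \<bar>s\<bar> powr (\<nu> - 1/2) * ((1 - u\<^sup>2) powr (\<nu> - 1) * exp (- s * u) * (\<bar>s\<bar> * Mp - u * s * Mm))" for u
    unfolding w_def bessel_moment_macdonald(2)[OF s] sp Mp_def Mm_def by (simp add: algebra_simps)
  have key: "2 powr (- \<nu>) * (\<bar>1 + q\<bar> * (indicator {-1<..<q} (-1 + (1 + q) * t) * w (-1 + (1 + q) * t)))
     = indicator {0<..<1} t * (c * ((\<bar>s\<bar> * Mp + s * Mm) * g 0 t - (1 + q) * s * Mm * g 1 t))" for t
  proof (cases "t \<in> {0<..<1}")
    case False
    then have "\<not> (-1 < -1 + (1 + q) * t \<and> -1 + (1 + q) * t < q)"
    proof -
      have "t \<le> 0 \<or> (1 + q) * 1 \<le> (1 + q) * t" 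
      proof (cases "t \<le> 0")
        case False
        then have "1 \<le> t" using \<open>t \<notin> {0<..<1}\<close> by auto
        then show ?thesis using q by (intro disjI2 mult_left_mono) auto
      qed simp
      moreover have "(1 + q) * t \<le> 0" if "t \<le> 0" using that q by (intro mult_nonneg_nonpos) auto
      ultimately show ?thesis by auto
    qed
    then show ?thesis using False by auto
  next
    case t: True
    define u where "u = -1 + (1 + q) * t"
    have "(1 + q) * t < (1 + q) * 1" using t q by (intro mult_strict_left_mono) auto
    then have u: "-1 < u" "u < q" using t q by (auto simp: u_def)
    have xt: "0 < 1 - x * t" using t x mult_strict_mono[of x 1 t 1] by auto
    have d: "1 - u\<^sup>2 = 2 * ((1 + q) * (t * (1 - x * t)))"
      by (simp add: u_def x_def power2_eq_square field_simps)
    have "(1 - u\<^sup>2) powr (\<nu> - 1) = 2 powr (\<nu> - 1) * ((1 + q) powr (\<nu> - 1) * (t powr (\<nu> - 1) * (1 - x * t) powr (\<nu> - 1)))"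
      unfolding d using t q xt by (simp add: powr_mult)
    moreover have "exp (- s * u) = exp s * exp (y * t)"
      unfolding u_def y_def exp_add[symmetric] by (simp add: algebra_simps)
    moreover have "(1 + q) * (1 + q) powr (\<nu> - 1) = (1 + q) powr \<nu>" using q by (simp add: powr_diff)
    moreover have "2 powr (- \<nu>) * 2 * 2 powr (\<nu> - 1) = (1::real)" by (simp add: powr_minus powr_diff)
    moreover have g0: "t powr (\<nu> - 1) * (1 - x * t) powr (\<nu> - 1) * exp (y * t) = g 0 t"
      by (simp add: g_def)
    moreover have g1: "t * g 0 t = g 1 t"
      using t by (simp add: g_def powr_diff powr_add)
    ultimately have "2 powr (- \<nu>) * ((1 + q) * w u) = c * (g 0 t * (\<bar>s\<bar> * Mp - u * s * Mm))"
    proof -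
      assume 1: "(1 - u\<^sup>2) powr (\<nu> - 1) = 2 powr (\<nu> - 1) * ((1 + q) powr (\<nu> - 1) * (t powr (\<nu> - 1) * (1 - x * t) powr (\<nu> - 1)))"
        and 2: "exp (- s * u) = exp s * exp (y * t)"
        and 3: "(1 + q) * (1 + q) powr (\<nu> - 1) = (1 + q) powr \<nu>"
        and 4: "2 powr (- \<nu>) * 2 * 2 powr (\<nu> - 1) = (1::real)"
      have "2 powr (- \<nu>) * ((1 + q) * w u) = (2 powr (- \<nu>) * 2 * 2 powr (\<nu> - 1)) * (\<bar>s\<bar> powr (\<nu> - 1/2) * exp s * ((1 + q) * (1 + q) powr (\<nu> - 1)))
         * ((t powr (\<nu> - 1) * (1 - x * t) powr (\<nu> - 1) * exp (y * t)) * (\<bar>s\<bar> * Mp - u * s * Mm))"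
        unfolding w_eq 1 2 by (simp only: mult_ac)
      then show ?thesis unfolding 3 4 g0 c_def by simp
    qed
    moreover have "g 0 t * (\<bar>s\<bar> * Mp - u * s * Mm) = (\<bar>s\<bar> * Mp + s * Mm) * g 0 t - (1 + q) * s * Mm * g 1 t"
      unfolding g1[symmetric] u_def by (simp add: algebra_simps)
    ultimately show ?thesis unfolding u_def[symmetric] using u t q by simp
  qed
  have "sqrt (2 * pi) * (LINT \<tau>:{0<..}|lborel. \<tau> powr (\<nu> - 1) * exp (- \<tau>) * std_normal_cdf (vg_arg s q \<tau>))
    = 2 powr (- \<nu>) * (LINT u:{-1<..<q}|lborel. w u)"
    using std_normal_cdf_mixture(2)[of \<nu> q s] \<nu> q unfolding w_def by (simp add: abs_less_iff)
  also have "\<dots> = 2 powr (- \<nu>) * (\<bar>1 + q\<bar> * (LINT t|lborel. indicator {-1<..<q} (-1 + (1 + q) * t) * w (-1 + (1 + q) * t)))"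
    unfolding set_lebesgue_integral_def
    by (subst lborel_integral_real_affine[of "1 + q" _ "-1"]) (use q in auto)
  also have "\<dots> = (LINT t|lborel. 2 powr (- \<nu>) * (\<bar>1 + q\<bar> * (indicator {-1<..<q} (-1 + (1 + q) * t) * w (-1 + (1 + q) * t))))"
    by simp
  also have "\<dots> = (LINT t:{0<..<1}|lborel. c * ((\<bar>s\<bar> * Mp + s * Mm) * g 0 t - (1 + q) * s * Mm * g 1 t))"
    unfolding key set_lebesgue_integral_def by simp
  also have "\<dots> = c * ((\<bar>s\<bar> * Mp + s * Mm) * (LINT t:{0<..<1}|lborel. g 0 t) - (1 + q) * s * Mm * (LINT t:{0<..<1}|lborel. g 1 t))"
    using g(1)[of 0] g(1)[of 1] by (simp add: set_integral_diff)
  also have "\<dots> = c * (Beta \<nu> 1 * (\<bar>s\<bar> * Mp + s * Mm) * A 0 - (1 + q) * s * Beta (\<nu> + 1) 1 * Mm * A 1)"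
    using \<nu> by (simp add: g(2) Beta_one_right)
  finally show ?thesis unfolding c_def Mp_def Mm_def .
qed

text \<open>
The substitution \<open>\<tau> = l * x\<close>, together with the parameters \<open>q\<close> and \<open>s\<close> that make the arguments of the
distribution function agree.
\<close>

lemma gamma_mixture_rescale:
  fixes \<nu> l \<sigma> \<beta> y :: real
  assumes \<nu>: "\<nu> > 0" and l: "l > 0" and \<sigma>: "\<sigma> > 0"
  defines "D \<equiv> sqrt (\<beta>\<^sup>2 + 2 * l * \<sigma>\<^sup>2)"
  shows "\<bar>\<beta> / D\<bar> < 1" and "\<beta> / D / sqrt (1 - (\<beta> / D)\<^sup>2) = \<beta> / (\<sigma> * sqrt (2 * l))"
    and "l powr \<nu> * (LINT x:{0<..}|lborel. x powr (\<nu> - 1) * exp (- l * x) * std_normal_cdf ((\<beta> * x + y) / (\<sigma> * sqrt x)))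
     = (LINT \<tau>:{0<..}|lborel. \<tau> powr (\<nu> - 1) * exp (- \<tau>) * std_normal_cdf (vg_arg (y * D / \<sigma>\<^sup>2) (\<beta> / D) \<tau>))"
proof -
  have p: "2 * l * \<sigma>\<^sup>2 > 0" using l \<sigma> by simp
  have D: "D > 0" "D\<^sup>2 = \<beta>\<^sup>2 + 2 * l * \<sigma>\<^sup>2" using p by (auto simp: D_def add_nonneg_pos)
  have q2: "1 - (\<beta> / D)\<^sup>2 = 2 * l * \<sigma>\<^sup>2 / D\<^sup>2"
    proof -
    have "(D\<^sup>2 - \<beta>\<^sup>2) / D\<^sup>2 = 1 - \<beta>\<^sup>2 / D\<^sup>2" using D(1) by (simp add: diff_divide_distrib)
    then show ?thesis unfolding D(2) power_divide by simp
  qed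
  have "0 < 1 - (\<beta> / D)\<^sup>2" unfolding q2 using p D(1) by (intro divide_pos_pos) simp_all
  then show "\<bar>\<beta> / D\<bar> < 1" by (simp add: abs_square_less_1)
  have sq: "sqrt (1 - (\<beta> / D)\<^sup>2) = \<sigma> * sqrt (2 * l) / D"
    unfolding q2 using D(1) \<sigma> by (simp add: real_sqrt_divide real_sqrt_mult)
  show "\<beta> / D / sqrt (1 - (\<beta> / D)\<^sup>2) = \<beta> / (\<sigma> * sqrt (2 * l))"
    unfolding sq using D(1) by simp
  define f where "f \<tau> = indicator {0<..} \<tau> * (\<tau> powr (\<nu> - 1) * exp (- \<tau>) * std_normal_cdf (vg_arg (y * D / \<sigma>\<^sup>2) (\<beta> / D) \<tau>))" for \<tau>
  have key: "\<bar>l\<bar> * f (0 + l * x) = l powr \<nu> * (indicator {0<..} x * (x powr (\<nu> - 1) * exp (- l * x) * std_normal_cdf ((\<beta> * x + y) / (\<sigma> * sqrt x))))" for x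
  proof (cases "x > 0")
    case x: True
    have s2: "sqrt (2 * (l * x)) = sqrt (2 * l) * sqrt x" by (simp add: real_sqrt_mult)
    have "vg_arg (y * D / \<sigma>\<^sup>2) (\<beta> / D) (l * x) = (\<beta> * x + y) / (\<sigma> * sqrt x)"
    proof -
      have "vg_arg (y * D / \<sigma>\<^sup>2) (\<beta> / D) (l * x) = \<beta> * sqrt x / \<sigma> + y / (\<sigma> * sqrt x)"
        unfolding vg_arg_def sq s2 using D(1) \<sigma> l x by (simp add: power2_eq_square)
      also have "\<dots> = (\<beta> * (sqrt x * sqrt x) + y) / (\<sigma> * sqrt x)"
        using \<sigma> x by (simp add: field_simps del: real_sqrt_mult_self)
      finally show ?thesis using x by simp
    qed
    moreover have "l * (l * x) powr (\<nu> - 1) = l powr \<nu> * x powr (\<nu> - 1)"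
      using l x by (simp add: powr_mult powr_diff)
    ultimately show ?thesis using l x by (simp add: f_def mult.assoc[symmetric])
  qed (use l in \<open>auto simp: f_def zero_less_mult_iff\<close>)
  have "(LINT \<tau>|lborel. f \<tau>) = (LINT x|lborel. \<bar>l\<bar> * f (0 + l * x))"
    by (subst lborel_integral_real_affine[of l _ 0]) (use l in auto)
  also have "\<dots> = l powr \<nu> * (LINT x:{0<..}|lborel. x powr (\<nu> - 1) * exp (- l * x) * std_normal_cdf ((\<beta> * x + y) / (\<sigma> * sqrt x)))"
    unfolding key by (simp add: set_lebesgue_integral_def)
  finally show "l powr \<nu> * (LINT x:{0<..}|lborel. x powr (\<nu> - 1) * exp (- l * x) * std_normal_cdf ((\<beta> * x + y) / (\<sigma> * sqrt x)))
     = (LINT \<tau>:{0<..}|lborel. \<tau> powr (\<nu> - 1) * exp (- \<tau>) * std_normal_cdf (vg_arg (y * D / \<sigma>\<^sup>2) (\<beta> / D) \<tau>))"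
    by (simp add: f_def set_lebesgue_integral_def)
qed

abbreviation gamma_kernel :: "real \<Rightarrow> real \<Rightarrow> real \<Rightarrow> real" where
  "gamma_kernel \<nu> l x \<equiv> indicator {0<..} x * (x powr (\<nu> - 1) * exp (- l * x))"

text \<open>
Divergence for \<open>l \<le> 0\<close> matters as much as the value for \<open>l > 0\<close>: it is what turns integrability of the
payment into conditions on the parameters.
\<close>

lemma gamma_kernel_nn_integral:
  assumes \<nu>: "(\<nu>::real) > 0"
  shows "l > 0 \<Longrightarrow> (\<integral>\<^sup>+x. ennreal (gamma_kernel \<nu> l x) \<partial>lborel) = ennreal (Gamma \<nu> / l powr \<nu>)"
    and "l \<le> 0 \<Longrightarrow> (\<integral>\<^sup>+x. ennreal (gamma_kernel \<nu> l x) \<partial>lborel) = \<infinity>"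
proof -
  define k where "k l = (\<integral>\<^sup>+x. ennreal (gamma_kernel \<nu> l x) \<partial>lborel)" for l
  have pos: "k l = ennreal (Gamma \<nu> / l powr \<nu>)" if l: "l > 0" for l
  proof -
    have "ennreal (Gamma \<nu>) = (\<integral>\<^sup>+x. ennreal (indicator {0<..} x * (x powr (\<nu> - 1) * exp (- x))) \<partial>lborel)"
      using Gamma_lborel_integral[OF \<nu>] by (subst nn_integral_eq_integral) (auto simp: has_bochner_integral_iff)
    also have "\<dots> = ennreal \<bar>l\<bar> * (\<integral>\<^sup>+x. ennreal (indicator {0<..} (0 + l * x) * ((0 + l * x) powr (\<nu> - 1) * exp (- (0 + l * x)))) \<partial>lborel)"
      by (rule nn_integral_real_affine) (use l in auto)
    also have "\<dots> = (\<integral>\<^sup>+x. ennreal \<bar>l\<bar> * ennreal (indicator {0<..} (0 + l * x) * ((0 + l * x) powr (\<nu> - 1) * exp (- (0 + l * x)))) \<partial>lborel)"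
      by (rule nn_integral_cmult[symmetric]) simp
    also have "\<dots> = (\<integral>\<^sup>+x. ennreal (l powr \<nu>) * ennreal (gamma_kernel \<nu> l x) \<partial>lborel)"
    proof (rule nn_integral_cong)
      fix x
      have "\<bar>l\<bar> * (indicator {0<..} (0 + l * x) * ((0 + l * x) powr (\<nu> - 1) * exp (- (0 + l * x))))
        = l powr \<nu> * (gamma_kernel \<nu> l x)"
        using l by (cases "x > 0") (auto simp: powr_mult powr_diff zero_less_mult_iff)
      then show "ennreal \<bar>l\<bar> * ennreal (indicator {0<..} (0 + l * x) * ((0 + l * x) powr (\<nu> - 1) * exp (- (0 + l * x))))
        = ennreal (l powr \<nu>) * ennreal (gamma_kernel \<nu> l x)"
        by (simp only: ennreal_mult'[symmetric] abs_ge_zero powr_ge_zero)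
    qed
    also have "\<dots> = ennreal (l powr \<nu>) * k l"
      unfolding k_def by (rule nn_integral_cmult) simp
    finally have *: "ennreal (Gamma \<nu>) = ennreal (l powr \<nu>) * k l" .
    have "k l = ennreal (1 / l powr \<nu>) * (ennreal (l powr \<nu>) * k l)"
      using l by (simp add: mult.assoc[symmetric] ennreal_mult'[symmetric])
    then show ?thesis using l by (simp add: *[symmetric] ennreal_mult'[symmetric] Gamma_real_nonneg)
  qed
  show "l > 0 \<Longrightarrow> (\<integral>\<^sup>+x. ennreal (gamma_kernel \<nu> l x) \<partial>lborel) = ennreal (Gamma \<nu> / l powr \<nu>)"
    using pos by (simp add: k_def)
  have "k l = \<infinity>" if l: "l \<le> 0"
  proof (rule ccontr)
    assume "k l \<noteq> \<infinity>"
    then obtain r where r: "k l = ennreal r" "r \<ge> 0" by (cases "k l") auto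
    \<comment> \<open>for this positive rate the integral is \<open>r + 1\<close>, yet it is at most the one for \<open>l\<close>\<close>
    define d where "d = (Gamma \<nu> / (r + 1)) powr (1 / \<nu>)"
    have G: "Gamma \<nu> > 0" using \<nu> by (rule Gamma_real_pos)
    have d: "d > 0" "d powr \<nu> = Gamma \<nu> / (r + 1)"
    proof -
      have x: "Gamma \<nu> / (r + 1) > 0" using G r(2) by simp
      then show "d > 0" unfolding d_def by (simp only: powr_gt_zero)
      show "d powr \<nu> = Gamma \<nu> / (r + 1)" unfolding d_def powr_powr using x r(2) \<nu> by simp
    qed
    have "ennreal (Gamma \<nu> / d powr \<nu>) = k d" using pos[OF d(1)] by simp
    also have "\<dots> \<le> k l"
      unfolding k_def
    proof (intro nn_integral_mono ennreal_leI)
      fix x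
      show "gamma_kernel \<nu> d x \<le> gamma_kernel \<nu> l x"
        using mult_right_mono[of l d x] l d(1) by (auto simp: indicator_def intro!: mult_left_mono)
    qed
    finally have "Gamma \<nu> / d powr \<nu> \<le> r" using r by simp
    then show False using G r(2) unfolding d(2) by simp
  qed
  then show "l \<le> 0 \<Longrightarrow> (\<integral>\<^sup>+x. ennreal (gamma_kernel \<nu> l x) \<partial>lborel) = \<infinity>"
    by (simp add: k_def)
qed

text \<open>
Up to normalisation, the probability that a Brownian motion with drift \<open>\<beta>\<close> and volatility \<open>\<sigma>\<close>, run with a
gamma clock of shape \<open>\<nu>\<close> and rate \<open>l\<close>, exceeds \<open>- y\<close>.
\<close>

definition vg_mixture :: "real \<Rightarrow> real \<Rightarrow> real \<Rightarrow> real \<Rightarrow> real \<Rightarrow> real" where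
  "vg_mixture \<nu> l \<sigma> \<beta> y =
     (LINT x:{0<..}|lborel. x powr (\<nu> - 1) * exp (- l * x) * std_normal_cdf ((\<beta> * x + y) / (\<sigma> * sqrt x)))"

context
  fixes \<nu> l \<sigma> \<beta> :: real
  assumes \<nu>: "\<nu> > 0" and l: "l > 0" and \<sigma>: "\<sigma> > 0"
begin

lemma vg_kernel_integrable:
  "integrable lborel (\<lambda>x. gamma_kernel \<nu> l x)"
  "(LINT x|lborel. gamma_kernel \<nu> l x) = Gamma \<nu> / l powr \<nu>"
proof -
  have "has_bochner_integral lborel (\<lambda>x. gamma_kernel \<nu> l x) (Gamma \<nu> / l powr \<nu>)"
    by (rule has_bochner_integral_nn_integral)
      (use gamma_kernel_nn_integral(1)[OF \<nu> l] \<nu> in \<open>auto simp: Gamma_real_nonneg\<close>)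
  then show "integrable lborel (\<lambda>x. gamma_kernel \<nu> l x)"
    "(LINT x|lborel. gamma_kernel \<nu> l x) = Gamma \<nu> / l powr \<nu>"
    by (simp_all add: has_bochner_integral_iff)
qed

lemma vg_integrand_integrable:
  "integrable lborel (\<lambda>x. indicator {0<..} x * (x powr (\<nu> - 1) * exp (- l * x) * std_normal_cdf ((\<beta> * x + y) / (\<sigma> * sqrt x))))"
proof (rule Bochner_Integration.integrable_bound[OF vg_kernel_integrable(1)])
  show "AE x in lborel. norm (indicator {0<..} x * (x powr (\<nu> - 1) * exp (- l * x) * std_normal_cdf ((\<beta> * x + y) / (\<sigma> * sqrt x))))
    \<le> norm (gamma_kernel \<nu> l x)"
  proof (rule AE_I2)
    fix x
    have "\<bar>std_normal_cdf ((\<beta> * x + y) / (\<sigma> * sqrt x))\<bar> \<le> 1"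
      using std_normal_cdf_bounds by simp
    then show "norm (indicator {0<..} x * (x powr (\<nu> - 1) * exp (- l * x) * std_normal_cdf ((\<beta> * x + y) / (\<sigma> * sqrt x))))
      \<le> norm (gamma_kernel \<nu> l x)"
      by (auto simp: abs_mult indicator_def intro!: mult_left_le)
  qed
qed simp

lemma vg_mixture_bounds: "0 \<le> vg_mixture \<nu> l \<sigma> \<beta> y" "vg_mixture \<nu> l \<sigma> \<beta> y \<le> Gamma \<nu> / l powr \<nu>"
proof -
  show "0 \<le> vg_mixture \<nu> l \<sigma> \<beta> y"
    unfolding vg_mixture_def set_lebesgue_integral_def
    by (intro integral_nonneg_AE AE_I2) (auto simp: std_normal_cdf_bounds)
  show "vg_mixture \<nu> l \<sigma> \<beta> y \<le> Gamma \<nu> / l powr \<nu>"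
    unfolding vg_mixture_def set_lebesgue_integral_def vg_kernel_integrable(2)[symmetric] real_scaleR_def
  proof (rule integral_mono[OF vg_integrand_integrable vg_kernel_integrable(1)])
    show "indicator {0<..} x * (x powr (\<nu> - 1) * exp (- l * x) * std_normal_cdf ((\<beta> * x + y) / (\<sigma> * sqrt x)))
      \<le> gamma_kernel \<nu> l x" for x
      by (auto simp: indicator_def std_normal_cdf_bounds intro!: mult_left_le)
  qed
qed

lemma vg_mixture_mono:
  assumes "y \<le> y'" shows "vg_mixture \<nu> l \<sigma> \<beta> y \<le> vg_mixture \<nu> l \<sigma> \<beta> y'"
  unfolding vg_mixture_def set_lebesgue_integral_def real_scaleR_def
proof (rule integral_mono[OF vg_integrand_integrable vg_integrand_integrable])
  show "indicator {0<..} x * (x powr (\<nu> - 1) * exp (- l * x) * std_normal_cdf ((\<beta> * x + y) / (\<sigma> * sqrt x)))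
    \<le> indicator {0<..} x * (x powr (\<nu> - 1) * exp (- l * x) * std_normal_cdf ((\<beta> * x + y') / (\<sigma> * sqrt x)))" for x
    using assms \<sigma> by (auto simp: indicator_def intro!: mult_left_mono std_normal_cdf_mono divide_right_mono)
qed

lemma vg_mixture_measurable [measurable]: "vg_mixture \<nu> l \<sigma> \<beta> \<in> borel_measurable borel"
  by (intro borel_measurable_mono monoI vg_mixture_mono)

lemma vg_mixture_nn_integral:
  "(\<integral>\<^sup>+x. ennreal (gamma_kernel \<nu> l x) * ennreal (std_normal_cdf ((\<beta> * x + y) / (\<sigma> * sqrt x))) \<partial>lborel)
   = ennreal (vg_mixture \<nu> l \<sigma> \<beta> y)"
proof -
  have "(\<integral>\<^sup>+x. ennreal (gamma_kernel \<nu> l x) * ennreal (std_normal_cdf ((\<beta> * x + y) / (\<sigma> * sqrt x))) \<partial>lborel)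
    = (\<integral>\<^sup>+x. ennreal (indicator {0<..} x * (x powr (\<nu> - 1) * exp (- l * x) * std_normal_cdf ((\<beta> * x + y) / (\<sigma> * sqrt x)))) \<partial>lborel)"
    by (intro nn_integral_cong) (simp add: ennreal_mult''[symmetric] std_normal_cdf_bounds mult.assoc)
  also have "\<dots> = ennreal (vg_mixture \<nu> l \<sigma> \<beta> y)"
    unfolding vg_mixture_def set_lebesgue_integral_def real_scaleR_def
    by (intro nn_integral_eq_integral vg_integrand_integrable) (auto simp: std_normal_cdf_bounds)
  finally show ?thesis .
qed

lemma vg_mixture_zero:
  "sqrt (2 * pi) * (l powr \<nu> * vg_mixture \<nu> l \<sigma> \<beta> 0) =
    Gamma (\<nu> + 1/2) * (Beta (1/2) \<nu> / sqrt 2 + \<beta> / (\<sigma> * sqrt l) *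
       gauss_hypergeom (\<nu> + 1/2) (1/2) (3/2) (- (\<beta>\<^sup>2 / (2 * l * \<sigma>\<^sup>2))))"
proof -
  define D where "D = sqrt (\<beta>\<^sup>2 + 2 * l * \<sigma>\<^sup>2)"
  note R = gamma_mixture_rescale[OF \<nu> l \<sigma>, where \<beta> = \<beta>, folded D_def]
  have z2: "(\<beta> / (\<sigma> * sqrt (2 * l)))\<^sup>2 = \<beta>\<^sup>2 / (2 * l * \<sigma>\<^sup>2)"
    using l by (simp add: power_divide power_mult_distrib mult.commute)
  have z: "sqrt 2 * (\<beta> / (\<sigma> * sqrt (2 * l)) * g) = \<beta> / (\<sigma> * sqrt l) * g" for g
    by (simp add: real_sqrt_mult)
  show ?thesis
    unfolding vg_mixture_def R(3)[where y = 0]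
    using std_normal_cdf_mixture_zero[OF \<nu> R(1), unfolded R(2) z2 z] by simp
qed

lemma vg_mixture_nonzero:
  assumes y: "y \<noteq> 0"
  defines "D \<equiv> sqrt (\<beta>\<^sup>2 + 2 * l * \<sigma>\<^sup>2)"
  defines "q \<equiv> \<beta> / D" and "s \<equiv> y * D / \<sigma>\<^sup>2"
  shows "sqrt (2 * pi) * (l powr \<nu> * vg_mixture \<nu> l \<sigma> \<beta> y) =
     \<bar>s\<bar> powr (\<nu> - 1/2) * exp s * (1 + q) powr \<nu> *
       (Beta \<nu> 1 * (\<bar>s\<bar> * macdonald (\<nu> + 1/2) \<bar>s\<bar> + s * macdonald (\<nu> - 1/2) \<bar>s\<bar>)
          * appell_degenerate (\<nu> + real 0) (1 - \<nu>) (\<nu> + 1 + real 0) ((1 + q) / 2) (- s * (1 + q))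
        - (1 + q) * s * Beta (\<nu> + 1) 1 * macdonald (\<nu> - 1/2) \<bar>s\<bar>
          * appell_degenerate (\<nu> + real 1) (1 - \<nu>) (\<nu> + 1 + real 1) ((1 + q) / 2) (- s * (1 + q)))"
proof -
  have "0 < \<beta>\<^sup>2 + 2 * l * \<sigma>\<^sup>2" using l \<sigma> by (intro add_nonneg_pos) auto
  then have s: "s \<noteq> 0" using y \<sigma> by (simp add: s_def D_def)
  note R = gamma_mixture_rescale[OF \<nu> l \<sigma>, where \<beta> = \<beta>, folded D_def, folded q_def]
  show ?thesis
    unfolding vg_mixture_def R(3)[of y, folded s_def]
    using std_normal_cdf_mixture_nonzero[OF \<nu> R(1) s] .
qed

end

section \<open>Distributions determined by their exponential moments\<close>

text \<open>
The constant term is the value at \<open>0\<close>; dividing by \<open>x\<close> shifts the coefficients, and the value of the shifted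
series at \<open>0\<close> is a limit.
\<close>

lemma real_power_series_zero_coeffs:
  fixes a :: "nat \<Rightarrow> real"
  assumes "\<And>x. (\<lambda>n. a n * x ^ n) sums 0"
  shows "a n = 0"
  using assms
proof (induction n arbitrary: a)
  case 0
  then show ?case using sums_unique2[OF powser_sums_zero 0] by simp
next
  case (Suc n)
  have a0: "a 0 = 0" using sums_unique2[OF powser_sums_zero Suc.prems] by simp
  have shift: "(\<lambda>n. a (Suc n) * x ^ n) sums 0" if x: "x \<noteq> 0" for x
  proof -
    have "(\<lambda>n. a (Suc n) * x ^ Suc n) sums 0"
      using Suc.prems[of x] a0 by (subst sums_Suc_iff) simp
    from sums_mult[OF this, of "1 / x"] show ?thesis
      using x by (simp add: field_simps)
  qed
  have *: "(\<lambda>n. a (Suc n) * x ^ n) sums (if x = 0 then a 1 else 0)" for x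
    using shift[of x] powser_sums_zero[of "\<lambda>n. a (Suc n)"] by auto
  from powser_limit_0[OF zero_less_one *]
  have "((\<lambda>x::real. if x = 0 then a 1 else 0) \<longlongrightarrow> a (Suc 0)) (at 0)" .
  moreover have "((\<lambda>x::real. if x = 0 then a 1 else 0) \<longlongrightarrow> 0) (at 0)"
    by (rule tendsto_eventually) (auto simp: eventually_at_filter)
  ultimately have "a (Suc 0) = 0" using tendsto_unique by (metis at_neq_bot)
  then have "(\<lambda>n. a (Suc n) * x ^ n) sums 0" for x
    using shift[of x] powser_sums_zero[of "\<lambda>n. a (Suc n)"] by (cases "x = 0") auto
  then show ?case by (rule Suc.IH)
qed

text \<open>
Stated for complex \<open>z\<close> so that it covers the moment generating function (real \<open>z\<close>) and the characteristic
function (imaginary \<open>z\<close>) at once.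
\<close>

lemma (in real_distribution) exponential_moment_series:
  assumes int: "\<And>u. integrable M (\<lambda>x. exp (u * x))"
  shows "(\<lambda>k. z ^ k / fact k * of_real (LINT x|M. x ^ k)) sums (LINT x|M. exp (z * complex_of_real x))"
proof -
  define f where "f k x = z ^ k / fact k * complex_of_real (x ^ k)" for k x
  define c where "c = cmod z"
  have nf: "norm (f k x) = (c * \<bar>x\<bar>) ^ k / fact k" for k x
    by (simp add: f_def norm_mult norm_divide norm_power c_def power_mult_distrib power_abs)
  have expabs: "integrable M (\<lambda>x. exp (u * \<bar>x\<bar>))" for u
  proof (rule Bochner_Integration.integrable_bound[OF Bochner_Integration.integrable_add[OF int[of u] int[of "- u"]]])
    show "AE x in M. norm (exp (u * \<bar>x\<bar>)) \<le> norm (exp (u * x) + exp (- u * x))"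
    proof (rule AE_I2)
      fix x
      have "exp (u * \<bar>x\<bar>) \<le> exp (u * x) + exp (- u * x)" by (cases "x \<ge> 0") auto
      moreover have "0 \<le> exp (u * x) + exp (- u * x)" by (intro add_nonneg_nonneg) auto
      ultimately show "norm (exp (u * \<bar>x\<bar>)) \<le> norm (exp (u * x) + exp (- u * x))"
        by (simp only: real_norm_def abs_exp_cancel abs_of_nonneg)
    qed
  qed simp
  have nf_le: "norm (f k x) \<le> exp (c * \<bar>x\<bar>)" for k x
  proof -
    have "(\<lambda>k. (c * \<bar>x\<bar>) ^ k /\<^sub>R fact k) sums exp (c * \<bar>x\<bar>)" by (rule exp_converges)
    then have "(\<Sum>i\<in>{k}. (c * \<bar>x\<bar>) ^ i /\<^sub>R fact i) \<le> exp (c * \<bar>x\<bar>)"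
      unfolding sums_iff by (metis (no_types, lifting) c_def divideR_right abs_ge_zero finite.emptyI finite.insertI
          fact_gt_zero inverse_nonnegative_iff_nonnegative mult_nonneg_nonneg norm_ge_zero order_less_imp_le
          scaleR_nonneg_nonneg sum_le_suminf zero_le_power)
    then show ?thesis unfolding nf by (simp add: divide_inverse mult.commute)
  qed
  have [measurable]: "f k \<in> borel_measurable M" for k unfolding f_def by measurable
  have intf: "integrable M (f k)" for k
    by (rule Bochner_Integration.integrable_bound[OF expabs[of c]]) (use nf_le in auto)
  have nsums: "(\<lambda>k. norm (f k x)) sums exp (c * \<bar>x\<bar>)" for x
    using exp_converges[of "c * \<bar>x\<bar>"] unfolding nf by (simp add: divide_inverse mult.commute)
  have summ: "summable (\<lambda>k. LINT x|M. norm (f k x))"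
  proof (rule summableI_nonneg_bounded)
    fix n
    have "(\<Sum>k<n. LINT x|M. norm (f k x)) = (LINT x|M. (\<Sum>k<n. norm (f k x)))"
      by (rule Bochner_Integration.integral_sum[symmetric]) (intro integrable_norm intf)
    also have "\<dots> \<le> (LINT x|M. exp (c * \<bar>x\<bar>))"
    proof (rule integral_mono)
      show "(\<Sum>k<n. norm (f k x)) \<le> exp (c * \<bar>x\<bar>)" for x
        using nsums[of x] by (metis finite_lessThan norm_ge_zero sum_le_suminf sums_iff)
    qed (intro Bochner_Integration.integrable_sum integrable_norm intf expabs)+
    finally show "(\<Sum>k<n. LINT x|M. norm (f k x)) \<le> (LINT x|M. exp (c * \<bar>x\<bar>))" .
  qed simp
  have "(\<lambda>k. LINT x|M. f k x) sums (LINT x|M. (\<Sum>k. f k x))"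
    by (rule sums_integral[OF intf _ summ]) (use nsums in \<open>auto simp: sums_iff\<close>)
  moreover have "(\<Sum>k. f k x) = exp (z * complex_of_real x)" for x
  proof -
    have "(\<lambda>k. (z * complex_of_real x) ^ k /\<^sub>R fact k) sums exp (z * complex_of_real x)" by (rule exp_converges)
    moreover have "(z * complex_of_real x) ^ k /\<^sub>R fact k = f k x" for k
      by (simp add: f_def scaleR_conv_of_real divide_inverse power_mult_distrib)
    ultimately show ?thesis by (simp add: sums_iff)
  qed
  moreover have "(LINT x|M. f k x) = z ^ k / fact k * of_real (LINT x|M. x ^ k)" for k
    unfolding f_def by (simp only: integral_mult_right_zero integral_complex_of_real)
  ultimately show ?thesis by simp
qed

text \<open>
Equality of the moment generating functions on the real line gives equality of all moments, these
determine the characteristic functions through the same power series, and Levy's theorem applies.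
\<close>

lemma exponential_moments_unique:
  assumes \<mu>: "real_distribution \<mu>" and \<nu>: "real_distribution \<nu>"
    and int\<mu>: "\<And>u. integrable \<mu> (\<lambda>x. exp (u * x))" and int\<nu>: "\<And>u. integrable \<nu> (\<lambda>x. exp (u * x))"
    and eq: "\<And>u. (LINT x|\<mu>. exp (u * x)) = (LINT x|\<nu>. exp (u * x))"
  shows "\<mu> = \<nu>"
proof (rule Levy_uniqueness[OF \<mu> \<nu>], rule ext)
  note S\<mu> = real_distribution.exponential_moment_series[OF \<mu> int\<mu>]
  note S\<nu> = real_distribution.exponential_moment_series[OF \<nu> int\<nu>]
  have moments: "(LINT x|\<mu>. x ^ k) = (LINT x|\<nu>. x ^ k)" for k
  proof -
    define a where "a k = ((LINT x|\<mu>. x ^ k) - (LINT x|\<nu>. x ^ k)) / fact k" for k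
    have "(\<lambda>k. a k * u ^ k) sums 0" for u
    proof -
      have L: "(LINT x|\<mu>. exp (complex_of_real u * complex_of_real x)) = of_real (LINT x|\<mu>. exp (u * x))"
        and R: "(LINT x|\<nu>. exp (complex_of_real u * complex_of_real x)) = of_real (LINT x|\<nu>. exp (u * x))"
        by (simp_all add: of_real_mult[symmetric] exp_of_real del: of_real_mult)
      have "(\<lambda>k. complex_of_real (a k * u ^ k)) sums complex_of_real 0"
        using sums_diff[OF S\<mu>[of "of_real u"] S\<nu>[of "of_real u"]] unfolding L R eq
        by (simp add: a_def diff_divide_distrib algebra_simps)
      then show ?thesis unfolding sums_of_real_iff .
    qed
    then have "a k = 0" by (rule real_power_series_zero_coeffs)
    then show ?thesis by (simp add: a_def)
  qed
  fix t :: real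
  have "(LINT x|\<mu>. exp (\<i> * t * complex_of_real x)) = (LINT x|\<nu>. exp (\<i> * t * complex_of_real x))"
    using S\<mu>[of "\<i> * t"] S\<nu>[of "\<i> * t"] unfolding moments by (rule sums_unique2)
  then show "char \<mu> t = char \<nu> t"
    by (simp add: char_def mult.assoc)
qed

text \<open>
Completing the square; the degenerate law is treated separately.
\<close>

lemma centred_gaussian_mgf:
  assumes "prob_space M" and g: "centred_gaussian M X v"
  shows "integrable M (\<lambda>w. exp (X w))" "(LINT w|M. exp (X w)) = exp (v / 2)"
proof -
  interpret prob_space M by fact
  have v: "0 \<le> v" and X[measurable]: "X \<in> borel_measurable M"
    and d: "distr M borel X = (if v = 0 then return borel 0 else density lborel (\<lambda>x. ennreal (normal_density 0 (sqrt v) x)))"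
    using g by (auto simp: centred_gaussian_def)
  have "has_bochner_integral (distr M borel X) exp (exp (v / 2))"
  proof (cases "v = 0")
    case True
    interpret R: prob_space "return borel (0::real)" by (rule prob_space_return) simp
    have "AE x in return borel (0::real). exp 0 = exp x" by (subst AE_return) auto
    then have "integrable (return borel (0::real)) exp"
      by (subst Bochner_Integration.integrable_cong_AE[where g = "\<lambda>x. exp 0"]) auto
    moreover have "(LINT x|return borel (0::real). exp x) = exp 0"
      by (rule integral_return) auto
    ultimately have "has_bochner_integral (return borel (0::real)) exp (exp (0::real))"
      by (simp add: has_bochner_integral_iff)
    then show ?thesis unfolding d using True by simp
  next
    case False
    then have v: "v > 0" using v by simp
    have "normal_density 0 (sqrt v) x * exp x = exp (v / 2) * normal_density v (sqrt v) x" for x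
    proof -
      have "- (x - 0)\<^sup>2 / (2 * (sqrt v)\<^sup>2) + x = v / 2 + - (x - v)\<^sup>2 / (2 * (sqrt v)\<^sup>2)"
        using v by (simp add: power2_eq_square field_simps)
      then have "exp (- (x - 0)\<^sup>2 / (2 * (sqrt v)\<^sup>2)) * exp x = exp (v / 2) * exp (- (x - v)\<^sup>2 / (2 * (sqrt v)\<^sup>2))"
        unfolding exp_add[symmetric] by simp
      then show ?thesis unfolding normal_density_def by (simp add: mult_ac)
    qed
    moreover have "has_bochner_integral lborel (\<lambda>x. exp (v / 2) * normal_density v (sqrt v) x) (exp (v / 2) * 1)"
      using v by (intro has_bochner_integral_mult_right) (simp add: has_bochner_integral_iff)
    ultimately have "has_bochner_integral lborel (\<lambda>x. normal_density 0 (sqrt v) x *\<^sub>R exp x) (exp (v / 2))"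
      by simp
    then have "has_bochner_integral (density lborel (\<lambda>x. ennreal (normal_density 0 (sqrt v) x))) exp (exp (v / 2))"
      by (intro has_bochner_integral_density) auto
    then show ?thesis unfolding d using False by simp
  qed
  then show "integrable M (\<lambda>w. exp (X w))" "(LINT w|M. exp (X w)) = exp (v / 2)"
    by (auto simp: has_bochner_integral_iff integrable_distr_eq integral_distr)
qed

section \<open>Integrals over independent sigma-algebras\<close>

text \<open>
The generated sigma-algebra as a measure on the underlying space, so that measurability with respect to it
can be expressed.
\<close>

definition generated_algebra ::
  "'a measure \<Rightarrow> 'i set \<Rightarrow> ('i \<Rightarrow> 'a \<Rightarrow> 'b::topological_space) \<Rightarrow> 'a measure" where
  "generated_algebra M I X = sigma (space M) (generated_sets M I X)"

lemma generated_sets_Pow: "generated_sets M I X \<subseteq> Pow (space M)"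
proof
  fix A assume "A \<in> generated_sets M I X"
  then have "A \<subseteq> space M"
    unfolding generated_sets_def by (rule sigma_sets_into_sp[rotated]) auto
  then show "A \<in> Pow (space M)" by simp
qed

lemma space_generated_algebra [simp]: "space (generated_algebra M I X) = space M"
  by (simp add: generated_algebra_def space_measure_of generated_sets_Pow)

lemma sets_generated_algebra [simp]: "sets (generated_algebra M I X) = generated_sets M I X"
  unfolding generated_algebra_def sets_measure_of[OF generated_sets_Pow]
  unfolding generated_sets_def by (rule sigma_sets_sigma_sets_eq) auto

lemma measurable_generated_algebra:
  "i \<in> I \<Longrightarrow> X i \<in> borel_measurable (generated_algebra M I X)"
  by (rule measurableI) (auto simp: generated_sets_def intro!: sigma_sets.Basic)

text \<open>
Independence of two sigma-algebras says that the diagonal map sends the probability to the product of its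
restrictions. Hence the two occurrences of the outcome may be averaged separately even if the
integrand, such as a time-changed path, is not a function of two random variables with values in nice
spaces.
\<close>

lemma (in prob_space) indep_set_nn_integral:
  assumes S: "space S = space M" and T: "space T = space M"
    and indep: "indep_set (sets S) (sets T)"
    and f[measurable]: "case_prod f \<in> borel_measurable (S \<Otimes>\<^sub>M T)"
  shows "(\<integral>\<^sup>+w. f w w \<partial>M) = (\<integral>\<^sup>+w. \<integral>\<^sup>+w'. f w w' \<partial>M \<partial>M)"
proof -
  note sub = indep_setD_ev1[OF indep] indep_setD_ev2[OF indep]
  have vimage: "(\<lambda>x. x) -` A \<inter> space M = A" if "A \<in> sets M" for A
    using sets.sets_into_space[OF that] by blast
  have id_measurable: "(\<lambda>x. x) \<in> measurable M R" if "space R = space M" "sets R \<subseteq> sets M" for R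
  proof (rule measurableI)
    show "x \<in> space R" if "x \<in> space M" for x using that \<open>space R = space M\<close> by simp
    show "(\<lambda>x. x) -` A \<inter> space M \<in> sets M" if "A \<in> sets R" for A
      using that \<open>sets R \<subseteq> sets M\<close> vimage[of A] by auto
  qed
  note idS[measurable] = id_measurable[OF S sub(1)] and idT[measurable] = id_measurable[OF T sub(2)]
  have pre: "sigma_sets (space M) {(\<lambda>x. x) -` A \<inter> space M |A. A \<in> sets R} = sets R"
    if "space R = space M" "sets R \<subseteq> sets M" for R
  proof -
    have "{(\<lambda>x. x) -` A \<inter> space M |A. A \<in> sets R} = (\<lambda>A. (\<lambda>x. x) -` A \<inter> space M) ` sets R"
      by (rule Setcompr_eq_image)
    also have "\<dots> = (\<lambda>A. A) ` sets R"
      using that(2) by (intro image_cong refl vimage) auto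
    finally show ?thesis using sets.sigma_sets_eq[of R] that(1) by simp
  qed
  have "indep_var S (\<lambda>x. x) T (\<lambda>x. x)"
    unfolding indep_var_eq pre[OF S sub(1)] pre[OF T sub(2)] using indep idS idT by blast
  then have eq: "distr M S (\<lambda>x. x) \<Otimes>\<^sub>M distr M T (\<lambda>x. x) = distr M (S \<Otimes>\<^sub>M T) (\<lambda>x. (x, x))"
    unfolding indep_var_distribution_eq by blast
  interpret DS: prob_space "distr M S (\<lambda>x. x)" by (rule prob_space_distr) (rule idS)
  interpret DT: prob_space "distr M T (\<lambda>x. x)" by (rule prob_space_distr) (rule idT)
  have fST: "case_prod f \<in> borel_measurable (distr M S (\<lambda>x. x) \<Otimes>\<^sub>M distr M T (\<lambda>x. x))"
    by (subst measurable_cong_sets[OF sets_pair_measure_cong[OF sets_distr sets_distr] refl]) (rule f)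
  have fdiag: "case_prod f \<in> borel_measurable (distr M (S \<Otimes>\<^sub>M T) (\<lambda>x. (x, x)))"
    unfolding measurable_distr_eq1 by (rule f)
  have "(\<integral>\<^sup>+w. f w w \<partial>M) = (\<integral>\<^sup>+p. case_prod f p \<partial>distr M (S \<Otimes>\<^sub>M T) (\<lambda>x. (x, x)))"
    using nn_integral_distr[OF measurable_Pair[OF idS idT] fdiag] by (simp only: prod.case)
  also have "\<dots> = (\<integral>\<^sup>+w. \<integral>\<^sup>+w'. f w w' \<partial>distr M T (\<lambda>x. x) \<partial>distr M S (\<lambda>x. x))"
    unfolding eq[symmetric] using DT.nn_integral_fst[OF fST] by (simp only: prod.case)
  also have "\<dots> = (\<integral>\<^sup>+w. \<integral>\<^sup>+w'. f w w' \<partial>distr M T (\<lambda>x. x) \<partial>M)"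
  proof (rule nn_integral_distr[OF idS])
    show "(\<lambda>w. \<integral>\<^sup>+w'. f w w' \<partial>distr M T (\<lambda>x. x)) \<in> borel_measurable (distr M S (\<lambda>x. x))"
      using DT.borel_measurable_nn_integral_fst[OF fST] by (simp only: prod.case)
  qed
  also have "\<dots> = (\<integral>\<^sup>+w. \<integral>\<^sup>+w'. f w w' \<partial>M \<partial>M)"
  proof (rule nn_integral_cong)
    fix w assume "w \<in> space M"
    then have "f w \<in> borel_measurable (distr M T (\<lambda>x. x))"
      unfolding measurable_distr_eq1 using measurable_Pair2[OF f, of w] S by (simp only: prod.case)
    then show "(\<integral>\<^sup>+w'. f w w' \<partial>distr M T (\<lambda>x. x)) = (\<integral>\<^sup>+w'. f w w' \<partial>M)"
      by (rule nn_integral_distr[OF idT])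
  qed
  finally show ?thesis .
qed

text \<open>
The same decoupling for two disjoint groups from an independent family.
\<close>

lemma (in prob_space) indep_sets_nn_integral:
  assumes indep: "indep_sets (\<lambda>i. sets (R i)) I" and R: "\<And>i. i \<in> I \<Longrightarrow> space (R i) = space M"
    and J: "J \<subseteq> I" "L \<subseteq> I" "J \<inter> L = {}"
    and f: "case_prod f \<in> borel_measurable
      (sigma (space M) (\<Union>i\<in>J. sets (R i)) \<Otimes>\<^sub>M sigma (space M) (\<Union>i\<in>L. sets (R i)))"
  shows "(\<integral>\<^sup>+w. f w w \<partial>M) = (\<integral>\<^sup>+w. \<integral>\<^sup>+w'. f w w' \<partial>M \<partial>M)"
proof (rule indep_set_nn_integral[OF _ _ _ f])
  have sub: "(\<Union>i\<in>X. sets (R i)) \<subseteq> Pow (space M)" if "X \<subseteq> I" for X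
    using that R sets.sets_into_space by fastforce
  have "indep_sets (\<lambda>j. sigma_sets (space M) (\<Union>i\<in>case_bool J L j. sets (R i))) UNIV"
  proof (rule indep_sets_collect_sigma)
    show "indep_sets (\<lambda>i. sets (R i)) (\<Union>j\<in>UNIV. case_bool J L j)"
      using J by (intro indep_sets_mono_index[OF _ indep]) (auto simp: UNIV_bool)
    show "Int_stable (sets (R i))" for i by (rule sets.Int_stable)
    show "disjoint_family_on (case_bool J L) UNIV"
      using J by (auto simp: disjoint_family_on_def split: bool.splits)
  qed
  then show "indep_set (sets (sigma (space M) (\<Union>i\<in>J. sets (R i)))) (sets (sigma (space M) (\<Union>i\<in>L. sets (R i))))"
    unfolding indep_set_def using J
    by (simp add: sets_measure_of[OF sub] ) (rule indep_sets_mono_sets, assumption, auto split: bool.splits)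
qed (auto intro!: space_measure_of simp: space_measure_of_conv)

lemma measurable_sigma_UN:
  assumes "f \<in> measurable (R i) N" "i \<in> J" "\<And>i. i \<in> J \<Longrightarrow> space (R i) = \<Omega>"
  shows "f \<in> measurable (sigma \<Omega> (\<Union>i\<in>J. sets (R i))) N"
proof -
  have sub: "(\<Union>i\<in>J. sets (R i)) \<subseteq> Pow \<Omega>"
    using assms(3) sets.sets_into_space by fastforce
  show ?thesis
  proof (rule measurableI)
    fix x assume "x \<in> space (sigma \<Omega> (\<Union>i\<in>J. sets (R i)))"
    then show "f x \<in> space N" using measurable_space[OF assms(1)] assms(2,3) sub by (simp add: space_measure_of)
  next
    fix A assume "A \<in> sets N"
    then have "f -` A \<inter> \<Omega> \<in> sets (R i)" using measurable_sets[OF assms(1)] assms(2,3) by fastforce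
    then show "f -` A \<inter> space (sigma \<Omega> (\<Union>i\<in>J. sets (R i))) \<in> sets (sigma \<Omega> (\<Union>i\<in>J. sets (R i)))"
      using sub assms(2) by (auto simp: space_measure_of sets_measure_of intro!: sigma_sets.Basic)
  qed
qed

lemma (in prob_space) indep_sets_imp_indep_set:
  assumes "indep_sets F I" "i \<in> I" "j \<in> I" "i \<noteq> j"
  shows "indep_set (F i) (F j)"
  unfolding indep_sets2_eq
proof (intro conjI ballI)
  show "F i \<subseteq> events" "F j \<subseteq> events" using assms by (auto simp: indep_sets_def)
  fix a b assume "a \<in> F i" "b \<in> F j"
  then show "prob (a \<inter> b) = prob a * prob b"
    using indep_setsD[OF assms(1), of "{i, j}" "\<lambda>k. if k = i then a else b"] assms(2-4) by (auto simp: Int_commute)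
qed

text \<open>
The jump parts are split off one after the other. The part of the first asset stays inside the exercise
condition \<open>H\<close>, so it is only decoupled, not factored out.
\<close>

lemma (in prob_space) independent_jumps_nn_integral:
  fixes R :: "nat \<Rightarrow> 'a measure" and X :: "'a \<Rightarrow> real" and Z :: "nat \<Rightarrow> 'a \<Rightarrow> real"
    and V :: "'a \<Rightarrow> ennreal" and H :: "real \<Rightarrow> real \<Rightarrow> ennreal" and g :: "real \<Rightarrow> ennreal"
  assumes indep: "indep_sets (\<lambda>i. sets (R i)) {0, 1, 2, 3}" and R: "\<And>i. i \<in> {0,1,2,3} \<Longrightarrow> space (R i) = space M"
    and V: "V \<in> borel_measurable (R 0)" and X: "X \<in> borel_measurable (R 0)"
    and Z: "\<And>i. i \<in> {1,2,3} \<Longrightarrow> Z i \<in> borel_measurable (R i)"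
    and H: "case_prod H \<in> borel_measurable (borel \<Otimes>\<^sub>M borel)" and g[measurable]: "g \<in> borel_measurable borel"
  shows "(\<integral>\<^sup>+w. V w * H (Z 1 w) (X w) * g (Z 2 w) * g (Z 3 w) \<partial>M)
    = (\<integral>\<^sup>+w'. \<integral>\<^sup>+w. V w * H (Z 1 w') (X w) \<partial>M \<partial>M)
      * (\<integral>\<^sup>+w. g (Z 2 w) \<partial>M) * (\<integral>\<^sup>+w. g (Z 3 w) \<partial>M)"
proof -
  define SG where "SG J = sigma (space M) (\<Union>i\<in>J. sets (R i))" for J
  have inSG: "f \<in> borel_measurable (SG J)" if "f \<in> borel_measurable (R i)" "i \<in> J" "J \<subseteq> {0,1,2,3}" for f :: "'a \<Rightarrow> real" and i J
    unfolding SG_def by (rule measurable_sigma_UN[where R = R and i = i, OF that(1,2)]) (use R that(3) in blast)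
  have inSGe: "f \<in> borel_measurable (SG J)" if "f \<in> borel_measurable (R i)" "i \<in> J" "J \<subseteq> {0,1,2,3}" for f :: "'a \<Rightarrow> ennreal" and i J
    unfolding SG_def by (rule measurable_sigma_UN[where R = R and i = i, OF that(1,2)]) (use R that(3) in blast)
  have sub: "sets (R i) \<subseteq> sets M" if "i \<in> {0,1,2,3}" for i
    using indep that by (auto simp: indep_sets_def)
  have inM: "f \<in> borel_measurable M" if "f \<in> borel_measurable (R i)" "i \<in> {0,1,2,3}" for i and f :: "'a \<Rightarrow> ennreal"
    by (rule measurable_from_subalg[OF _ that(1)]) (simp only: subalgebra_def sub[OF that(2)] R[OF that(2)] simp_thms)
  have gZ: "(\<lambda>w. g (Z i w)) \<in> borel_measurable (R i)" if "i \<in> {1,2,3}" for i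
    by (rule measurable_compose[OF Z[OF that] g])
  have split: "(\<integral>\<^sup>+w. f w w \<partial>M) = (\<integral>\<^sup>+w. \<integral>\<^sup>+w'. f w w' \<partial>M \<partial>M)"
    if "case_prod f \<in> borel_measurable (SG J \<Otimes>\<^sub>M SG L)" "J \<subseteq> {0,1,2,3}" "L \<subseteq> {0,1,2,3}" "J \<inter> L = {}" for f J L
    using that unfolding SG_def by (intro indep_sets_nn_integral[OF indep R])
  have HZX: "(\<lambda>w. V w * H (Z 1 w) (X w)) \<in> borel_measurable (SG {0,1})"
  proof -
    have "(\<lambda>w. (Z 1 w, X w)) \<in> measurable (SG {0,1}) (borel \<Otimes>\<^sub>M borel)"
      by (intro measurable_Pair inSG[OF Z, of 1] inSG[OF X]) auto
    from measurable_compose[OF this H] show ?thesis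
      by (intro borel_measurable_times_ennreal inSGe[OF V]) auto
  qed
  have SG: "space (SG J) = space M" "sets (SG J) = sigma_sets (space M) (\<Union>i\<in>J. sets (R i))" if "J \<subseteq> {0,1,2,3}" for J
  proof -
    have *: "(\<Union>i\<in>J. sets (R i)) \<subseteq> Pow (space M)"
    proof (rule UN_least)
      show "sets (R i) \<subseteq> Pow (space M)" if "i \<in> J" for i
        using sets.space_closed[of "R i"] R[of i] that \<open>J \<subseteq> {0,1,2,3}\<close> by auto
    qed
    show "space (SG J) = space M" "sets (SG J) = sigma_sets (space M) (\<Union>i\<in>J. sets (R i))"
      unfolding SG_def by (rule space_measure_of[OF *], rule sets_measure_of[OF *])
  qed
  have SGmono: "f \<in> borel_measurable (SG L)" if f: "f \<in> borel_measurable (SG J)" and JL: "J \<subseteq> L" "L \<subseteq> {0,1,2,3}" for f :: "'a \<Rightarrow> ennreal" and J L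
  proof (rule measurable_from_subalg[OF _ f])
    have J: "J \<subseteq> {0,1,2,3}" using JL by (rule order_trans)
    have "sigma_sets (space M) (\<Union>i\<in>J. sets (R i)) \<subseteq> sigma_sets (space M) (\<Union>i\<in>L. sets (R i))"
      using JL(1) by (intro sigma_sets_mono' UN_mono) auto
    then show "subalgebra (SG L) (SG J)" by (simp only: subalgebra_def SG[OF J] SG[OF JL(2)] simp_thms)
  qed
  have SGM: "f \<in> borel_measurable M" if f: "f \<in> borel_measurable (SG J)" and J: "J \<subseteq> {0,1,2,3}" for f :: "'a \<Rightarrow> ennreal" and J
  proof (rule measurable_from_subalg[OF _ f])
    have "sigma_sets (space M) (\<Union>i\<in>J. sets (R i)) \<subseteq> sets M"
      using sub J by (intro sets.sigma_sets_subset UN_least) auto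
    then show "subalgebra M (SG J)" by (simp only: subalgebra_def SG[OF J] simp_thms)
  qed
  define f3 where "f3 w w' = V w * H (Z 1 w) (X w) * g (Z 2 w) * g (Z 3 w')" for w w'
  define f2 where "f2 w w' = V w * H (Z 1 w) (X w) * g (Z 2 w')" for w w'
  define f1 where "f1 w w' = V w' * H (Z 1 w) (X w')" for w w'
  have m3: "(\<lambda>w. V w * H (Z 1 w) (X w) * g (Z 2 w)) \<in> borel_measurable (SG {0,1,2})"
    by (intro borel_measurable_times_ennreal SGmono[OF HZX] inSGe[OF gZ, of 2]) auto
  have "(\<integral>\<^sup>+w. f3 w w \<partial>M) = (\<integral>\<^sup>+w. \<integral>\<^sup>+w'. f3 w w' \<partial>M \<partial>M)"
  proof (rule split[of _ "{0,1,2}" "{3}"])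
    show "case_prod f3 \<in> borel_measurable (SG {0, 1, 2} \<Otimes>\<^sub>M SG {3})"
      unfolding f3_def case_prod_beta'
      by (intro borel_measurable_times_ennreal[OF measurable_compose[OF measurable_fst m3] measurable_compose[OF measurable_snd]] inSGe[OF gZ, of 3]) auto
  qed auto
  also have "\<dots> = (\<integral>\<^sup>+w. V w * H (Z 1 w) (X w) * g (Z 2 w) * (\<integral>\<^sup>+w'. g (Z 3 w') \<partial>M) \<partial>M)"
    unfolding f3_def by (intro nn_integral_cong nn_integral_cmult inM[OF gZ]) auto
  also have "\<dots> = (\<integral>\<^sup>+w. f2 w w \<partial>M) * (\<integral>\<^sup>+w'. g (Z 3 w') \<partial>M)"
    unfolding f2_def by (intro nn_integral_multc SGM[OF m3]) auto
  also have "(\<integral>\<^sup>+w. f2 w w \<partial>M) = (\<integral>\<^sup>+w. \<integral>\<^sup>+w'. f2 w w' \<partial>M \<partial>M)"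
  proof (rule split[of _ "{0,1}" "{2}"])
    show "case_prod f2 \<in> borel_measurable (SG {0, 1} \<Otimes>\<^sub>M SG {2})"
      unfolding f2_def case_prod_beta'
      by (intro borel_measurable_times_ennreal[OF measurable_compose[OF measurable_fst HZX] measurable_compose[OF measurable_snd]] inSGe[OF gZ, of 2]) auto
  qed auto
  also have "\<dots> = (\<integral>\<^sup>+w. V w * H (Z 1 w) (X w) * (\<integral>\<^sup>+w'. g (Z 2 w') \<partial>M) \<partial>M)"
    unfolding f2_def by (intro nn_integral_cong nn_integral_cmult inM[OF gZ]) auto
  also have "\<dots> = (\<integral>\<^sup>+w. f1 w w \<partial>M) * (\<integral>\<^sup>+w'. g (Z 2 w') \<partial>M)"
    unfolding f1_def by (intro nn_integral_multc SGM[OF HZX]) auto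
  also have "(\<integral>\<^sup>+w. f1 w w \<partial>M) = (\<integral>\<^sup>+w. \<integral>\<^sup>+w'. f1 w w' \<partial>M \<partial>M)"
  proof (rule split[of _ "{1}" "{0}"])
    have "(\<lambda>p. (Z 1 (fst p), X (snd p))) \<in> measurable (SG {1} \<Otimes>\<^sub>M SG {0}) (borel \<Otimes>\<^sub>M borel)"
      by (intro measurable_Pair measurable_compose[OF measurable_fst inSG[OF Z, of 1]] measurable_compose[OF measurable_snd inSG[OF X]]) auto
    from measurable_compose[OF this H]
    have "(\<lambda>p. H (Z 1 (fst p)) (X (snd p))) \<in> borel_measurable (SG {1} \<Otimes>\<^sub>M SG {0})" by simp
    then show "case_prod f1 \<in> borel_measurable (SG {1} \<Otimes>\<^sub>M SG {0})"
      unfolding f1_def case_prod_beta'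
      by (intro borel_measurable_times_ennreal measurable_compose[OF measurable_snd inSGe[OF V]]) auto
  qed auto
  finally show ?thesis unfolding f3_def f1_def .
qed

section \<open>Tilting a correlated Wiener process\<close>

text \<open>
The index \<open>1\<close> of the first asset is to remain a numeral, like \<open>2\<close> and \<open>3\<close>, when terms are simplified.
\<close>

declare One_nat_def [simp del]

text \<open>
The path at time \<open>t\<close> is the limit of its values at the grid points \<open>\<lfloor>(n + 1) * t\<rfloor> / (n + 1)\<close>, which take
countably many values. Truncation at \<open>0\<close> makes the process total in time.
\<close>

lemma continuous_process_measurable:
  fixes X :: "real \<Rightarrow> 'a \<Rightarrow> real"
  assumes X: "\<And>t. 0 \<le> t \<Longrightarrow> X t \<in> borel_measurable N"
    and cont: "\<And>w. w \<in> space N \<Longrightarrow> continuous_on {0..} (\<lambda>t. X t w)"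
  shows "(\<lambda>(t, w). X (max 0 t) w) \<in> borel_measurable ((borel :: real measure) \<Otimes>\<^sub>M N)"
proof (rule borel_measurable_LIMSEQ_metric)
  define k where "k n t = nat \<lfloor>real (Suc n) * max 0 t\<rfloor>" for n and t :: real
  fix n
  have [measurable]: "(\<lambda>p. k n (fst p)) \<in> measurable ((borel :: real measure) \<Otimes>\<^sub>M N) (count_space UNIV)"
    unfolding k_def by measurable
  have "(\<lambda>p. X (real (k n (fst p)) / real (Suc n)) (snd p)) \<in> borel_measurable ((borel :: real measure) \<Otimes>\<^sub>M N)"
    by (rule measurable_compose_countable[where f = "\<lambda>i p. X (real i / real (Suc n)) (snd p)"])
       (auto intro!: measurable_compose[OF measurable_snd X])
  then show "(\<lambda>(t, w). X (real (k n t) / real (Suc n)) w) \<in> borel_measurable ((borel :: real measure) \<Otimes>\<^sub>M N)"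
    by (simp add: case_prod_beta')
next
  fix p assume "p \<in> space ((borel :: real measure) \<Otimes>\<^sub>M N)"
  then obtain t w where p: "p = (t, w)" "w \<in> space N" by (auto simp: space_pair_measure)
  define m where "m = max 0 t"
  have m: "m \<ge> 0" by (simp add: m_def)
  have "(\<lambda>n. real (nat \<lfloor>real (Suc n) * m\<rfloor>) / real (Suc n)) \<longlonglongrightarrow> m"
  proof (rule real_tendsto_sandwich)
    show "\<forall>\<^sub>F n in sequentially. m - 1 / real (Suc n) \<le> real (nat \<lfloor>real (Suc n) * m\<rfloor>) / real (Suc n)"
    proof (intro always_eventually allI)
      fix n
      have "real (Suc n) * m - 1 \<le> real (nat \<lfloor>real (Suc n) * m\<rfloor>)" using m by linarith
      then have "(real (Suc n) * m - 1) / real (Suc n) \<le> real (nat \<lfloor>real (Suc n) * m\<rfloor>) / real (Suc n)"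
        by (rule divide_right_mono) simp
      then show "m - 1 / real (Suc n) \<le> real (nat \<lfloor>real (Suc n) * m\<rfloor>) / real (Suc n)"
        by (simp add: diff_divide_distrib)
    qed
    show "\<forall>\<^sub>F n in sequentially. real (nat \<lfloor>real (Suc n) * m\<rfloor>) / real (Suc n) \<le> m"
    proof (intro always_eventually allI)
      fix n
      have "real (nat \<lfloor>real (Suc n) * m\<rfloor>) \<le> real (Suc n) * m" using m by (simp add: of_nat_nat del: of_nat_Suc)
      then show "real (nat \<lfloor>real (Suc n) * m\<rfloor>) / real (Suc n) \<le> m"
        by (simp add: pos_divide_le_eq mult.commute del: of_nat_Suc)
    qed
    show "(\<lambda>n. m - 1 / real (Suc n)) \<longlonglongrightarrow> m"
      using tendsto_diff[OF tendsto_const[of m] lim_inverse_n'[THEN LIMSEQ_Suc]] by simp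
  qed simp
  then have "(\<lambda>n. X (real (nat \<lfloor>real (Suc n) * m\<rfloor>) / real (Suc n)) w) \<longlonglongrightarrow> X m w"
    using m by (intro continuous_on_tendsto_compose[OF cont[OF p(2)]]) auto
  then show "(\<lambda>n. case p of (t, w) \<Rightarrow> X (real (nat \<lfloor>real (Suc n) * max 0 t\<rfloor>) / real (Suc n)) w)
     \<longlonglongrightarrow> (case p of (t, w) \<Rightarrow> X (max 0 t) w)"
    by (simp add: p m_def)
qed

lemma levy_processD:
  assumes "levy_process M X"
  shows "0 \<le> t \<Longrightarrow> X t \<in> borel_measurable M"
    and "w \<in> space M \<Longrightarrow> X 0 w = 0"
    and "0 \<le> \<tau> (0::nat) \<Longrightarrow> mono \<tau> \<Longrightarrow>
      prob_space.indep_vars M (\<lambda>_. borel) (\<lambda>i w. X (\<tau> (Suc i)) w - X (\<tau> i) w) UNIV"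
    and "0 \<le> s \<Longrightarrow> 0 \<le> t \<Longrightarrow> distr M borel (\<lambda>w. X (s + t) w - X s w) = distr M borel (X t)"
proof -
  note * = assms[unfolded levy_process_def]
  show "0 \<le> t \<Longrightarrow> X t \<in> borel_measurable M" using *[THEN conjunct1] by simp
  show "w \<in> space M \<Longrightarrow> X 0 w = 0" using *[THEN conjunct2, THEN conjunct1] by simp
  show "0 \<le> \<tau> (0::nat) \<Longrightarrow> mono \<tau> \<Longrightarrow>
      prob_space.indep_vars M (\<lambda>_. borel) (\<lambda>i w. X (\<tau> (Suc i)) w - X (\<tau> i) w) UNIV"
    using *[THEN conjunct2, THEN conjunct2, THEN conjunct1] by simp
  show "0 \<le> s \<Longrightarrow> 0 \<le> t \<Longrightarrow> distr M borel (\<lambda>w. X (s + t) w - X s w) = distr M borel (X t)"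
    using *[THEN conjunct2, THEN conjunct2, THEN conjunct2, THEN conjunct1] by simp
qed

lemma correlated_wienerD:
  assumes "correlated_wiener M \<rho> B"
  shows "\<rho> 1 1 = 1" "\<rho> 2 2 = 1" "\<rho> 3 3 = 1"
    and "\<rho> 2 1 = \<rho> 1 2" "\<rho> 3 1 = \<rho> 1 3" "\<rho> 3 2 = \<rho> 2 3"
    and "levy_process M (\<lambda>t w. (B 1 t w, B 2 t w, B 3 t w))"
    and "w \<in> space M \<Longrightarrow> j \<in> {1,2,3} \<Longrightarrow> continuous_on {0..} (\<lambda>t. B j t w)"
    and "0 \<le> t \<Longrightarrow> centred_gaussian M (\<lambda>w. \<Sum>j\<in>{1,2,3}. u j * B j t w)
          (t * (\<Sum>j\<in>{1,2,3}. \<Sum>l\<in>{1,2,3}. u j * u l * \<rho> j l))"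
proof -
  note * = assms[unfolded correlated_wiener_def]
  note d = *[THEN conjunct1]
  note s = *[THEN conjunct2, THEN conjunct1]
  show "\<rho> 1 1 = 1" "\<rho> 2 2 = 1" "\<rho> 3 3 = 1" by (rule d[rule_format], blast)+
  show "\<rho> 2 1 = \<rho> 1 2" "\<rho> 3 1 = \<rho> 1 3" "\<rho> 3 2 = \<rho> 2 3" by (rule s[rule_format], blast, blast)+
  show "levy_process M (\<lambda>t w. (B 1 t w, B 2 t w, B 3 t w))"
    using *[THEN conjunct2, THEN conjunct2, THEN conjunct1] .
  show "w \<in> space M \<Longrightarrow> j \<in> {1,2,3} \<Longrightarrow> continuous_on {0..} (\<lambda>t. B j t w)"
    by (rule *[THEN conjunct2, THEN conjunct2, THEN conjunct2, THEN conjunct1, rule_format])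
  show "0 \<le> t \<Longrightarrow> centred_gaussian M (\<lambda>w. \<Sum>j\<in>{1,2,3}. u j * B j t w)
          (t * (\<Sum>j\<in>{1,2,3}. \<Sum>l\<in>{1,2,3}. u j * u l * \<rho> j l))"
    by (rule *[THEN conjunct2, THEN conjunct2, THEN conjunct2, THEN conjunct2, rule_format])
qed

context
  fixes M :: "'a measure" and \<rho> :: "nat \<Rightarrow> nat \<Rightarrow> real" and B :: "nat \<Rightarrow> real \<Rightarrow> 'a \<Rightarrow> real"
  assumes prob: "prob_space M" and wiener: "correlated_wiener M \<rho> B"
begin

interpretation prob_space M by (fact prob)

lemmas wiener_levy = correlated_wienerD(7)[OF wiener]
lemmas wiener_gaussian = correlated_wienerD(9)[OF wiener]
lemmas wiener_vector_measurable = levy_processD(1)[OF wiener_levy]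

lemma wiener_measurable:
  assumes "0 \<le> t"
  shows "B 1 t \<in> borel_measurable M" "B 2 t \<in> borel_measurable M" "B 3 t \<in> borel_measurable M"
proof -
  have fst: "fst \<in> borel_measurable (borel :: (real \<times> real \<times> real) measure)"
    and fsnd: "(\<lambda>x. fst (snd x)) \<in> borel_measurable (borel :: (real \<times> real \<times> real) measure)"
    and ssnd: "(\<lambda>x. snd (snd x)) \<in> borel_measurable (borel :: (real \<times> real \<times> real) measure)"
    by (auto intro!: borel_measurable_continuous_onI continuous_intros)
  note V = wiener_vector_measurable[OF assms]
  show "B 1 t \<in> borel_measurable M" using measurable_compose[OF V fst] by simp
  show "B 2 t \<in> borel_measurable M" using measurable_compose[OF V fsnd] by simp
  show "B 3 t \<in> borel_measurable M" using measurable_compose[OF V ssnd] by simp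
qed

abbreviation (input) variance_form :: "real \<Rightarrow> real \<Rightarrow> real \<Rightarrow> real" where
  "variance_form x y z \<equiv> x\<^sup>2 * \<rho> 1 1 + y\<^sup>2 * \<rho> 2 2 + z\<^sup>2 * \<rho> 3 3 + x * y * (\<rho> 1 2 + \<rho> 2 1)
     + x * z * (\<rho> 1 3 + \<rho> 3 1) + y * z * (\<rho> 2 3 + \<rho> 3 2)"

text \<open>
All linear combinations of the components are Gaussian, so joint exponential moments are one-dimensional.
\<close>

lemma wiener_exp_nn_integral:
  assumes t: "0 \<le> t"
  shows "(\<integral>\<^sup>+w. ennreal (exp (x * B 1 t w + y * B 2 t w + z * B 3 t w)) \<partial>M) = ennreal (exp (t * variance_form x y z / 2))"
proof -
  define u where "u j = (if j = 1 then x else if j = 2 then y else z)" for j :: nat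
  have s: "(\<Sum>j\<in>{1,2,3}. u j * B j t w) = x * B 1 t w + y * B 2 t w + z * B 3 t w" for w
    by (simp add: u_def)
  have q: "(\<Sum>j\<in>{1,2,3}. \<Sum>l\<in>{1,2,3}. u j * u l * \<rho> j l) = variance_form x y z"
    by (simp add: u_def) (simp add: power2_eq_square algebra_simps)
  note g = centred_gaussian_mgf[OF prob wiener_gaussian[OF t, of u], unfolded s q]
  show ?thesis using nn_integral_eq_integral[OF g(1)] g(2) by simp
qed

text \<open>
Independence and stationarity of the increments, used for the vector process on \<open>[0, a]\<close> and \<open>[a, b]\<close>.
\<close>

lemma wiener_increment_exp_nn_integral:
  assumes a: "0 \<le> a" and ab: "a \<le> b"
  shows "(\<integral>\<^sup>+w. ennreal (exp (x * B 1 a w + y * B 2 a w + z * B 3 a w)) *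
       ennreal (exp (x' * (B 1 b w - B 1 a w) + y' * (B 2 b w - B 2 a w) + z' * (B 3 b w - B 3 a w))) \<partial>M)
    = ennreal (exp (a * variance_form x y z / 2)) * ennreal (exp ((b - a) * variance_form x' y' z' / 2))"
proof -
  define V where "V t w = (B 1 t w, B 2 t w, B 3 t w)" for t w
  \<comment> \<open>a partition that stops at \<open>b\<close>: only its first two increments matter\<close>
  define \<tau> where "\<tau> n = (if n = 0 then 0 else if n = 1 then a else b)" for n :: nat
  have V0: "V 0 w = 0" if "w \<in> space M" for w
    using levy_processD(2)[OF wiener_levy that] unfolding V_def .
  have "0 \<le> \<tau> 0 \<and> mono \<tau>" using a ab by (auto simp: \<tau>_def mono_def)
  then have ind: "indep_vars (\<lambda>_. borel) (\<lambda>i w. V (\<tau> (Suc i)) w - V (\<tau> i) w) UNIV"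
    using levy_processD(3)[OF wiener_levy] unfolding V_def by blast
  have L: "distr M borel (\<lambda>w. V (s + t) w - V s w) = distr M borel (V t)" if "0 \<le> s" "0 \<le> t" for s t
    using levy_processD(4)[OF wiener_levy that] unfolding V_def .
  have Vm: "V t \<in> borel_measurable M" if "0 \<le> t" for t
    using wiener_vector_measurable[OF that] unfolding V_def .
  define h where "h x y z p = ennreal (exp (x * fst p + y * fst (snd p) + z * snd (snd p)))" for x y z :: real and p :: "real \<times> real \<times> real"
  have hm[measurable]: "h x y z \<in> borel_measurable borel" for x y z
    unfolding h_def
    by (intro measurable_compose[OF _ measurable_ennreal] borel_measurable_continuous_onI continuous_intros)
  have "indep_vars (\<lambda>_. borel) (\<lambda>i w. V (\<tau> (Suc i)) w - V (\<tau> i) w) {0, 1}"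
    by (rule indep_vars_subset[OF ind]) simp
  then have "indep_vars (\<lambda>_. borel) (\<lambda>i w. (if i = 0 then h x y z else h x' y' z') (V (\<tau> (Suc i)) w - V (\<tau> i) w)) {0, 1}"
    by (rule indep_vars_compose2) auto
  from indep_vars_nn_integral[OF _ this]
  have "(\<integral>\<^sup>+w. h x y z (V a w - V 0 w) * h x' y' z' (V b w - V a w) \<partial>M)
    = (\<integral>\<^sup>+w. h x y z (V a w - V 0 w) \<partial>M) * (\<integral>\<^sup>+w. h x' y' z' (V b w - V a w) \<partial>M)"
    by (simp add: \<tau>_def)
  moreover have "(\<integral>\<^sup>+w. h x y z (V a w - V 0 w) * h x' y' z' (V b w - V a w) \<partial>M)
    = (\<integral>\<^sup>+w. h x y z (V a w) * h x' y' z' (V b w - V a w) \<partial>M)"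
    by (intro nn_integral_cong) (simp add: V0)
  moreover have "(\<integral>\<^sup>+w. h x y z (V a w - V 0 w) \<partial>M) = (\<integral>\<^sup>+w. h x y z (V a w) \<partial>M)"
    by (intro nn_integral_cong) (simp add: V0)
  moreover have "(\<integral>\<^sup>+w. h x' y' z' (V b w - V a w) \<partial>M) = (\<integral>\<^sup>+w. h x' y' z' (V (b - a) w) \<partial>M)"
  proof -
    have "(\<integral>\<^sup>+w. h x' y' z' (V b w - V a w) \<partial>M) = (\<integral>\<^sup>+p. h x' y' z' p \<partial>distr M borel (\<lambda>w. V (a + (b - a)) w - V a w))"
      using a ab by (subst nn_integral_distr) (auto intro!: borel_measurable_diff Vm)
    also have "\<dots> = (\<integral>\<^sup>+w. h x' y' z' (V (b - a) w) \<partial>M)"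
      using a ab by (subst L, simp, simp, subst nn_integral_distr) (auto intro!: Vm)
    finally show ?thesis .
  qed
  moreover have "(\<integral>\<^sup>+w. h x y z (V t w) \<partial>M) = ennreal (exp (t * variance_form x y z / 2))" if "0 \<le> t" for t x y z
    using wiener_exp_nn_integral[OF that] by (simp add: h_def V_def)
  ultimately have "(\<integral>\<^sup>+w. h x y z (V a w) * h x' y' z' (V b w - V a w) \<partial>M)
     = ennreal (exp (a * variance_form x y z / 2)) * ennreal (exp ((b - a) * variance_form x' y' z' / 2))"
    using a ab by simp
  then show ?thesis by (simp add: h_def V_def)
qed

context
  fixes y z :: real
  assumes \<rho>12: "\<rho> 1 2 = 0" and \<rho>13: "\<rho> 1 3 = 0"
begin

abbreviation (input) variance23 :: real where
  "variance23 \<equiv> y\<^sup>2 + z\<^sup>2 + 2 * \<rho> 2 3 * y * z"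

text \<open>
The two times may come in either order. The joint moment factorises in both cases since on the common
interval the first component has no covariance with the other two.
\<close>

lemma wiener_two_times_exp_nn_integral:
  assumes s: "0 \<le> s" and t: "0 \<le> t"
  shows "(\<integral>\<^sup>+w. ennreal (exp (x * B 1 t w + (y * B 2 s w + z * B 3 s w))) \<partial>M)
    = ennreal (exp (t * x\<^sup>2 / 2 + s * variance23 / 2))"
proof -
  have one: "\<rho> 1 1 = 1" "\<rho> 2 2 = 1" "\<rho> 3 3 = 1"
    and sym: "\<rho> 2 1 = \<rho> 1 2" "\<rho> 3 1 = \<rho> 1 3" "\<rho> 3 2 = \<rho> 2 3"
    using correlated_wienerD(1-6)[OF wiener] by -
  note simps = one[simplified] sym[simplified] \<rho>12[simplified] \<rho>13[simplified]
  consider "t \<le> s" | "s \<le> t" by linarith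
  then show ?thesis
  proof cases
    case 1
    have "(\<integral>\<^sup>+w. ennreal (exp (x * B 1 t w + (y * B 2 s w + z * B 3 s w))) \<partial>M)
      = (\<integral>\<^sup>+w. ennreal (exp (x * B 1 t w + y * B 2 t w + z * B 3 t w)) *
       ennreal (exp (0 * (B 1 s w - B 1 t w) + y * (B 2 s w - B 2 t w) + z * (B 3 s w - B 3 t w))) \<partial>M)"
      by (intro nn_integral_cong) (simp add: ennreal_mult''[symmetric] exp_add[symmetric] algebra_simps)
    also have "\<dots> = ennreal (exp (t * x\<^sup>2 / 2 + s * variance23 / 2))"
      unfolding wiener_increment_exp_nn_integral[OF t 1]
      by (simp add: ennreal_mult''[symmetric] exp_add[symmetric] simps) (simp add: field_simps)
    finally show ?thesis .
  next
    case 2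
    have "(\<integral>\<^sup>+w. ennreal (exp (x * B 1 t w + (y * B 2 s w + z * B 3 s w))) \<partial>M)
      = (\<integral>\<^sup>+w. ennreal (exp (x * B 1 s w + y * B 2 s w + z * B 3 s w)) *
       ennreal (exp (x * (B 1 t w - B 1 s w) + 0 * (B 2 t w - B 2 s w) + 0 * (B 3 t w - B 3 s w))) \<partial>M)"
      by (intro nn_integral_cong) (simp add: ennreal_mult''[symmetric] exp_add[symmetric] algebra_simps)
    also have "\<dots> = ennreal (exp (t * x\<^sup>2 / 2 + s * variance23 / 2))"
      unfolding wiener_increment_exp_nn_integral[OF s 2]
      by (simp add: ennreal_mult''[symmetric] exp_add[symmetric] simps) (simp add: field_simps)
    finally show ?thesis .
  qed
qed

text \<open>
Under the measure with density proportional to \<open>exp (y * B 2 s + z * B 3 s)\<close> the first component at time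
\<open>t\<close> has the same exponential moments as under \<open>M\<close>, hence the same law. This replaces an appeal to
independence of jointly Gaussian vectors.
\<close>

lemma wiener_tilted_law:
  assumes s: "0 \<le> s" and t: "0 \<le> t" and A[measurable]: "A \<in> sets borel"
  shows "(\<integral>\<^sup>+w. ennreal (exp (y * B 2 s w + z * B 3 s w)) * indicator A (B 1 t w) \<partial>M)
    = ennreal (exp (s * variance23 / 2)) * emeasure M {w\<in>space M. B 1 t w \<in> A}"
proof -
  note [measurable] = wiener_measurable(1)[OF t] wiener_measurable(2,3)[OF s]
  define c where "c = s * variance23 / 2"
  define W where "W w = y * B 2 s w + z * B 3 s w" for w
  have [measurable]: "W \<in> borel_measurable M" unfolding W_def by measurable
  define Q where "Q = density M (\<lambda>w. ennreal (exp (W w - c)))"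
  have [measurable]: "B 1 t \<in> borel_measurable Q" by (simp add: Q_def)
  have Qexp: "(\<integral>\<^sup>+w. ennreal (exp (x * B 1 t w)) \<partial>Q) = ennreal (exp (t * x\<^sup>2 / 2))" for x
  proof -
    have "(\<integral>\<^sup>+w. ennreal (exp (x * B 1 t w)) \<partial>Q) = (\<integral>\<^sup>+w. ennreal (exp (- c)) * ennreal (exp (x * B 1 t w + (y * B 2 s w + z * B 3 s w))) \<partial>M)"
      unfolding Q_def by (subst nn_integral_density)
        (auto intro!: nn_integral_cong simp: ennreal_mult''[symmetric] exp_add[symmetric] W_def algebra_simps)
    also have "\<dots> = ennreal (exp (- c)) * ennreal (exp (t * x\<^sup>2 / 2 + c))"
      by (subst nn_integral_cmult) (auto simp: wiener_two_times_exp_nn_integral[OF s t] c_def)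
    finally show ?thesis by (simp add: ennreal_mult''[symmetric] exp_add[symmetric])
  qed
  have Mexp: "(\<integral>\<^sup>+w. ennreal (exp (x * B 1 t w)) \<partial>M) = ennreal (exp (t * x\<^sup>2 / 2))" for x
  proof -
    have "\<rho> 1 1 = 1" using correlated_wienerD(1)[OF wiener] .
    then show ?thesis using wiener_exp_nn_integral[OF t, of x 0 0] by simp
  qed
  have "emeasure Q (space Q) = 1"
    using Qexp[of 0] by (simp add: Q_def)
  then interpret Q: prob_space Q by (rule prob_spaceI)
  have integ: "integrable (distr N borel (B 1 t)) (\<lambda>b. exp (x * b)) \<and>
      (LINT b|distr N borel (B 1 t). exp (x * b)) = exp (t * x\<^sup>2 / 2)"
    if [measurable]: "B 1 t \<in> borel_measurable N"
      and N: "(\<integral>\<^sup>+w. ennreal (exp (x * B 1 t w)) \<partial>N) = ennreal (exp (t * x\<^sup>2 / 2))" for N :: "'a measure" and x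
  proof -
    have "has_bochner_integral N (\<lambda>w. exp (x * B 1 t w)) (exp (t * x\<^sup>2 / 2))"
      by (rule has_bochner_integral_nn_integral) (use N in auto)
    then show ?thesis
      by (auto simp: has_bochner_integral_iff integrable_distr_eq integral_distr)
  qed
  have "distr Q borel (B 1 t) = distr M borel (B 1 t)"
  proof (rule exponential_moments_unique)
    show "real_distribution (distr Q borel (B 1 t))" by (rule Q.real_distribution_distr) simp
    show "real_distribution (distr M borel (B 1 t))" by (rule real_distribution_distr) simp
  qed (use integ[of Q] integ[of M] Qexp Mexp in auto)
  then have "emeasure (distr Q borel (B 1 t)) A = emeasure (distr M borel (B 1 t)) A" by simp
  then have eq: "emeasure Q {w\<in>space M. B 1 t w \<in> A} = emeasure M {w\<in>space M. B 1 t w \<in> A}"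
    by (simp add: emeasure_distr vimage_def Int_def Q_def conj_commute)
  have "(\<integral>\<^sup>+w. ennreal (exp (y * B 2 s w + z * B 3 s w)) * indicator A (B 1 t w) \<partial>M)
    = (\<integral>\<^sup>+w. ennreal (exp c) * (ennreal (exp (W w - c)) * indicator {w\<in>space M. B 1 t w \<in> A} w) \<partial>M)"
    by (intro nn_integral_cong) (auto simp: W_def[symmetric] ennreal_mult''[symmetric] exp_add[symmetric] indicator_def)
  also have "\<dots> = ennreal (exp c) * emeasure Q {w\<in>space M. B 1 t w \<in> A}"
    unfolding Q_def by (subst nn_integral_cmult) (auto simp: emeasure_density)
  finally show ?thesis unfolding eq c_def .
qed

text \<open>
The sign is flipped so that the event becomes a lower half-line of a standard normal variable.
\<close>

lemma wiener_first_probability: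
  assumes t: "0 < t" and \<sigma>: "0 < \<sigma>"
  shows "emeasure M {w\<in>space M. k \<le> \<beta> * t + \<sigma> * B 1 t w} = ennreal (std_normal_cdf ((\<beta> * t - k) / (\<sigma> * sqrt t)))"
proof -
  note [measurable] = wiener_measurable(1)[OF less_imp_le[OF t]]
  define u where "u j = (if j = 1 then - 1 / sqrt t else 0)" for j :: nat
  have s: "(\<Sum>j\<in>{1,2,3}. u j * B j t w) = - B 1 t w / sqrt t" for w
    by (simp add: u_def)
  have "\<rho> 1 1 = 1" using correlated_wienerD(1)[OF wiener] .
  then have q: "t * (\<Sum>j\<in>{1,2,3}. \<Sum>l\<in>{1,2,3}. u j * u l * \<rho> j l) = 1"
    using t by (simp add: u_def)
  have d: "distr M borel (\<lambda>w. - B 1 t w / sqrt t) = std_normal_distribution"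
    using wiener_gaussian[OF less_imp_le[OF t], of u, unfolded s q] by (simp add: centred_gaussian_def)
  define x where "x = (\<beta> * t - k) / (\<sigma> * sqrt t)"
  have "{w\<in>space M. k \<le> \<beta> * t + \<sigma> * B 1 t w} = (\<lambda>w. - B 1 t w / sqrt t) -` {..x} \<inter> space M"
    using t \<sigma> by (auto simp: x_def field_simps)
  then have "emeasure M {w\<in>space M. k \<le> \<beta> * t + \<sigma> * B 1 t w} = emeasure (distr M borel (\<lambda>w. - B 1 t w / sqrt t)) {..x}"
    by (subst emeasure_distr) auto
  also have "\<dots> = ennreal (std_normal_cdf x)"
    unfolding d cdf_def by (rule finite_measure.emeasure_eq_measure)
      (use prob_space_normal_density[of 1 0] in \<open>simp add: prob_space_def\<close>)
  finally show ?thesis by (simp add: x_def)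
qed

end

end

section \<open>Gamma subordinators\<close>

lemma gamma_process_levy: "gamma_process M u v g \<Longrightarrow> levy_process M g"
  by (simp add: gamma_process_def)

lemma gamma_process_pos_params: "gamma_process M u v g \<Longrightarrow> 0 < u" "gamma_process M u v g \<Longrightarrow> 0 < v"
  by (simp_all add: gamma_process_def)

lemma gamma_process_nonneg:
  assumes "gamma_process M u v g" "w \<in> space M" "0 \<le> t"
  shows "0 \<le> g t w"
proof -
  have "mono_on {0..} (\<lambda>t. g t w)" using assms by (simp add: gamma_process_def)
  then have "g 0 w \<le> g t w" using assms(3) by (auto simp: mono_on_def)
  then show ?thesis using levy_processD(2)[OF gamma_process_levy[OF assms(1)] assms(2)] by simp
qed

lemma gamma_process_nn_integral:
  assumes g: "gamma_process M u v g" and t: "0 < t" and h[measurable]: "h \<in> borel_measurable borel"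
  shows "(\<integral>\<^sup>+w. h (g t w) \<partial>M) = (\<integral>\<^sup>+x. ennreal (v powr (u * t) / Gamma (u * t)) *
      (ennreal (gamma_kernel (u * t) v x) * h x) \<partial>lborel)"
proof -
  have d: "distributed M lborel (g t)
        (\<lambda>x. ennreal (if 0 < x
           then v powr (u * t) * x powr (u * t - 1) * exp (- v * x) / Gamma (u * t) else 0))"
    using g t by (simp add: gamma_process_def)
  have pos: "0 < u" "0 < v" using gamma_process_pos_params[OF g] by auto
  have "(\<integral>\<^sup>+w. h (g t w) \<partial>M) = (\<integral>\<^sup>+x. ennreal (if 0 < x
           then v powr (u * t) * x powr (u * t - 1) * exp (- v * x) / Gamma (u * t) else 0) * h x \<partial>lborel)"
    by (rule distributed_nn_integral[OF d, symmetric]) simp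
  also have "\<dots> = (\<integral>\<^sup>+x. ennreal (v powr (u * t) / Gamma (u * t)) *
      (ennreal (gamma_kernel (u * t) v x) * h x) \<partial>lborel)"
  proof (rule nn_integral_cong)
    fix x
    have "(if 0 < x then v powr (u * t) * x powr (u * t - 1) * exp (- v * x) / Gamma (u * t) else 0)
      = v powr (u * t) / Gamma (u * t) * (gamma_kernel (u * t) v x)"
      by simp
    moreover have "0 \<le> v powr (u * t) / Gamma (u * t)" using pos t by (simp add: Gamma_real_nonneg)
    ultimately show "ennreal (if 0 < x then v powr (u * t) * x powr (u * t - 1) * exp (- v * x) / Gamma (u * t) else 0) * h x
       = ennreal (v powr (u * t) / Gamma (u * t)) * (ennreal (gamma_kernel (u * t) v x) * h x)"
      by (simp only: ennreal_mult' mult.assoc)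
  qed
  finally show ?thesis .
qed

lemma gamma_process_AE_pos:
  assumes g: "gamma_process M u v g" and t: "0 < t"
  shows "AE w in M. 0 < g t w"
proof -
  note [measurable] = levy_processD(1)[OF gamma_process_levy[OF g] less_imp_le[OF t]]
  have "(\<integral>\<^sup>+w. indicator {..0} (g t w) \<partial>M) = (\<integral>\<^sup>+x. 0 \<partial>(lborel :: real measure))"
    unfolding gamma_process_nn_integral[OF g t borel_measurable_indicator[of "{..0}" borel, OF borel_closed[OF closed_atMost]]]
    by (intro nn_integral_cong) (auto split: split_indicator)
  then have "(\<integral>\<^sup>+w. indicator {..0} (g t w) \<partial>M) = 0" by simp
  then have "AE w in M. indicator {..0} (g t w) = (0::ennreal)"
    by (subst (asm) nn_integral_0_iff_AE) auto
  then show ?thesis by eventually_elim (auto split: split_indicator_asm)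
qed

text \<open>
The exponential is absorbed into the rate of the gamma density.
\<close>

lemma gamma_process_exp_nn_integral:
  assumes g: "gamma_process M u v g" and t: "0 < t"
  shows "c < v \<Longrightarrow> (\<integral>\<^sup>+w. ennreal (exp (c * g t w)) \<partial>M) = ennreal ((v / (v - c)) powr (u * t))"
    and "v \<le> c \<Longrightarrow> (\<integral>\<^sup>+w. ennreal (exp (c * g t w)) \<partial>M) = \<infinity>"
proof -
  have pos: "0 < u" "0 < v" using gamma_process_pos_params[OF g] by auto
  have \<nu>: "0 < u * t" using pos t by simp
  have cpos: "0 < v powr (u * t) / Gamma (u * t)" using \<nu> pos Gamma_real_pos by simp
  have "(\<integral>\<^sup>+w. ennreal (exp (c * g t w)) \<partial>M) = (\<integral>\<^sup>+x. ennreal (v powr (u * t) / Gamma (u * t)) *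
      (ennreal (gamma_kernel (u * t) v x) * ennreal (exp (c * x))) \<partial>lborel)"
    by (rule gamma_process_nn_integral[OF g t]) simp
  also have "\<dots> = (\<integral>\<^sup>+x. ennreal (v powr (u * t) / Gamma (u * t)) * ennreal (gamma_kernel (u * t) (v - c) x) \<partial>lborel)"
  proof (intro nn_integral_cong arg_cong2[where f = "(*)"] refl)
    fix x
    have "exp (- (v - c) * x) = exp (- v * x) * exp (c * x)"
      unfolding exp_add[symmetric] by (simp add: algebra_simps)
    then show "ennreal (gamma_kernel (u * t) v x) * ennreal (exp (c * x))
      = ennreal (gamma_kernel (u * t) (v - c) x)"
      by (simp add: ennreal_mult''[symmetric] mult.assoc)
  qed
  also have "\<dots> = ennreal (v powr (u * t) / Gamma (u * t)) * (\<integral>\<^sup>+x. ennreal (gamma_kernel (u * t) (v - c) x) \<partial>lborel)"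
    by (rule nn_integral_cmult) simp
  finally have *: "(\<integral>\<^sup>+w. ennreal (exp (c * g t w)) \<partial>M) = \<dots>" .
  show "(\<integral>\<^sup>+w. ennreal (exp (c * g t w)) \<partial>M) = ennreal ((v / (v - c)) powr (u * t))" if "c < v"
    unfolding * using gamma_kernel_nn_integral(1)[OF \<nu>, of "v - c"] that cpos pos Gamma_real_pos[OF \<nu>]
    by (simp add: ennreal_mult'[symmetric] powr_divide)
  show "(\<integral>\<^sup>+w. ennreal (exp (c * g t w)) \<partial>M) = \<infinity>" if "v \<le> c"
    unfolding * using gamma_kernel_nn_integral(2)[OF \<nu>, of "v - c"] that cpos pos Gamma_real_pos[OF \<nu>]
    by (simp add: ennreal_mult_eq_top_iff)
qed

text \<open>
The exponential tilt changes the rate of the gamma density from \<open>v\<close> to \<open>v - b\<close>.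
\<close>

lemma gamma_process_vg_mixture:
  assumes g: "gamma_process M u v g" and t: "0 < t" and b: "b < v" and \<sigma>: "\<sigma> > 0"
  shows "(\<integral>\<^sup>+w. ennreal (exp (b * g t w)) * ennreal (std_normal_cdf ((\<beta> * g t w + y) / (\<sigma> * sqrt (g t w)))) \<partial>M)
    = ennreal (v powr (u * t) / Gamma (u * t) * vg_mixture (u * t) (v - b) \<sigma> \<beta> y)"
proof -
  have pos: "0 < u" "0 < v" using gamma_process_pos_params[OF g] by auto
  have \<nu>: "0 < u * t" using pos t by simp
  have "(\<integral>\<^sup>+w. ennreal (exp (b * g t w)) * ennreal (std_normal_cdf ((\<beta> * g t w + y) / (\<sigma> * sqrt (g t w)))) \<partial>M)
    = (\<integral>\<^sup>+x. ennreal (v powr (u * t) / Gamma (u * t)) *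
      (ennreal (gamma_kernel (u * t) v x) *
       (ennreal (exp (b * x)) * ennreal (std_normal_cdf ((\<beta> * x + y) / (\<sigma> * sqrt x))))) \<partial>lborel)"
    by (rule gamma_process_nn_integral[OF g t]) measurable
  also have "\<dots> = (\<integral>\<^sup>+x. ennreal (v powr (u * t) / Gamma (u * t)) *
     (ennreal (gamma_kernel (u * t) (v - b) x) *
       ennreal (std_normal_cdf ((\<beta> * x + y) / (\<sigma> * sqrt x)))) \<partial>lborel)"
  proof (rule nn_integral_cong, rule arg_cong2[where f = "(*)", OF refl])
    fix x
    have "exp (- (v - b) * x) = exp (- v * x) * exp (b * x)"
      unfolding exp_add[symmetric] by (simp add: algebra_simps)
    then show "ennreal (gamma_kernel (u * t) v x) *
       (ennreal (exp (b * x)) * ennreal (std_normal_cdf ((\<beta> * x + y) / (\<sigma> * sqrt x))))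
      = ennreal (gamma_kernel (u * t) (v - b) x) * ennreal (std_normal_cdf ((\<beta> * x + y) / (\<sigma> * sqrt x)))"
      by (simp add: ennreal_mult''[symmetric] mult.assoc[symmetric])
  qed
  also have "\<dots> = ennreal (v powr (u * t) / Gamma (u * t)) *
     (\<integral>\<^sup>+x. ennreal (gamma_kernel (u * t) (v - b) x) *
       ennreal (std_normal_cdf ((\<beta> * x + y) / (\<sigma> * sqrt x))) \<partial>lborel)"
    by (rule nn_integral_cmult) measurable
  also have "(\<integral>\<^sup>+x. ennreal (gamma_kernel (u * t) (v - b) x) *
       ennreal (std_normal_cdf ((\<beta> * x + y) / (\<sigma> * sqrt x))) \<partial>lborel) = ennreal (vg_mixture (u * t) (v - b) \<sigma> \<beta> y)"
    by (rule vg_mixture_nn_integral[OF \<nu> _ \<sigma>]) (use b in simp)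
  also have "ennreal (v powr (u * t) / Gamma (u * t)) * ennreal (vg_mixture (u * t) (v - b) \<sigma> \<beta> y)
    = ennreal (v powr (u * t) / Gamma (u * t) * vg_mixture (u * t) (v - b) \<sigma> \<beta> y)"
    using \<nu> b \<sigma> by (intro ennreal_mult[symmetric] vg_mixture_bounds) (auto simp: Gamma_real_nonneg)
  finally show ?thesis .
qed

text \<open>
The subordinators are independent of the paths, so for a fixed outcome of the subordinators the Wiener
process is evaluated at two deterministic times, where \<open>wiener_tilted_law\<close> applies.
\<close>

lemma time_changed_tilt:
  assumes prob: "prob_space M" and wiener: "correlated_wiener M \<rho> B"
    and \<rho>: "\<rho> 1 2 = 0" "\<rho> 1 3 = 0"
    and R: "space R = space M" "prob_space.indep_set M (sets R) (generated_sets M ({1,2,3} \<times> {0..}) (\<lambda>(j, t). B j t))"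
    and \<tau>m: "\<tau>1 \<in> borel_measurable R" "\<tau>2 \<in> borel_measurable R"
    and \<tau>0: "\<And>w. w \<in> space M \<Longrightarrow> 0 \<le> \<tau>1 w" "\<And>w. w \<in> space M \<Longrightarrow> 0 \<le> \<tau>2 w"
    and D: "D \<in> sets borel"
  shows "(\<integral>\<^sup>+w. ennreal (exp (d * \<tau>2 w + (y * B 2 (\<tau>2 w) w + z * B 3 (\<tau>2 w) w))) * indicator D (\<beta> * \<tau>1 w + \<sigma> * B 1 (\<tau>1 w) w) \<partial>M)
    = (\<integral>\<^sup>+w. ennreal (exp ((d + (y\<^sup>2 + z\<^sup>2 + 2 * \<rho> 2 3 * y * z) / 2) * \<tau>2 w)) * emeasure M {w'\<in>space M. \<beta> * \<tau>1 w + \<sigma> * B 1 (\<tau>1 w) w' \<in> D} \<partial>M)"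
proof -
  interpret prob_space M by (fact prob)
  define A where "A = generated_algebra M ({1,2,3::nat} \<times> {0::real..}) (\<lambda>(j, t). B j t)"
  have A: "space A = space M" "sets A = generated_sets M ({1,2,3} \<times> {0..}) (\<lambda>(j, t). B j t)" by (simp_all add: A_def)
  have BA: "B j t \<in> borel_measurable A" if "j \<in> {1,2,3}" "0 \<le> t" for j t
    using measurable_generated_algebra[of "(j, t)" "{1,2,3} \<times> {0..}" "\<lambda>(j, t). B j t" M] that by (simp add: A_def)
  have path: "(\<lambda>p. B j (max 0 (\<tau> (fst p))) (snd p)) \<in> borel_measurable (R \<Otimes>\<^sub>M A)"
    if j: "j \<in> {1,2,3}" and \<tau>: "\<tau> \<in> borel_measurable R" for j \<tau>
  proof -
    have 1: "(\<lambda>(t, w). B j (max 0 t) w) \<in> borel_measurable (borel \<Otimes>\<^sub>M A)"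
      by (rule continuous_process_measurable[OF BA[OF j]])
        (use correlated_wienerD(8)[OF wiener _ j] A(1) in auto)
    have 2: "(\<lambda>p. (\<tau> (fst p), snd p)) \<in> measurable (R \<Otimes>\<^sub>M A) (borel \<Otimes>\<^sub>M A)"
      by (intro measurable_Pair measurable_compose[OF measurable_fst \<tau>] measurable_snd)
    show ?thesis using measurable_compose[OF 2 1] by simp
  qed
  define f where "f w w' = ennreal (exp (d * \<tau>2 w + (y * B 2 (max 0 (\<tau>2 w)) w' + z * B 3 (max 0 (\<tau>2 w)) w')))
     * indicator D (\<beta> * \<tau>1 w + \<sigma> * B 1 (max 0 (\<tau>1 w)) w')" for w w'
  have f: "case_prod f \<in> borel_measurable (R \<Otimes>\<^sub>M A)"
  proof -
    note [measurable] = path[of 1, OF _ \<tau>m(1), simplified] path[of 2, OF _ \<tau>m(2), simplified] path[of 3, OF _ \<tau>m(2), simplified] \<tau>m D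
    show ?thesis unfolding f_def case_prod_beta' by measurable
  qed
  have "(\<integral>\<^sup>+w. ennreal (exp (d * \<tau>2 w + (y * B 2 (\<tau>2 w) w + z * B 3 (\<tau>2 w) w))) * indicator D (\<beta> * \<tau>1 w + \<sigma> * B 1 (\<tau>1 w) w) \<partial>M)
    = (\<integral>\<^sup>+w. f w w \<partial>M)"
    by (intro nn_integral_cong) (simp add: f_def \<tau>0 max_absorb2)
  also have "\<dots> = (\<integral>\<^sup>+w. \<integral>\<^sup>+w'. f w w' \<partial>M \<partial>M)"
    by (rule indep_set_nn_integral[OF R(1) A(1) _ f]) (simp add: A(2) R(2))
  also have "\<dots> = (\<integral>\<^sup>+w. ennreal (exp ((d + (y\<^sup>2 + z\<^sup>2 + 2 * \<rho> 2 3 * y * z) / 2) * \<tau>2 w)) * emeasure M {w'\<in>space M. \<beta> * \<tau>1 w + \<sigma> * B 1 (\<tau>1 w) w' \<in> D} \<partial>M)"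
  proof (rule nn_integral_cong)
    fix w assume w: "w \<in> space M"
    define s where "s = \<tau>2 w"
    define t where "t = \<tau>1 w"
    have st: "0 \<le> s" "0 \<le> t" using \<tau>0 w by (auto simp: s_def t_def)
    note [measurable] = wiener_measurable(1)[OF prob wiener st(2)] wiener_measurable(2,3)[OF prob wiener st(1)] D
    define C where "C = {b. \<beta> * t + \<sigma> * b \<in> D}"
    have C[measurable]: "C \<in> sets borel"
    proof -
      have "(\<lambda>b. \<beta> * t + \<sigma> * b) -` D \<inter> space borel \<in> sets borel" by (rule measurable_sets[OF _ D]) simp
      then show ?thesis by (simp add: C_def vimage_def)
    qed
    have "(\<integral>\<^sup>+w'. f w w' \<partial>M) = (\<integral>\<^sup>+w'. ennreal (exp (d * s)) * (ennreal (exp (y * B 2 s w' + z * B 3 s w')) * indicator C (B 1 t w')) \<partial>M)"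
      using st by (intro nn_integral_cong)
        (simp add: f_def s_def[symmetric] t_def[symmetric] C_def exp_add ennreal_mult' indicator_def mult.assoc max_absorb2)
    also have "\<dots> = ennreal (exp (d * s)) * (\<integral>\<^sup>+w'. ennreal (exp (y * B 2 s w' + z * B 3 s w')) * indicator C (B 1 t w') \<partial>M)"
      by (rule nn_integral_cmult) simp
    also have "\<dots> = ennreal (exp (d * s)) * (ennreal (exp (s * (y\<^sup>2 + z\<^sup>2 + 2 * \<rho> 2 3 * y * z) / 2)) * emeasure M {w'\<in>space M. B 1 t w' \<in> C})"
      by (simp only: wiener_tilted_law[OF prob wiener \<rho> st C])
    also have "\<dots> = ennreal (exp ((d + (y\<^sup>2 + z\<^sup>2 + 2 * \<rho> 2 3 * y * z) / 2) * s)) * emeasure M {w'\<in>space M. \<beta> * t + \<sigma> * B 1 t w' \<in> D}"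
      by (simp add: mult.assoc[symmetric] ennreal_mult'[symmetric] exp_add[symmetric] C_def distrib_right mult.commute[of s])
    finally show "(\<integral>\<^sup>+w'. f w w' \<partial>M) = ennreal (exp ((d + (y\<^sup>2 + z\<^sup>2 + 2 * \<rho> 2 3 * y * z) / 2) * \<tau>2 w)) * emeasure M {w'\<in>space M. \<beta> * \<tau>1 w + \<sigma> * B 1 (\<tau>1 w) w' \<in> D}"
      by (simp only: s_def t_def)
  qed
  finally show ?thesis .
qed

text \<open>
After the Wiener components have been averaged out, the exponent is \<open>c * \<theta> 2 T\<close>; inserting the decomposition
of \<open>\<theta> 2\<close> separates the independent processes \<open>\<gamma>\<close> and \<open>\<theta> 1\<close>. A general Borel set \<open>D\<close> covers the exercise
event as well as the whole line, which gives the expectation of the payment itself.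
\<close>

lemma variance_gamma_tilt:
  fixes \<theta> :: "nat \<Rightarrow> real \<Rightarrow> 'a \<Rightarrow> real" and \<gamma> :: "real \<Rightarrow> 'a \<Rightarrow> real" and \<beta> \<sigma> :: "nat \<Rightarrow> real"
  assumes prob: "prob_space M" and wiener: "correlated_wiener M \<rho> B"
    and \<rho>: "\<rho> 1 2 = 0" "\<rho> 1 3 = 0"
    and \<theta>: "\<And>j. j \<in> {1,2,3} \<Longrightarrow> gamma_process M (\<alpha> j) (\<alpha> j) (\<theta> j)"
    and \<gamma>: "gamma_process M a a \<gamma>"
    and \<theta>_indep_B: "prob_space.indep_set M
          (generated_sets M ({1,2,3} \<times> {0..}) (\<lambda>(j, t). \<theta> j t))
          (generated_sets M ({1,2,3} \<times> {0..}) (\<lambda>(j, t). B j t))"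
    and \<gamma>_indep_\<theta>: "prob_space.indep_set M (generated_sets M {0..} \<gamma>) (generated_sets M {0..} (\<theta> 1))"
    and T: "0 < T" and eq: "AE w in M. \<theta> 3 T w = \<theta> 2 T w \<and> \<theta> 2 T w = k * \<gamma> T w + k1 * \<theta> 1 T w"
    and D: "D \<in> sets borel"
  defines "c \<equiv> \<beta> 2 + \<beta> 3 + ((\<sigma> 2)\<^sup>2 + (\<sigma> 3)\<^sup>2 + 2 * \<rho> 2 3 * \<sigma> 2 * \<sigma> 3) / 2"
  shows "(\<integral>\<^sup>+w. ennreal (exp (\<beta> 2 * \<theta> 2 T w + \<sigma> 2 * B 2 (\<theta> 2 T w) w + (\<beta> 3 * \<theta> 3 T w + \<sigma> 3 * B 3 (\<theta> 3 T w) w)))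
        * indicator D (\<beta> 1 * \<theta> 1 T w + \<sigma> 1 * B 1 (\<theta> 1 T w) w) \<partial>M)
    = (\<integral>\<^sup>+w. ennreal (exp (k * c * \<gamma> T w)) \<partial>M) *
      (\<integral>\<^sup>+w. ennreal (exp (k1 * c * \<theta> 1 T w)) * emeasure M {w'\<in>space M. \<beta> 1 * \<theta> 1 T w + \<sigma> 1 * B 1 (\<theta> 1 T w) w' \<in> D} \<partial>M)"
proof -
  let ?pr = "\<lambda>w. emeasure M {w'\<in>space M. \<beta> 1 * \<theta> 1 T w + \<sigma> 1 * B 1 (\<theta> 1 T w) w' \<in> D}"
  let ?pay = "\<lambda>w. ennreal (exp (\<beta> 2 * \<theta> 2 T w + \<sigma> 2 * B 2 (\<theta> 2 T w) w + (\<beta> 3 * \<theta> 3 T w + \<sigma> 3 * B 3 (\<theta> 3 T w) w)))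
        * indicator D (\<beta> 1 * \<theta> 1 T w + \<sigma> 1 * B 1 (\<theta> 1 T w) w)"
  interpret prob_space M by (fact prob)
  have T0: "0 \<le> T" using T by simp
  define R where "R = generated_algebra M ({1,2,3::nat} \<times> {0::real..}) (\<lambda>(j, t). \<theta> j t)"
  have R: "space R = space M" by (simp add: R_def)
  have RB: "indep_set (sets R) (generated_sets M ({1,2,3} \<times> {0..}) (\<lambda>(j, t). B j t))"
    unfolding R_def sets_generated_algebra by (fact \<theta>_indep_B)
  have \<theta>R: "\<theta> j T \<in> borel_measurable R" if "j \<in> {1,2,3}" for j
    using measurable_generated_algebra[of "(j, T)" "{1,2,3} \<times> {0..}" "\<lambda>(j, t). \<theta> j t" M] that T0 by (simp add: R_def)
  have \<theta>0: "0 \<le> \<theta> j T w" if "j \<in> {1,2,3}" "w \<in> space M" for j w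
    by (rule gamma_process_nonneg[OF \<theta>[OF that(1)] that(2) T0])
  have "(\<integral>\<^sup>+w. ?pay w \<partial>M)
    = (\<integral>\<^sup>+w. ennreal (exp ((\<beta> 2 + \<beta> 3) * \<theta> 2 T w + (\<sigma> 2 * B 2 (\<theta> 2 T w) w + \<sigma> 3 * B 3 (\<theta> 2 T w) w)))
        * indicator D (\<beta> 1 * \<theta> 1 T w + \<sigma> 1 * B 1 (\<theta> 1 T w) w) \<partial>M)"
  proof (rule nn_integral_cong_AE)
    show "AE w in M. ?pay w
      = ennreal (exp ((\<beta> 2 + \<beta> 3) * \<theta> 2 T w + (\<sigma> 2 * B 2 (\<theta> 2 T w) w + \<sigma> 3 * B 3 (\<theta> 2 T w) w)))
        * indicator D (\<beta> 1 * \<theta> 1 T w + \<sigma> 1 * B 1 (\<theta> 1 T w) w)"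
      using eq
    proof eventually_elim
      case (elim w)
      then have e: "\<theta> 3 T w = \<theta> 2 T w" by simp
      show ?case unfolding e by (simp add: algebra_simps)
    qed
  qed
  also have "\<dots> = (\<integral>\<^sup>+w. ennreal (exp ((\<beta> 2 + \<beta> 3 + ((\<sigma> 2)\<^sup>2 + (\<sigma> 3)\<^sup>2 + 2 * \<rho> 2 3 * \<sigma> 2 * \<sigma> 3) / 2) * \<theta> 2 T w))
       * ?pr w \<partial>M)"
    by (rule time_changed_tilt[OF prob wiener \<rho> R RB \<theta>R \<theta>R \<theta>0 \<theta>0 D]) auto
  also have "\<dots> = (\<integral>\<^sup>+w. ennreal (exp (k * c * \<gamma> T w)) * (ennreal (exp (k1 * c * \<theta> 1 T w))
       * ?pr w) \<partial>M)"
  proof (rule nn_integral_cong_AE)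
    show "AE w in M. ennreal (exp ((\<beta> 2 + \<beta> 3 + ((\<sigma> 2)\<^sup>2 + (\<sigma> 3)\<^sup>2 + 2 * \<rho> 2 3 * \<sigma> 2 * \<sigma> 3) / 2) * \<theta> 2 T w))
       * ?pr w
      = ennreal (exp (k * c * \<gamma> T w)) * (ennreal (exp (k1 * c * \<theta> 1 T w))
       * ?pr w)"
      using eq
    proof eventually_elim
      case (elim w)
      then have e: "\<theta> 2 T w = k * \<gamma> T w + k1 * \<theta> 1 T w" by simp
      have "exp (c * \<theta> 2 T w) = exp (k * c * \<gamma> T w) * exp (k1 * c * \<theta> 1 T w)"
        unfolding e exp_add[symmetric] by (simp add: algebra_simps)
      then show ?case unfolding c_def[symmetric] by (simp add: ennreal_mult' mult.assoc)
    qed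
  qed
  finally have tilted: "(\<integral>\<^sup>+w. ?pay w \<partial>M) = \<dots>" .
  have split: "(\<integral>\<^sup>+w. ennreal (exp (k * c * \<gamma> T w)) * (ennreal (exp (k1 * c * \<theta> 1 T w))
       * ?pr w) \<partial>M) = (\<integral>\<^sup>+w. \<integral>\<^sup>+w''. ennreal (exp (k * c * \<gamma> T w)) * (ennreal (exp (k1 * c * \<theta> 1 T w''))
       * ?pr w'') \<partial>M \<partial>M)"
    and m\<theta>: "(\<lambda>w. ennreal (exp (k1 * c * \<theta> 1 T w)) *
       ?pr w) \<in> borel_measurable M"
  proof -
    define RG where "RG = generated_algebra M {0::real..} \<gamma>"
    define RT where "RT = generated_algebra M {0::real..} (\<theta> 1)"
    have sp: "space RG = space M" "space RT = space M" by (simp_all add: RG_def RT_def)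
    have ind: "indep_set (sets RG) (sets RT)"
      unfolding RG_def RT_def sets_generated_algebra by (fact \<gamma>_indep_\<theta>)
    have \<gamma>m: "\<gamma> T \<in> borel_measurable RG" unfolding RG_def by (rule measurable_generated_algebra) (use T0 in simp)
    have \<theta>m: "\<theta> 1 T \<in> borel_measurable RT" unfolding RT_def by (rule measurable_generated_algebra) (use T0 in simp)
    define \<psi> where "\<psi> t = (\<integral>\<^sup>+w'. indicator D (\<beta> 1 * t + \<sigma> 1 * B 1 (max 0 t) w') \<partial>M)" for t
    have "(\<lambda>p. indicator D (\<beta> 1 * fst p + \<sigma> 1 * B 1 (max 0 (fst p)) (snd p)) :: ennreal) \<in> borel_measurable ((borel :: real measure) \<Otimes>\<^sub>M M)"
    proof -
      have "(\<lambda>(t, w). B 1 (max 0 t) w) \<in> borel_measurable ((borel :: real measure) \<Otimes>\<^sub>M M)"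
        by (rule continuous_process_measurable[OF wiener_measurable(1)[OF prob wiener]])
          (use correlated_wienerD(8)[OF wiener, of _ 1] in auto)
      then have [measurable]: "(\<lambda>p. B 1 (max 0 (fst p)) (snd p)) \<in> borel_measurable ((borel :: real measure) \<Otimes>\<^sub>M M)"
        by (simp add: case_prod_beta')
      note [measurable] = D
      show ?thesis by measurable
    qed
    from borel_measurable_nn_integral_fst[OF this]
    have \<psi>m: "\<psi> \<in> borel_measurable borel" unfolding \<psi>_def by simp
    have \<psi>: "?pr w = \<psi> (\<theta> 1 T w)"
      if "w \<in> space M" for w
    proof -
      have t0: "0 \<le> \<theta> 1 T w" using \<theta>0[of 1] that by simp
      note [measurable] = wiener_measurable(1)[OF prob wiener t0] D
      have "\<psi> (\<theta> 1 T w) = (\<integral>\<^sup>+w'. indicator {w'\<in>space M. \<beta> 1 * \<theta> 1 T w + \<sigma> 1 * B 1 (\<theta> 1 T w) w' \<in> D} w' \<partial>M)"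
        unfolding \<psi>_def using t0 by (intro nn_integral_cong) (auto simp: max_absorb2 indicator_def)
      then show ?thesis by simp
    qed
    define f where "f w w' = ennreal (exp (k * c * \<gamma> T w)) * (ennreal (exp (k1 * c * \<theta> 1 T w')) * \<psi> (\<theta> 1 T w'))" for w w'
    have mRG: "(\<lambda>w. ennreal (exp (k * c * \<gamma> T w))) \<in> borel_measurable RG"
      by (rule measurable_compose[OF \<gamma>m, of "\<lambda>x. ennreal (exp (k * c * x))"]) simp
    have mRT: "(\<lambda>w. ennreal (exp (k1 * c * \<theta> 1 T w)) * \<psi> (\<theta> 1 T w)) \<in> borel_measurable RT"
      by (rule measurable_compose[OF \<theta>m, of "\<lambda>x. ennreal (exp (k1 * c * x)) * \<psi> x"]) (intro borel_measurable_times_ennreal \<psi>m, simp)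
    have f: "case_prod f \<in> borel_measurable (RG \<Otimes>\<^sub>M RT)"
      unfolding f_def case_prod_beta'
      by (rule borel_measurable_times_ennreal[OF measurable_compose[OF measurable_fst mRG] measurable_compose[OF measurable_snd mRT]])
    have "(\<integral>\<^sup>+w. f w w \<partial>M) = (\<integral>\<^sup>+w. \<integral>\<^sup>+w'. f w w' \<partial>M \<partial>M)"
      by (rule indep_set_nn_integral[OF sp ind f])
    then show "(\<integral>\<^sup>+w. ennreal (exp (k * c * \<gamma> T w)) * (ennreal (exp (k1 * c * \<theta> 1 T w))
       * ?pr w) \<partial>M)
     = (\<integral>\<^sup>+w. \<integral>\<^sup>+w''. ennreal (exp (k * c * \<gamma> T w)) * (ennreal (exp (k1 * c * \<theta> 1 T w''))
       * ?pr w'') \<partial>M \<partial>M)"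
      unfolding f_def by (simp add: \<psi> cong: nn_integral_cong)
    have "subalgebra M RT" unfolding subalgebra_def using indep_setD_ev2[OF ind] sp by simp
    then have "(\<lambda>w. ennreal (exp (k1 * c * \<theta> 1 T w)) * \<psi> (\<theta> 1 T w)) \<in> borel_measurable M"
      by (rule measurable_from_subalg[OF _ mRT])
    then show "(\<lambda>w. ennreal (exp (k1 * c * \<theta> 1 T w)) *
       ?pr w) \<in> borel_measurable M"
      by (subst measurable_cong[where g = "\<lambda>w. ennreal (exp (k1 * c * \<theta> 1 T w)) * \<psi> (\<theta> 1 T w)"]) (simp_all add: \<psi>)
  qed
  note tilted
  also note split
  also have "(\<integral>\<^sup>+w. \<integral>\<^sup>+w''. ennreal (exp (k * c * \<gamma> T w)) * (ennreal (exp (k1 * c * \<theta> 1 T w''))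
       * ?pr w'') \<partial>M \<partial>M)
     = (\<integral>\<^sup>+w. ennreal (exp (k * c * \<gamma> T w)) * (\<integral>\<^sup>+w''. ennreal (exp (k1 * c * \<theta> 1 T w''))
       * ?pr w'' \<partial>M) \<partial>M)"
    by (intro nn_integral_cong nn_integral_cmult m\<theta>)
  also have "\<dots> = (\<integral>\<^sup>+w. ennreal (exp (k * c * \<gamma> T w)) \<partial>M) *
      (\<integral>\<^sup>+w. ennreal (exp (k1 * c * \<theta> 1 T w)) * ?pr w \<partial>M)"
  proof (rule nn_integral_multc)
    show "(\<lambda>w. ennreal (exp (k * c * \<gamma> T w))) \<in> borel_measurable M"
      using levy_processD(1)[OF gamma_process_levy[OF \<gamma>] T0] by measurable
  qed
  finally show ?thesis .
qed

section \<open>Compound Poisson averages and their truncation\<close>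

text \<open>
In the tail every value of a decreasing sequence is at most the last value of the truncated sum, and the
weights of the tail add up to the missing mass.
\<close>

lemma weighted_average_truncation:
  fixes p f :: "nat \<Rightarrow> real"
  assumes p: "\<And>n. 0 \<le> p n" "p sums 1" and f: "\<And>n. 0 \<le> f n" "\<And>m n. m \<le> n \<Longrightarrow> f n \<le> f m"
  shows "summable (\<lambda>n. p n * f n)"
    and "(\<Sum>n=0..N. p n * f n) \<le> (\<Sum>n. p n * f n)"
    and "(\<Sum>n. p n * f n) \<le> (\<Sum>n=0..N. p n * f n) + f N * (1 - (\<Sum>n=0..N. p n))"
proof -
  have "summable (\<lambda>n. p n * f 0)" by (intro summable_mult2 sums_summable[OF p(2)])
  then show sm: "summable (\<lambda>n. p n * f n)"
    by (rule summable_comparison_test[rotated]) (use p f in \<open>auto intro!: mult_left_mono\<close>)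
  show "(\<Sum>n=0..N. p n * f n) \<le> (\<Sum>n. p n * f n)"
    using sm p f by (intro sum_le_suminf) auto
  have tail: "(\<Sum>n. p (n + Suc N)) = 1 - (\<Sum>n=0..N. p n)"
    using suminf_minus_initial_segment[OF sums_summable[OF p(2)], of "Suc N"] p(2)
    by (simp add: sums_iff atLeast0AtMost lessThan_Suc_atMost)
  have "(\<Sum>n. p n * f n) = (\<Sum>n. p (n + Suc N) * f (n + Suc N)) + (\<Sum>n=0..N. p n * f n)"
    using suminf_split_initial_segment[OF sm, of "Suc N"] by (simp add: atLeast0AtMost lessThan_Suc_atMost)
  also have "(\<Sum>n. p (n + Suc N) * f (n + Suc N)) \<le> (\<Sum>n. p (n + Suc N) * f N)"
    using sums_summable[OF p(2)] by (intro suminf_le mult_left_mono p f summable_mult2 summable_ignore_initial_segment sm) auto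
  also have "\<dots> = (\<Sum>n. p (n + Suc N)) * f N"
    by (rule suminf_mult2[symmetric]) (intro summable_ignore_initial_segment sums_summable[OF p(2)])
  finally show "(\<Sum>n. p n * f n) \<le> (\<Sum>n=0..N. p n * f n) + f N * (1 - (\<Sum>n=0..N. p n))"
    unfolding tail by (simp add: mult.commute)
qed

text \<open>
Expansion of \<open>(T1 + r1) * (T2 + r2) * (T3 + r3)\<close>.
\<close>

lemma three_factor_truncation:
  fixes T1 T2 T3 P1 P2 P3 r1 r2 r3 C :: real
  assumes "0 \<le> C" "0 \<le> T1" "0 \<le> T2" "0 \<le> T3"
    and "T1 \<le> P1" "T2 \<le> P2" "T3 \<le> P3" "P1 \<le> T1 + r1" "P2 \<le> T2 + r2" "P3 \<le> T3 + r3"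
  shows "C * (T1 * T2 * T3) \<le> C * (P1 * P2 * P3)"
    and "C * (P1 * P2 * P3) \<le> C * (T1 * T2 * T3) + C * r1 * r2 * r3 + C * T1 * r2 * r3 + C * T2 * r1 * r3 + C * T3 * r1 * r2
       + C * T1 * T2 * r3 + C * T1 * T3 * r2 + C * T2 * T3 * r1"
proof -
  show "C * (T1 * T2 * T3) \<le> C * (P1 * P2 * P3)"
    using assms by (intro mult_left_mono mult_mono) auto
  have "C * (P1 * P2 * P3) \<le> C * ((T1 + r1) * (T2 + r2) * (T3 + r3))"
    using assms by (intro mult_left_mono mult_mono) auto
  also have "\<dots> = C * (T1 * T2 * T3) + C * r1 * r2 * r3 + C * T1 * r2 * r3 + C * T2 * r1 * r3 + C * T3 * r1 * r2
       + C * T1 * T2 * r3 + C * T1 * T3 * r2 + C * T2 * T3 * r1"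
    by (simp add: algebra_simps)
  finally show "C * (P1 * P2 * P3) \<le> \<dots>" .
qed

lemma poisson_weights:
  fixes c t :: real
  assumes "0 \<le> c" "0 \<le> t"
  shows "0 \<le> c ^ n * t ^ n * exp (- c * t) / fact n"
    and "(\<lambda>n. c ^ n * t ^ n * exp (- c * t) / fact n) sums 1"
proof -
  show "0 \<le> c ^ n * t ^ n * exp (- c * t) / fact n" using assms by simp
  have "(\<lambda>n. exp (- c * t) * ((c * t) ^ n /\<^sub>R fact n)) sums (exp (- c * t) * exp (c * t))"
    by (intro sums_mult exp_converges)
  moreover have "exp (- c * t) * ((c * t) ^ n /\<^sub>R fact n) = c ^ n * t ^ n * exp (- c * t) / fact n" for n
    by (simp add: power_mult_distrib divide_inverse mult_ac)
  moreover have "exp (- c * t) * exp (c * t) = 1" by (simp add: exp_add[symmetric])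
  ultimately show "(\<lambda>n. c ^ n * t ^ n * exp (- c * t) / fact n) sums 1" by simp
qed

text \<open>
Conditioning on the number of jumps: on the event that it equals \<open>n\<close> the random sum has a fixed number of
terms, which are independent of that event.
\<close>

lemma compound_poisson_nn_integral:
  fixes \<xi> :: "nat \<Rightarrow> 'a \<Rightarrow> real" and N :: "real \<Rightarrow> 'a \<Rightarrow> nat"
  assumes prob: "prob_space M" and N: "poisson_process M c N"
    and indep: "prob_space.indep_set M (generated_sets M {0..} (\<lambda>t w. real (N t w))) (generated_sets M {1..} \<xi>)"
    and \<xi>0: "\<And>w. w \<in> space M \<Longrightarrow> \<xi> 0 w = 0"
    and t: "0 \<le> t" and h[measurable]: "h \<in> borel_measurable borel"
  shows "(\<integral>\<^sup>+w. h (\<Sum>l=0..N t w. \<xi> l w) \<partial>M) =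
    (\<Sum>n. ennreal (c ^ n * t ^ n * exp (- c * t) / fact n) * (\<integral>\<^sup>+w. h (\<Sum>l=0..n. \<xi> l w) \<partial>M))"
proof -
  interpret prob_space M by (fact prob)
  define RN where "RN = generated_algebra M {0::real..} (\<lambda>t w. real (N t w))"
  define RX where "RX = generated_algebra M {1::nat..} \<xi>"
  have sp: "space RN = space M" "space RX = space M" by (simp_all add: RN_def RX_def)
  have ind: "indep_set (sets RN) (sets RX)" using indep by (simp add: RN_def RX_def)
  have sub: "sets RN \<subseteq> sets M" "sets RX \<subseteq> sets M" using indep_setD_ev1[OF ind] indep_setD_ev2[OF ind] .
  have NR: "(\<lambda>w. real (N t w)) \<in> borel_measurable RN"
    unfolding RN_def by (rule measurable_generated_algebra) (use t in simp)
  have \<xi>R: "\<xi> l \<in> borel_measurable RX" if "l \<ge> 1" for l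
    unfolding RX_def by (rule measurable_generated_algebra) (use that in simp)
  have SR: "(\<lambda>w. \<Sum>l=0..n. \<xi> l w) \<in> borel_measurable RX" for n
  proof -
    have "(\<lambda>w. \<Sum>l=1..n. \<xi> l w) \<in> borel_measurable RX" by (intro borel_measurable_sum \<xi>R) auto
    moreover have "(\<Sum>l=0..n. \<xi> l w) = (\<Sum>l=1..n. \<xi> l w)" if "w \<in> space RX" for w
      using \<xi>0[of w] that sp by (simp add: sum.atLeast_Suc_atMost One_nat_def)
    ultimately show ?thesis by (subst measurable_cong) auto
  qed
  have NS: "{w\<in>space M. N t w = n} \<in> sets RN" for n
  proof -
    have "(\<lambda>w. real (N t w)) -` {real n} \<inter> space RN \<in> sets RN" by (rule measurable_sets[OF NR]) simp
    moreover have "(\<lambda>w. real (N t w)) -` {real n} \<inter> space RN = {w\<in>space M. N t w = n}" using sp by auto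
    ultimately show ?thesis by simp
  qed
  have RM: "f \<in> borel_measurable M" if "f \<in> borel_measurable RX" for f :: "'a \<Rightarrow> ennreal"
    using that sub sp by (auto simp: measurable_def)
  have hS: "(\<lambda>w. h (\<Sum>l=0..n. \<xi> l w)) \<in> borel_measurable RX" for n
    by (rule measurable_compose[OF SR h])
  have pn: "emeasure M {w\<in>space M. N t w = n} = ennreal (c ^ n * t ^ n * exp (- c * t) / fact n)" for n
  proof -
    have "measure M {w\<in>space M. N t w = n} = (c * t) ^ n / fact n * exp (- c * t)"
      using N t by (simp add: poisson_process_def)
    then show ?thesis by (simp add: emeasure_eq_measure power_mult_distrib)
  qed
  have "(\<integral>\<^sup>+w. h (\<Sum>l=0..N t w. \<xi> l w) \<partial>M) = (\<integral>\<^sup>+w. (\<Sum>n. indicator {w\<in>space M. N t w = n} w * h (\<Sum>l=0..n. \<xi> l w)) \<partial>M)"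
  proof (rule nn_integral_cong)
    fix w assume w: "w \<in> space M"
    have "(\<lambda>n. indicator {w\<in>space M. N t w = n} w * h (\<Sum>l=0..n. \<xi> l w)) =
      (\<lambda>n. if n = N t w then h (\<Sum>l=0..n. \<xi> l w) else 0)"
      using w by (auto simp: fun_eq_iff indicator_def)
    moreover have "(\<lambda>n. if n = N t w then h (\<Sum>l=0..n. \<xi> l w) else 0) sums h (\<Sum>l=0..N t w. \<xi> l w)"
      by (rule sums_single)
    ultimately show "h (\<Sum>l=0..N t w. \<xi> l w) = (\<Sum>n. indicator {w\<in>space M. N t w = n} w * h (\<Sum>l=0..n. \<xi> l w))"
      by (simp add: sums_iff)
  qed
  also have "\<dots> = (\<Sum>n. \<integral>\<^sup>+w. indicator {w\<in>space M. N t w = n} w * h (\<Sum>l=0..n. \<xi> l w) \<partial>M)"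
  proof (rule nn_integral_suminf)
    fix n
    have "{w\<in>space M. N t w = n} \<in> sets M" using NS sub by blast
    then show "(\<lambda>w. indicator {w\<in>space M. N t w = n} w * h (\<Sum>l=0..n. \<xi> l w)) \<in> borel_measurable M"
      by (intro borel_measurable_times_ennreal borel_measurable_indicator RM[OF hS])
  qed
  also have "\<dots> = (\<Sum>n. ennreal (c ^ n * t ^ n * exp (- c * t) / fact n) * (\<integral>\<^sup>+w. h (\<Sum>l=0..n. \<xi> l w) \<partial>M))"
  proof (intro suminf_cong)
    fix n
    define g where "g w w' = indicator {w\<in>space M. N t w = n} w * h (\<Sum>l=0..n. \<xi> l w')" for w w'
    have g: "case_prod g \<in> borel_measurable (RN \<Otimes>\<^sub>M RX)"
      unfolding g_def case_prod_beta'
      by (intro borel_measurable_times_ennreal measurable_compose[OF measurable_fst borel_measurable_indicator[OF NS]]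
          measurable_compose[OF measurable_snd hS])
    have "(\<integral>\<^sup>+w. g w w \<partial>M) = (\<integral>\<^sup>+w. \<integral>\<^sup>+w'. g w w' \<partial>M \<partial>M)"
      by (rule indep_set_nn_integral[OF sp ind g])
    also have "\<dots> = (\<integral>\<^sup>+w. indicator {w\<in>space M. N t w = n} w * (\<integral>\<^sup>+w'. h (\<Sum>l=0..n. \<xi> l w') \<partial>M) \<partial>M)"
      unfolding g_def by (intro nn_integral_cong nn_integral_cmult RM hS)
    also have "\<dots> = emeasure M {w\<in>space M. N t w = n} * (\<integral>\<^sup>+w'. h (\<Sum>l=0..n. \<xi> l w') \<partial>M)"
      using NS[of n] sub by (subst nn_integral_multc) (auto intro!: borel_measurable_indicator)
    finally show "(\<integral>\<^sup>+w. indicator {w\<in>space M. N t w = n} w * h (\<Sum>l=0..n. \<xi> l w) \<partial>M)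
      = ennreal (c ^ n * t ^ n * exp (- c * t) / fact n) * (\<integral>\<^sup>+w. h (\<Sum>l=0..n. \<xi> l w) \<partial>M)"
      unfolding g_def pn .
  qed
  finally show ?thesis .
qed

text \<open>
Bounds and monotonicity of \<open>h\<close> are required on the nonnegative half-line only, since the jumps are
nonnegative; this admits \<open>h z = exp (- z)\<close>.
\<close>

lemma compound_poisson_expectation:
  fixes \<xi> :: "nat \<Rightarrow> 'a \<Rightarrow> real" and N :: "real \<Rightarrow> 'a \<Rightarrow> nat" and h :: "real \<Rightarrow> real"
  assumes prob: "prob_space M" and N: "poisson_process M c N"
    and indep: "prob_space.indep_set M (generated_sets M {0..} (\<lambda>t w. real (N t w))) (generated_sets M {1..} \<xi>)"
    and \<xi>0: "\<And>w. w \<in> space M \<Longrightarrow> \<xi> 0 w = 0"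
    and \<xi>_nonneg: "\<And>l w. w \<in> space M \<Longrightarrow> 0 \<le> \<xi> l w"
    and t: "0 \<le> t" and h[measurable]: "h \<in> borel_measurable borel"
    and h_bounds: "\<And>x. 0 \<le> x \<Longrightarrow> 0 \<le> h x \<and> h x \<le> C"
    and h_antimono: "\<And>x y. 0 \<le> x \<Longrightarrow> x \<le> y \<Longrightarrow> h y \<le> h x"
  defines "\<phi> \<equiv> (\<lambda>n. prob_space.expectation M (\<lambda>w. h (\<Sum>l=0..n. \<xi> l w)))"
  shows "(\<lambda>w. \<Sum>l=0..n. \<xi> l w) \<in> borel_measurable M"
    and "0 \<le> \<phi> n" and "m \<le> n \<Longrightarrow> \<phi> n \<le> \<phi> m"
    and "(\<integral>\<^sup>+w. ennreal (h (\<Sum>l=0..N t w. \<xi> l w)) \<partial>M) = ennreal (\<Sum>n. c ^ n * t ^ n * exp (- c * t) / fact n * \<phi> n)"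
proof -
  interpret prob_space M by (fact prob)
  have c: "0 \<le> c" using N by (simp add: poisson_process_def)
  define S where "S n w = (\<Sum>l=0..n. \<xi> l w)" for n w
  have \<xi>M: "\<xi> l \<in> borel_measurable M" if "l \<ge> 1" for l
  proof (rule measurable_from_subalg[OF _ measurable_generated_algebra[of l "{1..}"]])
    show "subalgebra M (generated_algebra M {1..} \<xi>)"
      using indep_setD_ev2[OF indep] by (simp add: subalgebra_def)
  qed (use that in simp)
  have SM: "S n \<in> borel_measurable M" for n
  proof -
    have "(\<lambda>w. \<Sum>l=1..n. \<xi> l w) \<in> borel_measurable M" by (intro borel_measurable_sum \<xi>M) auto
    moreover have "S n w = (\<Sum>l=1..n. \<xi> l w)" if "w \<in> space M" for w
      using \<xi>0[OF that] by (simp add: S_def sum.atLeast_Suc_atMost One_nat_def)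
    ultimately show ?thesis by (subst measurable_cong) auto
  qed
  then show "(\<lambda>w. \<Sum>l=0..n. \<xi> l w) \<in> borel_measurable M" for n by (simp add: S_def[abs_def])
  have S0: "0 \<le> S n w" if "w \<in> space M" for n w
    unfolding S_def by (intro sum_nonneg \<xi>_nonneg that)
  have Smono: "S m w \<le> S n w" if "w \<in> space M" "m \<le> n" for m n w
    unfolding S_def by (rule sum_mono2) (use that \<xi>_nonneg in auto)
  have int: "integrable M (\<lambda>w. h (S n w))" for n
  proof (rule integrable_const_bound)
    show "AE w in M. norm (h (S n w)) \<le> C"
    proof (rule AE_I2)
      fix w assume "w \<in> space M"
      from h_bounds[OF S0[OF this, of n]] show "norm (h (S n w)) \<le> C" by simp
    qed
  qed (rule measurable_compose[OF SM h])
  have \<phi>: "\<phi> n = expectation (\<lambda>w. h (S n w))" for n by (simp add: \<phi>_def S_def)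
  have h0: "0 \<le> h (S n w)" if "w \<in> space M" for n w using h_bounds[OF S0[OF that]] by simp
  show \<phi>0: "0 \<le> \<phi> n" for n unfolding \<phi> by (intro integral_nonneg_AE AE_I2 h0)
  show \<phi>mono: "\<phi> n \<le> \<phi> m" if "m \<le> n" for m n
    unfolding \<phi> by (intro integral_mono int h_antimono S0 Smono that)
  have nn: "(\<integral>\<^sup>+w. ennreal (h (S n w)) \<partial>M) = ennreal (\<phi> n)" for n
    unfolding \<phi> by (intro nn_integral_eq_integral int AE_I2 h0)
  have "(\<integral>\<^sup>+w. ennreal (h (\<Sum>l=0..N t w. \<xi> l w)) \<partial>M) =
    (\<Sum>n. ennreal (c ^ n * t ^ n * exp (- c * t) / fact n) * (\<integral>\<^sup>+w. ennreal (h (S n w)) \<partial>M))"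
    unfolding S_def by (rule compound_poisson_nn_integral[OF prob N indep \<xi>0 t]) simp_all
  also have "\<dots> = (\<Sum>n. ennreal (c ^ n * t ^ n * exp (- c * t) / fact n * \<phi> n))"
    unfolding nn by (intro suminf_cong ennreal_mult[symmetric] poisson_weights(1) c t \<phi>0)
  also have "\<dots> = ennreal (\<Sum>n. c ^ n * t ^ n * exp (- c * t) / fact n * \<phi> n)"
    by (intro suminf_ennreal2 mult_nonneg_nonneg poisson_weights(1) c t \<phi>0
        weighted_average_truncation(1)[OF poisson_weights[OF c t]] \<phi>mono)
  finally show "(\<integral>\<^sup>+w. ennreal (h (\<Sum>l=0..N t w. \<xi> l w)) \<partial>M) = ennreal (\<Sum>n. c ^ n * t ^ n * exp (- c * t) / fact n * \<phi> n)" .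
qed

section \<open>The price of the digital option\<close>

theorem theorem2:
  fixes M :: "'a measure" and F :: "real \<Rightarrow> 'a measure"
    and T K r rd a b q \<Lambda> price :: real
    and \<mu> \<beta> \<sigma> \<alpha> \<alpha>t \<kappa> \<kappa>1 \<kappa>t lam :: "nat \<Rightarrow> real"
    and \<rho> :: "nat \<Rightarrow> nat \<Rightarrow> real"
    and B \<theta> \<gamma>t Z S :: "nat \<Rightarrow> real \<Rightarrow> 'a \<Rightarrow> real"
    and \<gamma> :: "real \<Rightarrow> 'a \<Rightarrow> real"
    and N :: "nat \<Rightarrow> real \<Rightarrow> 'a \<Rightarrow> nat"
    and \<xi> :: "nat \<Rightarrow> nat \<Rightarrow> 'a \<Rightarrow> real"
    and s \<Xi> :: "real \<Rightarrow> real"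
    and A :: "nat \<Rightarrow> real \<Rightarrow> real"
    and DC :: "nat \<Rightarrow> nat \<Rightarrow> nat \<Rightarrow> real"
    and p tail :: "nat \<Rightarrow> nat \<Rightarrow> real"
    and trunc :: "nat \<Rightarrow> nat \<Rightarrow> nat \<Rightarrow> real"
  assumes prob: "prob_space M"
    and T: "0 < T" and K: "0 < K" and r: "0 \<le> r" and rd: "0 \<le> rd"
    and \<sigma>: "\<And>j. j \<in> {1,2,3} \<Longrightarrow> 0 \<le> \<sigma> j" and \<sigma>1: "0 < \<sigma> 1"
    \<comment> \<open>Wiener processes and subordinators\<close>
    and wiener: "correlated_wiener M \<rho> B"
    and \<theta>_gamma: "\<And>j. j \<in> {1,2,3} \<Longrightarrow> gamma_process M (\<alpha> j) (\<alpha> j) (\<theta> j)"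
    and \<theta>_indep_B: "prob_space.indep_set M
          (generated_sets M ({1,2,3} \<times> {0..}) (\<lambda>(j, t). \<theta> j t))
          (generated_sets M ({1,2,3} \<times> {0..}) (\<lambda>(j, t). B j t))"
    and \<gamma>_gamma: "gamma_process M a a \<gamma>"
    and \<gamma>t_gamma: "\<And>j. j \<in> {2,3} \<Longrightarrow> gamma_process M (\<alpha>t j) (\<alpha>t j) (\<gamma>t j)"
    and \<gamma>_indep: "prob_space.indep_sets M
          (\<lambda>i. generated_sets M {0..}
             (if i = 0 then \<gamma> else if i = 1 then \<theta> 1 else \<gamma>t i)) {0, 1, 2, 3::nat}"
    and \<kappa>: "\<And>j. j \<in> {2,3} \<Longrightarrow>
          0 \<le> \<kappa> j \<and> 0 \<le> \<kappa>1 j \<and> 0 \<le> \<kappa>t j \<and> \<kappa> j + \<kappa>1 j + \<kappa>t j = 1"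
    and \<theta>_decomp: "\<And>j t. j \<in> {2,3} \<Longrightarrow> 0 \<le> t \<Longrightarrow>
          AE \<omega> in M. \<theta> j t \<omega> = \<kappa> j * \<gamma> t \<omega> + \<kappa>1 j * \<theta> 1 t \<omega> + \<kappa>t j * \<gamma>t j t \<omega>"
    \<comment> \<open>jumps\<close>
    and poisson: "\<And>j. j \<in> {1,2,3} \<Longrightarrow> poisson_process M (lam j) (N j)"
    and \<xi>_0: "\<And>j \<omega>. j \<in> {1,2,3} \<Longrightarrow> \<omega> \<in> space M \<Longrightarrow> \<xi> j 0 \<omega> = 0"
    and \<xi>_nonneg: "\<And>j l \<omega>. j \<in> {1,2,3} \<Longrightarrow> \<omega> \<in> space M \<Longrightarrow> 0 \<le> \<xi> j l \<omega>"
    and \<xi>_indep: "prob_space.indep_vars M (\<lambda>_. borel) (\<lambda>(j, l). \<xi> j l) ({1,2,3} \<times> {1..})"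
    and \<xi>_ident: "\<And>j l. j \<in> {1,2,3} \<Longrightarrow> 1 \<le> l \<Longrightarrow>
          distr M borel (\<xi> j l) = distr M borel (\<xi> j 1)"
    and N_indep_\<xi>: "\<And>j. j \<in> {1,2,3} \<Longrightarrow> prob_space.indep_set M
          (generated_sets M {0..} (\<lambda>t \<omega>. real (N j t \<omega>))) (generated_sets M {1..} (\<xi> j))"
    and Z_def: "Z = (\<lambda>j t \<omega>. \<Sum>l=0..N j t \<omega>. \<xi> j l \<omega>)"
    and Z_indep: "prob_space.indep_sets M
          (\<lambda>i. if i = 0
               then generated_sets M ({1,2,3} \<times> {0..}) (\<lambda>(j, t) \<omega>. (\<theta> j t \<omega>, B j (\<theta> j t \<omega>) \<omega>))
               else generated_sets M {0..} (Z i)) {0, 1, 2, 3::nat}"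
    \<comment> \<open>assets and price\<close>
    and S_def: "S = (\<lambda>j t \<omega>.
          exp (\<mu> j * t + \<beta> j * \<theta> j t \<omega> + \<sigma> j * B j (\<theta> j t \<omega>) \<omega> - Z j t \<omega>))"
    and S_integrable: "integrable M (\<lambda>\<omega>. S 3 T \<omega> * S 2 T \<omega>)"
    and filtration: "filtration (space M) F" "\<And>t. subalgebra M (F t)"
    and martingales:
          "martingale_upto M F T (\<lambda>t \<omega>. S 3 t \<omega> * exp (rd * t) / exp (r * t))"
          "martingale_upto M F T (\<lambda>t \<omega>. S 3 t \<omega> * S 1 t \<omega> / exp (r * t))"
          "martingale_upto M F T (\<lambda>t \<omega>. S 3 t \<omega> * S 2 t \<omega> / exp (r * t))"
    and price_def: "price = exp (- r * T) *
          prob_space.expectation M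
            (\<lambda>\<omega>. S 3 T \<omega> * S 2 T \<omega> * indicator {\<omega>. K \<le> S 1 T \<omega>} \<omega>)"
    \<comment> \<open>special assumptions\<close>
    and \<rho>12: "\<rho> 1 2 = 0" and \<rho>13: "\<rho> 1 3 = 0"
    and \<theta>_eq: "\<And>t. 0 \<le> t \<Longrightarrow>
          AE \<omega> in M. \<theta> 3 t \<omega> = \<theta> 2 t \<omega> \<and> \<theta> 2 t \<omega> = \<kappa> 2 * \<gamma> t \<omega> + \<kappa>1 2 * \<theta> 1 t \<omega>"
    \<comment> \<open>abbreviations\<close>
    and b_def: "b = \<kappa>1 2 * ((\<Sum>j=2..3. \<beta> j + (\<sigma> j)\<^sup>2 / 2) + \<rho> 2 3 * \<sigma> 2 * \<sigma> 3)"
    and \<Lambda>_def: "\<Lambda> = Gamma (\<alpha> 1 * T + 1/2) *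
          (Beta (1/2) (\<alpha> 1 * T) / sqrt 2
           + \<beta> 1 / (\<sigma> 1 * sqrt (\<alpha> 1 - b)) *
             gauss_hypergeom (\<alpha> 1 * T + 1/2) (1/2) (3/2)
               (- ((\<beta> 1)\<^sup>2 / (2 * (\<alpha> 1 - b) * (\<sigma> 1)\<^sup>2))))"
    and q_def: "q = \<beta> 1 / sqrt ((\<beta> 1)\<^sup>2 + 2 * (\<alpha> 1 - b) * (\<sigma> 1)\<^sup>2)"
    and s_def: "s = (\<lambda>x. (\<mu> 1 * T - ln K - x)
          * sqrt ((\<beta> 1)\<^sup>2 + 2 * (\<alpha> 1 - b) * (\<sigma> 1)\<^sup>2) / (\<sigma> 1)\<^sup>2)"
    and A_def: "A = (\<lambda>j x. appell_degenerate (\<alpha> 1 * T + real j) (1 - \<alpha> 1 * T)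
          (\<alpha> 1 * T + 1 + real j) ((1 + q) / 2) (- s x * (1 + q)))"
    and \<Xi>_def: "\<Xi> = (\<lambda>x. \<bar>s x\<bar> powr (\<alpha> 1 * T - 1/2) * exp (s x) * (1 + q) powr (\<alpha> 1 * T) *
          (Beta (\<alpha> 1 * T) 1 *
             (\<bar>s x\<bar> * macdonald (\<alpha> 1 * T + 1/2) \<bar>s x\<bar>
              + s x * macdonald (\<alpha> 1 * T - 1/2) \<bar>s x\<bar>) * A 0 x
           - (1 + q) * s x * Beta (\<alpha> 1 * T + 1) 1 * macdonald (\<alpha> 1 * T - 1/2) \<bar>s x\<bar> * A 1 x))"
    and DC_def: "DC = (\<lambda>n1 n2 n3.
          exp ((\<mu> 2 + \<mu> 3 - r) * T) * \<alpha> 1 powr (\<alpha> 1 * T)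
            / ((\<alpha> 1 - b) powr (\<alpha> 1 * T) * Gamma (\<alpha> 1 * T) * sqrt (2 * pi))
          * prob_space.expectation M (\<lambda>\<omega>. exp (- (\<Sum>l=0..n2. \<xi> 2 l \<omega>)))
          * prob_space.expectation M (\<lambda>\<omega>. exp (- (\<Sum>l=0..n3. \<xi> 3 l \<omega>)))
          * (a / (a - \<kappa> 2 * ((\<Sum>j=2..3. \<beta> j + (\<sigma> j)\<^sup>2 / 2) + \<rho> 2 3 * \<sigma> 2 * \<sigma> 3)))
              powr (a * T)
          * (\<Lambda> * measure M {\<omega> \<in> space M. (\<Sum>l=0..n1. \<xi> 1 l \<omega>) = \<mu> 1 * T - ln K}
             + prob_space.expectation M (\<lambda>\<omega>. \<Xi> (\<Sum>l=0..n1. \<xi> 1 l \<omega>)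
                 * indicator {\<omega>. (\<Sum>l=0..n1. \<xi> 1 l \<omega>) \<noteq> \<mu> 1 * T - ln K} \<omega>)))"
    and p_def: "p = (\<lambda>j n. lam j ^ n * T ^ n * exp (- lam j * T) / fact n)"
    and tail_def: "tail = (\<lambda>j m. 1 - (\<Sum>n=0..m. p j n))"
    and trunc_def: "trunc = (\<lambda>N1 N2 N3. \<Sum>n1=0..N1. \<Sum>n2=0..N2. \<Sum>n3=0..N3.
          lam 1 ^ n1 * lam 2 ^ n2 * lam 3 ^ n3 * T ^ (n1 + n2 + n3)
            * exp (- (lam 1 + lam 2 + lam 3) * T) * DC n1 n2 n3 / (fact n1 * fact n2 * fact n3))"
  shows "(\<forall>n1 n2 n3 m1 m2 m3. n1 \<le> m1 \<and> n2 \<le> m2 \<and> n3 \<le> m3 \<longrightarrow> DC m1 m2 m3 \<le> DC n1 n2 n3) \<and>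
    (\<forall>N1 N2 N3.
       trunc N1 N2 N3 \<le> price \<and>
       price \<le> trunc N1 N2 N3
         + DC N1 N2 N3 * tail 1 N1 * tail 2 N2 * tail 3 N3
         + (\<Sum>n1=0..N1. p 1 n1 * DC n1 N2 N3) * tail 2 N2 * tail 3 N3
         + (\<Sum>n2=0..N2. p 2 n2 * DC N1 n2 N3) * tail 1 N1 * tail 3 N3
         + (\<Sum>n3=0..N3. p 3 n3 * DC N1 N2 n3) * tail 1 N1 * tail 2 N2
         + (\<Sum>n1=0..N1. \<Sum>n2=0..N2. p 1 n1 * p 2 n2 * DC n1 n2 N3) * tail 3 N3
         + (\<Sum>n1=0..N1. \<Sum>n3=0..N3. p 1 n1 * p 3 n3 * DC n1 N2 n3) * tail 2 N2
         + (\<Sum>n2=0..N2. \<Sum>n3=0..N3. p 2 n2 * p 3 n3 * DC N1 n2 n3) * tail 1 N1)"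
proof -
  let ?pr = "\<lambda>D w. emeasure M {w'\<in>space M. \<beta> 1 * \<theta> 1 T w + \<sigma> 1 * B 1 (\<theta> 1 T w) w' \<in> D}"
  interpret prob_space M by (fact prob)
  define c where "c = \<beta> 2 + \<beta> 3 + ((\<sigma> 2)\<^sup>2 + (\<sigma> 3)\<^sup>2 + 2 * \<rho> 2 3 * \<sigma> 2 * \<sigma> 3) / 2"
  define \<nu> where "\<nu> = \<alpha> 1 * T"
  define y0 where "y0 = \<mu> 1 * T - ln K"
  have T0: "0 \<le> T" using T by simp
  have sum23: "(\<Sum>j=2..3. \<beta> j + (\<sigma> j)\<^sup>2 / 2) + \<rho> 2 3 * \<sigma> 2 * \<sigma> 3 = c"
  proof -
    have "{2..3::nat} = {2, 3}" by auto
    then show ?thesis by (simp add: c_def field_simps)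
  qed
  have b_c: "b = \<kappa>1 2 * c" unfolding b_def sum23 ..
  have \<gamma>1: "gamma_process M (\<alpha> 1) (\<alpha> 1) (\<theta> 1)" using \<theta>_gamma[of 1] by simp
  have \<alpha>1: "0 < \<alpha> 1" using gamma_process_pos_params[OF \<gamma>1] by simp
  have a: "0 < a" using gamma_process_pos_params[OF \<gamma>_gamma] by simp
  have \<nu>: "0 < \<nu>" using \<alpha>1 T by (simp add: \<nu>_def)
  have \<theta>m: "\<theta> j T \<in> borel_measurable M" if "j \<in> {1,2,3}" for j
    by (rule levy_processD(1)[OF gamma_process_levy[OF \<theta>_gamma[OF that]] T0])
  have \<gamma>_indep_\<theta>: "indep_set (generated_sets M {0..} \<gamma>) (generated_sets M {0..} (\<theta> 1))"
    using indep_sets_imp_indep_set[OF \<gamma>_indep, of 0 1] by simp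

  define Y where "Y w = \<beta> 2 * \<theta> 2 T w + \<sigma> 2 * B 2 (\<theta> 2 T w) w + (\<beta> 3 * \<theta> 3 T w + \<sigma> 3 * B 3 (\<theta> 3 T w) w)" for w
  define X where "X w = \<beta> 1 * \<theta> 1 T w + \<sigma> 1 * B 1 (\<theta> 1 T w) w" for w
  define E\<gamma> where "E\<gamma> = (\<integral>\<^sup>+w. ennreal (exp (\<kappa> 2 * c * \<gamma> T w)) \<partial>M)"
  have tilt: "(\<integral>\<^sup>+w. ennreal (exp (Y w)) * indicator D (X w) \<partial>M) = E\<gamma> *
      (\<integral>\<^sup>+w. ennreal (exp (b * \<theta> 1 T w)) * ?pr D w \<partial>M)"
    if "D \<in> sets borel" for D
    unfolding Y_def X_def E\<gamma>_def b_c c_def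
    by (rule variance_gamma_tilt[OF prob wiener \<rho>12 \<rho>13 \<theta>_gamma \<gamma>_gamma \<theta>_indep_B \<gamma>_indep_\<theta> T \<theta>_eq[OF T0] that])

  define R where "R i = (if i = 0
               then generated_algebra M ({1,2,3::nat} \<times> {0::real..}) (\<lambda>(j, t) w. (\<theta> j t w, B j (\<theta> j t w) w))
               else generated_algebra M {0::real..} (Z i))" for i :: nat
  have R: "space (R i) = space M" for i by (simp add: R_def)
  have R_indep: "indep_sets (\<lambda>i. sets (R i)) {0, 1, 2, 3}"
    using Z_indep by (simp add: R_def if_distrib[where f = sets] cong: if_cong)
  have pair: "(\<lambda>w. (\<theta> j T w, B j (\<theta> j T w) w)) \<in> borel_measurable (R 0)" if "j \<in> {1,2,3}" for j
    using measurable_generated_algebra[of "(j, T)" "{1,2,3} \<times> {0..}" "\<lambda>(j, t) w. (\<theta> j t w, B j (\<theta> j t w) w)" M] that T0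
    by (simp add: R_def)
  have \<theta>R: "\<theta> j T \<in> borel_measurable (R 0)" and BR: "(\<lambda>w. B j (\<theta> j T w) w) \<in> borel_measurable (R 0)" if "j \<in> {1,2,3}" for j
  proof -
    have f: "fst \<in> borel_measurable (borel :: (real \<times> real) measure)" "snd \<in> borel_measurable (borel :: (real \<times> real) measure)"
      by (auto intro!: borel_measurable_continuous_onI continuous_intros)
    show "\<theta> j T \<in> borel_measurable (R 0)" using measurable_compose[OF pair[OF that] f(1)] by simp
    show "(\<lambda>w. B j (\<theta> j T w) w) \<in> borel_measurable (R 0)" using measurable_compose[OF pair[OF that] f(2)] by simp
  qed
  have XR: "X \<in> borel_measurable (R 0)" and YR: "Y \<in> borel_measurable (R 0)"
  proof -
    note [measurable] = \<theta>R[of 1, simplified] \<theta>R[of 2, simplified] \<theta>R[of 3, simplified]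
      BR[of 1, simplified] BR[of 2, simplified] BR[of 3, simplified]
    show "X \<in> borel_measurable (R 0)" "Y \<in> borel_measurable (R 0)" unfolding X_def Y_def by measurable
  qed
  have ZR: "Z i T \<in> borel_measurable (R i)" if "i \<in> {1,2,3}" for i
  proof -
    have "Z i T \<in> borel_measurable (generated_algebra M {0::real..} (Z i))"
      by (rule measurable_generated_algebra) (use T0 in simp)
    then show ?thesis using that by (auto simp: R_def)
  qed
  have RM: "subalgebra M (R i)" if "i \<in> {0,1,2,3}" for i
  proof -
    have "\<forall>i\<in>{0,1,2,3}. sets (R i) \<subseteq> events" using R_indep unfolding indep_sets_def by (rule conjunct1)
    then show ?thesis using that unfolding subalgebra_def R by blast
  qed
  note XM[measurable] = measurable_from_subalg[OF RM XR, simplified]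
    and YM[measurable] = measurable_from_subalg[OF RM YR, simplified]
  have ZM[measurable]: "Z 1 T \<in> borel_measurable M" "Z 2 T \<in> borel_measurable M" "Z 3 T \<in> borel_measurable M"
    using measurable_from_subalg[OF RM ZR] by simp_all

  define g where "g z = ennreal (exp (- z))" for z :: real
  have gm: "g \<in> borel_measurable borel" unfolding g_def by simp
  have jumps: "(\<integral>\<^sup>+w. ennreal (exp (Y w)) * H (Z 1 T w) (X w) * g (Z 2 T w) * g (Z 3 T w) \<partial>M)
    = (\<integral>\<^sup>+w'. \<integral>\<^sup>+w. ennreal (exp (Y w)) * H (Z 1 T w') (X w) \<partial>M \<partial>M)
      * (\<integral>\<^sup>+w. g (Z 2 T w) \<partial>M) * (\<integral>\<^sup>+w. g (Z 3 T w) \<partial>M)"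
    if H: "case_prod H \<in> borel_measurable (borel \<Otimes>\<^sub>M borel)" for H
  proof (rule independent_jumps_nn_integral[where Z = "\<lambda>i. Z i T", OF R_indep R _ XR ZR H gm])
    show "(\<lambda>w. ennreal (exp (Y w))) \<in> borel_measurable (R 0)"
      using YR by measurable
  qed

  \<comment> \<open>the jumps of the second and third asset enter only through \<open>exp (- z)\<close>\<close>
  define \<phi> where "\<phi> j n = expectation (\<lambda>w. exp (- (\<Sum>l=0..n. \<xi> j l w)))" for j n
  define Q where "Q j = (\<Sum>n. p j n * \<phi> j n)" for j
  have lam: "0 \<le> lam j" if "j \<in> {1,2,3}" for j
    using poisson[OF that] by (simp add: poisson_process_def)
  have p0: "0 \<le> p j n" and p1: "p j sums 1" if "j \<in> {1,2,3}" for j n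
    unfolding p_def using poisson_weights[OF lam[OF that] T0] by auto
  have cpexp: "0 \<le> \<phi> j n" "m \<le> n \<Longrightarrow> \<phi> j n \<le> \<phi> j m"
      "(\<integral>\<^sup>+w. g (Z j T w) \<partial>M) = ennreal (Q j)" if j: "j \<in> {1,2,3}" for j m n
    using compound_poisson_expectation(2-4)[OF prob poisson[OF j] N_indep_\<xi>[OF j] \<xi>_0[OF j] \<xi>_nonneg[OF j] T0,
        of "\<lambda>z. exp (- z)" 1]
    by (simp_all add: \<phi>_def Q_def g_def p_def Z_def)
  have Qpos: "0 < Q j" if j: "j \<in> {1,2,3}" for j
  proof -
    have "\<phi> j 0 = expectation (\<lambda>w. 1)"
      unfolding \<phi>_def by (intro Bochner_Integration.integral_cong) (simp_all add: \<xi>_0[OF j])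
    then have "0 < (\<Sum>n=0..0. p j n * \<phi> j n)"
      by (simp add: p_def prob_space)
    also have "\<dots> \<le> Q j"
      unfolding Q_def by (rule weighted_average_truncation(2)[OF p0[OF j] p1[OF j] cpexp(1)[OF j] cpexp(2)[OF j]])
    finally show ?thesis .
  qed

  \<comment> \<open>without the exercise condition the same factorisation computes the expected payment, which is finite\<close>
  have S32: "ennreal (S 3 T w * S 2 T w) = ennreal (exp ((\<mu> 2 + \<mu> 3) * T)) * (ennreal (exp (Y w)) * g (Z 2 T w) * g (Z 3 T w))" for w
  proof -
    have "S 3 T w * S 2 T w = exp ((\<mu> 2 + \<mu> 3) * T) * (exp (Y w) * exp (- Z 2 T w) * exp (- Z 3 T w))"
      unfolding S_def Y_def exp_add[symmetric] by (simp add: algebra_simps)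
    then show ?thesis by (simp add: g_def ennreal_mult'')
  qed
  have finite: "(\<integral>\<^sup>+w. ennreal (S 3 T w * S 2 T w) \<partial>M) < \<infinity>"
  proof -
    have "(\<integral>\<^sup>+w. ennreal (S 3 T w * S 2 T w) \<partial>M) = (\<integral>\<^sup>+w. ennreal (norm (S 3 T w * S 2 T w)) \<partial>M)"
      by (intro nn_integral_cong) (simp add: S_def)
    then show ?thesis using S_integrable by (simp add: integrable_iff_bounded)
  qed
  have total: "(\<integral>\<^sup>+w. ennreal (S 3 T w * S 2 T w) \<partial>M) = ennreal (exp ((\<mu> 2 + \<mu> 3) * T)) *
      (E\<gamma> * (\<integral>\<^sup>+w. ennreal (exp (b * \<theta> 1 T w)) \<partial>M) * ennreal (Q 2) * ennreal (Q 3))"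
  proof -
    have "(\<integral>\<^sup>+w. ennreal (S 3 T w * S 2 T w) \<partial>M) = ennreal (exp ((\<mu> 2 + \<mu> 3) * T)) *
        (\<integral>\<^sup>+w. ennreal (exp (Y w)) * g (Z 2 T w) * g (Z 3 T w) \<partial>M)"
      unfolding S32 by (rule nn_integral_cmult) (simp add: g_def)
    also have "(\<integral>\<^sup>+w. ennreal (exp (Y w)) * g (Z 2 T w) * g (Z 3 T w) \<partial>M)
      = (\<integral>\<^sup>+w. ennreal (exp (Y w)) \<partial>M) * ennreal (Q 2) * ennreal (Q 3)"
      using jumps[of "\<lambda>_ _. 1"] cpexp(3)[of 2] cpexp(3)[of 3] by (simp add: emeasure_space_1)
    also have "(\<integral>\<^sup>+w. ennreal (exp (Y w)) \<partial>M) = E\<gamma> * (\<integral>\<^sup>+w. ennreal (exp (b * \<theta> 1 T w)) \<partial>M)"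
      using tilt[of UNIV] by (simp add: emeasure_space_1)
    finally show ?thesis .
  qed
  \<comment> \<open>none of the four factors vanishes, so each of them must be finite\<close>
  have E\<gamma>0: "E\<gamma> \<noteq> 0"
  proof -
    have "E\<gamma> = ennreal ((a / (a - \<kappa> 2 * c)) powr (a * T)) \<or> E\<gamma> = \<infinity>"
      unfolding E\<gamma>_def using gamma_process_exp_nn_integral[OF \<gamma>_gamma T, of "\<kappa> 2 * c"] by (cases "\<kappa> 2 * c < a") auto
    then show ?thesis
    proof
      assume e: "E\<gamma> = ennreal ((a / (a - \<kappa> 2 * c)) powr (a * T))"
      show ?thesis
      proof (cases "\<kappa> 2 * c < a")
        case True
        then show ?thesis using a by (simp add: e)
      next
        case False
        then show ?thesis unfolding E\<gamma>_def using gamma_process_exp_nn_integral(2)[OF \<gamma>_gamma T, of "\<kappa> 2 * c"] by simp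
      qed
    qed simp
  qed
  have E\<theta>0: "(\<integral>\<^sup>+w. ennreal (exp (b * \<theta> 1 T w)) \<partial>M) \<noteq> 0"
    using gamma_process_exp_nn_integral[OF \<gamma>1 T, of b] \<alpha>1 by (cases "b < \<alpha> 1") auto
  have Q0: "ennreal (Q 2) \<noteq> 0" "ennreal (Q 3) \<noteq> 0" using Qpos[of 2] Qpos[of 3] by auto
  have E\<gamma>_fin: "E\<gamma> \<noteq> \<infinity>"
    using finite E\<theta>0 Q0 unfolding total by (auto simp: ennreal_mult_eq_top_iff less_top[symmetric] ennreal_mult_less_top)
  have E\<theta>_fin: "(\<integral>\<^sup>+w. ennreal (exp (b * \<theta> 1 T w)) \<partial>M) \<noteq> \<infinity>"
    using finite E\<gamma>0 Q0 unfolding total by (auto simp: ennreal_mult_eq_top_iff less_top[symmetric] ennreal_mult_less_top)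
  have b: "b < \<alpha> 1" using E\<theta>_fin gamma_process_exp_nn_integral(2)[OF \<gamma>1 T, of b] by (cases "b < \<alpha> 1") auto
  have ac: "\<kappa> 2 * c < a"
    using E\<gamma>_fin gamma_process_exp_nn_integral(2)[OF \<gamma>_gamma T, of "\<kappa> 2 * c"] unfolding E\<gamma>_def by (cases "\<kappa> 2 * c < a") auto
  define m where "m = (a / (a - \<kappa> 2 * c)) powr (a * T)"
  have E\<gamma>: "E\<gamma> = ennreal m"
    unfolding E\<gamma>_def m_def by (rule gamma_process_exp_nn_integral(1)[OF \<gamma>_gamma T ac])
  have m0: "0 \<le> m" by (simp add: m_def)
  define l where "l = \<alpha> 1 - b"
  have l: "0 < l" using b by (simp add: l_def)

  \<comment> \<open>the normalisation is that of \<open>\<Lambda>\<close> and \<open>\<Xi>\<close>, and \<open>x\<close> stands for the total jump of the first asset\<close>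
  define \<Psi> where "\<Psi> x = sqrt (2 * pi) * (l powr \<nu> * vg_mixture \<nu> l (\<sigma> 1) (\<beta> 1) (y0 - x))" for x
  define k where "k = \<alpha> 1 powr \<nu> / (l powr \<nu> * Gamma \<nu> * sqrt (2 * pi))"
  have k0: "0 \<le> k" using \<nu> by (simp add: k_def Gamma_real_nonneg)
  have \<Psi>0: "0 \<le> \<Psi> x" for x
    unfolding \<Psi>_def by (intro mult_nonneg_nonneg vg_mixture_bounds(1)[OF \<nu> l \<sigma>1]) auto
  have \<Psi>_le: "\<Psi> x \<le> sqrt (2 * pi) * (l powr \<nu> * (Gamma \<nu> / l powr \<nu>))" for x
    unfolding \<Psi>_def by (intro mult_left_mono vg_mixture_bounds(2)[OF \<nu> l \<sigma>1]) auto
  have \<Psi>_mono: "\<Psi> y \<le> \<Psi> x" if "x \<le> y" for x y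
    unfolding \<Psi>_def using that by (intro mult_left_mono vg_mixture_mono[OF \<nu> l \<sigma>1]) auto
  have \<Psi>m[measurable]: "\<Psi> \<in> borel_measurable borel"
    unfolding \<Psi>_def using vg_mixture_measurable[OF \<nu> l \<sigma>1] by measurable
  have tilt_K: "(\<integral>\<^sup>+w. ennreal (exp (Y w)) * indicator {z - y0..} (X w) \<partial>M) = ennreal (m * k) * ennreal (\<Psi> z)" for z
  proof -
    have "(\<integral>\<^sup>+w. ennreal (exp (b * \<theta> 1 T w)) * ?pr {z - y0..} w \<partial>M)
      = (\<integral>\<^sup>+w. ennreal (exp (b * \<theta> 1 T w)) * ennreal (std_normal_cdf ((\<beta> 1 * \<theta> 1 T w + (y0 - z)) / (\<sigma> 1 * sqrt (\<theta> 1 T w)))) \<partial>M)"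
    proof (rule nn_integral_cong_AE)
      show "AE w in M. ennreal (exp (b * \<theta> 1 T w)) * ?pr {z - y0..} w
        = ennreal (exp (b * \<theta> 1 T w)) * ennreal (std_normal_cdf ((\<beta> 1 * \<theta> 1 T w + (y0 - z)) / (\<sigma> 1 * sqrt (\<theta> 1 T w))))"
        using gamma_process_AE_pos[OF \<gamma>1 T]
      proof eventually_elim
        case (elim w)
        have e: "\<beta> 1 * \<theta> 1 T w - (z - y0) = \<beta> 1 * \<theta> 1 T w + (y0 - z)" by simp
        show ?case
          unfolding atLeast_iff wiener_first_probability[OF prob wiener \<rho>12 \<rho>13 elim \<sigma>1] e ..
      qed
    qed
    also have "\<dots> = ennreal (\<alpha> 1 powr \<nu> / Gamma \<nu> * vg_mixture \<nu> l (\<sigma> 1) (\<beta> 1) (y0 - z))"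
      unfolding \<nu>_def l_def by (rule gamma_process_vg_mixture[OF \<gamma>1 T b \<sigma>1])
    also have "\<alpha> 1 powr \<nu> / Gamma \<nu> * vg_mixture \<nu> l (\<sigma> 1) (\<beta> 1) (y0 - z) = k * \<Psi> z"
      using l by (simp add: k_def \<Psi>_def)
    finally have J: "(\<integral>\<^sup>+w. ennreal (exp (b * \<theta> 1 T w)) * ?pr {z - y0..} w \<partial>M)
      = ennreal (k * \<Psi> z)" .
    have "(\<integral>\<^sup>+w. ennreal (exp (Y w)) * indicator {z - y0..} (X w) \<partial>M) = ennreal m * ennreal (k * \<Psi> z)"
      using tilt[of "{z - y0..}"] unfolding J E\<gamma> by simp
    also have "\<dots> = ennreal (m * k) * ennreal (\<Psi> z)"
      using m0 k0 \<Psi>0 by (simp add: ennreal_mult mult.assoc)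
    finally show ?thesis .
  qed
  define \<psi> where "\<psi> n = expectation (\<lambda>w. \<Psi> (\<Sum>l=0..n. \<xi> 1 l w))" for n
  have one: "(1::nat) \<in> {1,2,3}" by simp
  note CP1 = compound_poisson_expectation[OF prob poisson[OF one] N_indep_\<xi>[OF one] \<xi>_0[OF one] \<xi>_nonneg[OF one] T0 \<Psi>m]
  have \<psi>: "0 \<le> \<psi> n" "m \<le> n \<Longrightarrow> \<psi> n \<le> \<psi> m"
      "(\<integral>\<^sup>+w. ennreal (\<Psi> (Z 1 T w)) \<partial>M) = ennreal (\<Sum>n. p 1 n * \<psi> n)" for m n
    using CP1(2-4)[of "sqrt (2 * pi) * (l powr \<nu> * (Gamma \<nu> / l powr \<nu>))"] \<Psi>0 \<Psi>_le \<Psi>_mono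
    by (simp_all add: \<psi>_def p_def Z_def)
  have S1m[measurable]: "(\<lambda>w. \<Sum>l=0..n. \<xi> 1 l w) \<in> borel_measurable M" for n
    using CP1(1)[of "sqrt (2 * pi) * (l powr \<nu> * (Gamma \<nu> / l powr \<nu>))"] \<Psi>0 \<Psi>_le \<Psi>_mono by blast

  define P where "P = (\<Sum>n. p 1 n * \<psi> n)"
  have P0: "0 \<le> P"
    unfolding P_def by (intro suminf_nonneg weighted_average_truncation(1)[OF p0[OF one] p1[OF one]] \<psi> mult_nonneg_nonneg p0[OF one])
  define C where "C = exp ((\<mu> 2 + \<mu> 3 - r) * T) * k * m"
  have C0: "0 \<le> C" using k0 m0 by (simp add: C_def)
  have price: "price = C * (P * Q 2 * Q 3)"
  proof -
    define f where "f w = S 3 T w * S 2 T w * indicator {w. K \<le> S 1 T w} w" for w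
    have exercise: "K \<le> S 1 T w \<longleftrightarrow> Z 1 T w - y0 \<le> X w" for w
    proof -
      have "K \<le> S 1 T w \<longleftrightarrow> ln K \<le> \<mu> 1 * T + \<beta> 1 * \<theta> 1 T w + \<sigma> 1 * B 1 (\<theta> 1 T w) w - Z 1 T w"
        unfolding S_def by (metis K exp_le_cancel_iff exp_ln)
      then show ?thesis unfolding X_def y0_def by (auto simp: algebra_simps)
    qed
    define H where "H z x = (indicator {z - y0..} x :: ennreal)" for z x
    have H: "case_prod H \<in> borel_measurable (borel \<Otimes>\<^sub>M borel)"
    proof -
      have "case_prod H = (\<lambda>p. indicator {p. fst p - y0 \<le> snd p} p)"
        by (auto simp: H_def fun_eq_iff indicator_def)
      moreover have "(\<lambda>p. indicator {p. fst p - y0 \<le> snd p} p :: ennreal) \<in> borel_measurable (borel \<Otimes>\<^sub>M borel)"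
        by measurable
      ultimately show ?thesis by simp
    qed
    have f: "ennreal (f w) = ennreal (exp ((\<mu> 2 + \<mu> 3) * T)) * (ennreal (exp (Y w)) * H (Z 1 T w) (X w) * g (Z 2 T w) * g (Z 3 T w))" for w
    proof -
      have "ennreal (f w) = ennreal (S 3 T w * S 2 T w) * H (Z 1 T w) (X w)"
        by (auto simp: f_def H_def indicator_def exercise)
      then show ?thesis unfolding S32 by (simp add: mult_ac)
    qed
    have "(\<integral>\<^sup>+w. ennreal (f w) \<partial>M) = ennreal (exp ((\<mu> 2 + \<mu> 3) * T)) *
       (\<integral>\<^sup>+w. ennreal (exp (Y w)) * H (Z 1 T w) (X w) * g (Z 2 T w) * g (Z 3 T w) \<partial>M)"
      unfolding f
    proof (rule nn_integral_cmult)
      have "(\<lambda>w. H (Z 1 T w) (X w)) \<in> borel_measurable M"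
        using measurable_compose[OF measurable_Pair[OF ZM(1) XM] H] by simp
      then show "(\<lambda>w. ennreal (exp (Y w)) * H (Z 1 T w) (X w) * g (Z 2 T w) * g (Z 3 T w)) \<in> borel_measurable M"
        unfolding g_def by measurable
    qed
    also have "\<dots> = ennreal (exp ((\<mu> 2 + \<mu> 3) * T)) *
       ((\<integral>\<^sup>+w'. ennreal (m * k) * ennreal (\<Psi> (Z 1 T w')) \<partial>M) * ennreal (Q 2) * ennreal (Q 3))"
      unfolding jumps[OF H] using cpexp(3)[of 2] cpexp(3)[of 3] by (simp add: H_def tilt_K)
    also have "(\<integral>\<^sup>+w'. ennreal (m * k) * ennreal (\<Psi> (Z 1 T w')) \<partial>M) = ennreal (m * k) * ennreal P"
      unfolding P_def \<psi>(3)[symmetric] by (rule nn_integral_cmult) simp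
    also have "ennreal (exp ((\<mu> 2 + \<mu> 3) * T)) * (ennreal (m * k) * ennreal P * ennreal (Q 2) * ennreal (Q 3))
      = ennreal (exp ((\<mu> 2 + \<mu> 3) * T) * (m * k * P * Q 2 * Q 3))"
      using m0 k0 P0 Qpos[of 2] Qpos[of 3] by (simp add: ennreal_mult less_imp_le)
    finally have nn: "(\<integral>\<^sup>+w. ennreal (f w) \<partial>M) = ennreal (exp ((\<mu> 2 + \<mu> 3) * T) * (m * k * P * Q 2 * Q 3))" .
    have Sm: "(\<lambda>w. S 3 T w * S 2 T w) \<in> borel_measurable M"
      by (rule borel_measurable_integrable[OF S_integrable])
    have "has_bochner_integral M f (exp ((\<mu> 2 + \<mu> 3) * T) * (m * k * P * Q 2 * Q 3))"
    proof (rule has_bochner_integral_nn_integral[OF _ _ _ nn])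
      have "f = (\<lambda>w. S 3 T w * S 2 T w * indicator {z. 0 \<le> z} (X w - (Z 1 T w - y0)))"
        by (auto simp: f_def fun_eq_iff indicator_def exercise)
      also have "\<dots> \<in> borel_measurable M"
        by (intro borel_measurable_times Sm) measurable
      finally show "f \<in> borel_measurable M" .
      show "AE w in M. 0 \<le> f w" by (auto simp: f_def S_def)
      show "0 \<le> exp ((\<mu> 2 + \<mu> 3) * T) * (m * k * P * Q 2 * Q 3)"
        using m0 k0 P0 Qpos[of 2] Qpos[of 3] by (simp add: less_imp_le)
    qed
    then have "price = exp (- r * T) * (exp ((\<mu> 2 + \<mu> 3) * T) * (m * k * P * Q 2 * Q 3))"
      unfolding price_def f_def by (simp add: has_bochner_integral_iff)
    moreover have "exp ((\<mu> 2 + \<mu> 3 - r) * T) = exp (- r * T) * exp ((\<mu> 2 + \<mu> 3) * T)"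
      unfolding exp_add[symmetric] by (simp add: algebra_simps)
    ultimately show ?thesis by (simp add: C_def mult_ac)
  qed

  \<comment> \<open>the parameter \<open>s x\<close> vanishes exactly when \<open>x = y0\<close>, which separates the two closed forms\<close>
  define D where "D = sqrt ((\<beta> 1)\<^sup>2 + 2 * l * (\<sigma> 1)\<^sup>2)"
  have \<Psi>_y0: "\<Psi> y0 = \<Lambda>"
    unfolding \<Psi>_def \<Lambda>_def using vg_mixture_zero[OF \<nu> l \<sigma>1, of "\<beta> 1"] by (simp add: \<nu>_def l_def)
  have \<Psi>_\<Xi>: "\<Psi> x = \<Xi> x" if "x \<noteq> y0" for x
  proof -
    have y: "y0 - x \<noteq> 0" using that by simp
    have q: "q = \<beta> 1 / D" unfolding q_def D_def l_def ..
    have s: "s x = (y0 - x) * D / (\<sigma> 1)\<^sup>2" unfolding s_def y0_def D_def l_def ..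
    show ?thesis
      using vg_mixture_nonzero[OF \<nu> l \<sigma>1 y, of "\<beta> 1", folded D_def, folded q s]
      unfolding \<Psi>_def \<Xi>_def A_def \<nu>_def by simp
  qed
  have closed_form: "\<Lambda> * measure M {w \<in> space M. (\<Sum>l=0..n1. \<xi> 1 l w) = \<mu> 1 * T - ln K}
             + expectation (\<lambda>w. \<Xi> (\<Sum>l=0..n1. \<xi> 1 l w)
                 * indicator {w. (\<Sum>l=0..n1. \<xi> 1 l w) \<noteq> \<mu> 1 * T - ln K} w) = \<psi> n1" for n1
  proof -
    define W where "W w = (\<Sum>l=0..n1. \<xi> 1 l w)" for w
    have [measurable]: "W \<in> borel_measurable M" unfolding W_def by (rule S1m)
    have eq: "\<Xi> (W w) * indicator {w. W w \<noteq> y0} w = \<Psi> (W w) * indicator (- {y0}) (W w)" for w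
      by (cases "W w = y0") (simp_all add: \<Psi>_\<Xi> indicator_def)
    have bound: "\<bar>\<Psi> x\<bar> \<le> sqrt (2 * pi) * (l powr \<nu> * (Gamma \<nu> / l powr \<nu>))" for x
      using \<Psi>0[of x] \<Psi>_le[of x] by simp
    have int: "integrable M (\<lambda>w. \<Psi> (W w) * indicator (- {y0}) (W w))"
    proof (rule integrable_const_bound)
      show "AE w in M. norm (\<Psi> (W w) * indicator (- {y0}) (W w)) \<le> sqrt (2 * pi) * (l powr \<nu> * (Gamma \<nu> / l powr \<nu>))"
        using bound order_trans[OF abs_ge_zero bound] by (intro AE_I2) (auto simp: indicator_def)
    qed measurable
    have ev: "{w \<in> space M. W w = y0} \<in> sets M" by measurable
    have int': "integrable M (\<lambda>w. \<Lambda> * indicator {w \<in> space M. W w = y0} w)"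
      using ev by (intro integrable_mult_right integrable_real_indicator) (auto simp: emeasure_eq_measure)
    have "\<psi> n1 = expectation (\<lambda>w. \<Lambda> * indicator {w \<in> space M. W w = y0} w + \<Psi> (W w) * indicator (- {y0}) (W w))"
      unfolding \<psi>_def W_def[symmetric]
      by (intro Bochner_Integration.integral_cong) (auto simp: indicator_def \<Psi>_y0)
    also have "\<dots> = \<Lambda> * measure M {w \<in> space M. W w = y0} + expectation (\<lambda>w. \<Psi> (W w) * indicator (- {y0}) (W w))"
      using ev by (subst Bochner_Integration.integral_add[OF int' int]) simp
    finally show ?thesis unfolding W_def[symmetric] y0_def[symmetric] eq by simp
  qed
  have DC: "DC n1 n2 n3 = C * (\<psi> n1 * \<phi> 2 n2 * \<phi> 3 n3)" for n1 n2 n3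
    unfolding DC_def closed_form sum23 \<phi>_def[symmetric] C_def k_def m_def l_def \<nu>_def by simp

  define t1 where "t1 N = (\<Sum>n=0..N. p 1 n * \<psi> n)" for N
  define t where "t j N = (\<Sum>n=0..N. p j n * \<phi> j n)" for j N
  have two: "(2::nat) \<in> {1,2,3}" and three: "(3::nat) \<in> {1,2,3}" by simp_all
  have w1: "t1 N \<le> P" "P \<le> t1 N + \<psi> N * tail 1 N" for N
    unfolding t1_def P_def tail_def
    by (rule weighted_average_truncation(2,3)[OF p0[OF one] p1[OF one] \<psi>(1,2)], assumption)+
  have wj: "t j N \<le> Q j" "Q j \<le> t j N + \<phi> j N * tail j N" if j: "j \<in> {1,2,3}" for j N
    unfolding t_def Q_def tail_def
    by (rule weighted_average_truncation(2,3)[OF p0[OF j] p1[OF j] cpexp(1,2)[OF j]], assumption)+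
  have t1_0: "0 \<le> t1 N" for N
    unfolding t1_def by (intro sum_nonneg mult_nonneg_nonneg p0[OF one] \<psi>(1))
  have t_0: "0 \<le> t j N" if j: "j \<in> {1,2,3}" for j N
    unfolding t_def by (intro sum_nonneg mult_nonneg_nonneg p0[OF j] cpexp(1)[OF j])
  have trunc: "trunc N1 N2 N3 = C * (t1 N1 * t 2 N2 * t 3 N3)" for N1 N2 N3
  proof -
    have "lam 1 ^ n1 * lam 2 ^ n2 * lam 3 ^ n3 * T ^ (n1 + n2 + n3)
            * exp (- (lam 1 + lam 2 + lam 3) * T) * DC n1 n2 n3 / (fact n1 * fact n2 * fact n3)
        = C * ((p 1 n1 * \<psi> n1) * (p 2 n2 * \<phi> 2 n2) * (p 3 n3 * \<phi> 3 n3))" for n1 n2 n3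
    proof -
      have "exp (- (lam 1 + lam 2 + lam 3) * T) = exp (- lam 1 * T) * exp (- lam 2 * T) * exp (- lam 3 * T)"
        unfolding exp_add[symmetric] by (simp add: algebra_simps)
      then show ?thesis unfolding DC p_def by (simp add: power_add)
    qed
    then have "trunc N1 N2 N3 = (\<Sum>n1=0..N1. \<Sum>n2=0..N2. \<Sum>n3=0..N3.
        C * ((p 1 n1 * \<psi> n1) * (p 2 n2 * \<phi> 2 n2) * (p 3 n3 * \<phi> 3 n3)))"
      by (simp only: trunc_def)
    also have "\<dots> = C * (t1 N1 * t 2 N2 * t 3 N3)"
      unfolding t1_def t_def by (simp only: sum_distrib_left[symmetric] sum_distrib_right[symmetric])
    finally show ?thesis .
  qed
  have double: "(\<Sum>i=0..I. \<Sum>j=0..J. u i j) = d * ((\<Sum>i=0..I. f i) * (\<Sum>j=0..J. h j))"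
    if "\<And>i j. u i j = d * (f i * h j)" for u :: "nat \<Rightarrow> nat \<Rightarrow> real" and f h d I J
    unfolding that by (simp only: sum_distrib_left[symmetric] sum_distrib_right[symmetric])
  show ?thesis
  proof (intro conjI allI impI)
    fix n1 n2 n3 m1 m2 m3 :: nat
    assume le: "n1 \<le> m1 \<and> n2 \<le> m2 \<and> n3 \<le> m3"
    show "DC m1 m2 m3 \<le> DC n1 n2 n3"
      unfolding DC using le C0
      by (intro mult_left_mono mult_mono \<psi>(1,2) cpexp(1,2) mult_nonneg_nonneg) auto
  next
    fix N1 N2 N3
    show "trunc N1 N2 N3 \<le> price"
      unfolding trunc price
      by (rule three_factor_truncation(1)[OF C0 t1_0 t_0[OF two] t_0[OF three] w1(1) wj(1)[OF two] wj(1)[OF three]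
        w1(2) wj(2)[OF two] wj(2)[OF three]])
  next
    fix N1 N2 N3
    have s1: "(\<Sum>n1=0..N1. p 1 n1 * DC n1 N2 N3) = C * t1 N1 * (\<phi> 2 N2 * \<phi> 3 N3)"
      and s2: "(\<Sum>n2=0..N2. p 2 n2 * DC N1 n2 N3) = C * t 2 N2 * (\<psi> N1 * \<phi> 3 N3)"
      and s3: "(\<Sum>n3=0..N3. p 3 n3 * DC N1 N2 n3) = C * t 3 N3 * (\<psi> N1 * \<phi> 2 N2)"
      unfolding DC t1_def t_def by (simp_all add: sum_distrib_left sum_distrib_right mult_ac)
    have s12: "(\<Sum>n1=0..N1. \<Sum>n2=0..N2. p 1 n1 * p 2 n2 * DC n1 n2 N3) = (C * \<phi> 3 N3) * (t1 N1 * t 2 N2)"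
      and s13: "(\<Sum>n1=0..N1. \<Sum>n3=0..N3. p 1 n1 * p 3 n3 * DC n1 N2 n3) = (C * \<phi> 2 N2) * (t1 N1 * t 3 N3)"
      and s23: "(\<Sum>n2=0..N2. \<Sum>n3=0..N3. p 2 n2 * p 3 n3 * DC N1 n2 n3) = (C * \<psi> N1) * (t 2 N2 * t 3 N3)"
      unfolding DC t1_def t_def by (rule double, simp add: mult_ac)+
    show "price \<le> trunc N1 N2 N3
         + DC N1 N2 N3 * tail 1 N1 * tail 2 N2 * tail 3 N3
         + (\<Sum>n1=0..N1. p 1 n1 * DC n1 N2 N3) * tail 2 N2 * tail 3 N3
         + (\<Sum>n2=0..N2. p 2 n2 * DC N1 n2 N3) * tail 1 N1 * tail 3 N3
         + (\<Sum>n3=0..N3. p 3 n3 * DC N1 N2 n3) * tail 1 N1 * tail 2 N2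
         + (\<Sum>n1=0..N1. \<Sum>n2=0..N2. p 1 n1 * p 2 n2 * DC n1 n2 N3) * tail 3 N3
         + (\<Sum>n1=0..N1. \<Sum>n3=0..N3. p 1 n1 * p 3 n3 * DC n1 N2 n3) * tail 2 N2
         + (\<Sum>n2=0..N2. \<Sum>n3=0..N3. p 2 n2 * p 3 n3 * DC N1 n2 n3) * tail 1 N1"
      unfolding s1 s2 s3 s12 s13 s23 unfolding trunc price DC
      using three_factor_truncation(2)[OF C0 t1_0 t_0[OF two] t_0[OF three] w1(1) wj(1)[OF two] wj(1)[OF three]
        w1(2) wj(2)[OF two] wj(2)[OF three], of N1 N2 N3]
      by (simp add: mult_ac)
  qed
qed

end
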